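(* Let $M$ be an oriented biconservative hypersurface of index $2$ in the pseudo-Euclidean space $\mathbb E^5_2$. Assume that, with respect to an orthonormal frame field $\{e_1=\nabla H/\|\nabla H\|,e_2,e_3,e_4\}$ of principal directions, its shape operator has the form $$S=\mathrm{diag}(k_1,0,0,k_4),\qquad k_4\neq 0 .$$ Then $M$ is (locally) congruent to one of the following eight types of generalized cylinders over surfaces, for some smooth functions $\phi=\phi(s)$ and $\psi=\psi(s)$: (i) $x(s,t,u,v)=(t,u,\phi\cos v,\phi\sin v,\psi)$, with $\phi'^2+\psi'^2=1$; (ii) $x(s,t,u,v)=(\phi\sinh v,t,u,\phi\cosh v,\psi)$, with $\phi'^2+\psi'^2=1$; (iii) $x(s,t,u,v)=(\psi,t,u,\phi\cos v,\phi\sin v)$, with $\phi'^2-\psi'^2=-1$; (iv) $x(s,t,u,v)=(\phi\cosh v,t,u,\phi\sinh v,\psi)$, with $\phi'^2-\psi'^2=1$; (v) $x(s,t,u,v)=\left(\frac{v^2s}{2}+\psi+s,\;t,\;u,\;vs,\;\frac{v^2s}{2}+\psi\right)$, with $1+2\psi'>0$; (vi) $x(s,t,u,v)=(\phi\cos v,\phi\sin v,t,u,\psi)$, with $\phi'^2-\psi'^2=1$; (vii) $x(s,t,u,v)=(\phi\sinh v,\psi,t,u,\phi\cosh v)$, with $\phi'^2-\psi'^2=-1$; (viii) $x(s,t,u,v)=\left(\frac{sv^2}{2}+\psi,\;sv,\;t,\;u,\;\frac{sv^2}{2}+\psi+s\right)$, with $1+2\psi'<0$.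
   Context: $\mathbb E^5_2$ is $\mathbb R^5$ with the metric $\langle\cdot,\cdot\rangle=-dx_1^2-dx_2^2+dx_3^2+dx_4^2+dx_5^2$. Hypersurfaces are smooth and connected. A hypersurface $x:M\to\mathbb E^5_2$ of index $2$ is one whose induced metric is non-degenerate of index $2$; its unit normal $N$ then satisfies $\langle N,N\rangle=1$. The shape operator is $S(X)=-\widetilde\nabla_XN$, where $\widetilde\nabla$ is the flat connection of $\mathbb E^5_2$, and the mean curvature is $H=\frac14\operatorname{tr}S$. $\nabla H$ is the gradient of $H$ for the induced metric and $\|\nabla H\|=|\langle\nabla H,\nabla H\rangle|^{1/2}$. $M$ is biconservative if the tangential part of $\Delta^2x$ vanishes identically ($\Delta$ the Laplace operator of $M$); for these hypersurfaces this is equivalent to $S(\nabla H)=-2H\nabla H$. Standing assumptions: $\nabla H$ vanishes nowhere and is nowhere light-like, so that $e_1=\nabla H/\|\nabla H\|$ is a unit principal direction with principal curvature $k_1=-2H$; moreover $k_1$ differs everywhere from the other principal curvatures. The result is local: "congruent to one of" means that every point of $M$ has a neighbourhood which, up to an isometry of $\mathbb E^5_2$, is parametrized by one of the listed maps on some open set of parameters $(s,t,u,v)$. Primes denote $d/ds$. *)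

theory Defs
  imports "HOL-Analysis.Analysis"
begin

section \<open>The pseudo-Euclidean space of dimension 5 and index 2\<close>

definition sprod :: "real^5 \<Rightarrow> real^5 \<Rightarrow> real" where
  "sprod a b = - (a$1 * b$1) - a$2 * b$2 + a$3 * b$3 + a$4 * b$4 + a$5 * b$5"

definition pe_isometry :: "(real^5 \<Rightarrow> real^5) \<Rightarrow> bool" where
  "pe_isometry \<Phi> \<longleftrightarrow>
     (\<exists>L b. linear L \<and> (\<forall>a c. sprod (L a) (L c) = sprod a c) \<and> (\<forall>a. \<Phi> a = L a + b))"

definition nondegenerate_on :: "(real^5) set \<Rightarrow> bool" where
  "nondegenerate_on T \<longleftrightarrow> (\<forall>a\<in>T. (\<forall>b\<in>T. sprod a b = 0) \<longrightarrow> a = 0)"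

definition index_on :: "(real^5) set \<Rightarrow> nat" where
  "index_on T = Max {dim W | W. subspace W \<and> W \<subseteq> T \<and> (\<forall>w\<in>W. w \<noteq> 0 \<longrightarrow> sprod w w < 0)}"


section \<open>Smooth maps\<close>

text \<open>Smoothness is only used on open sets, so derivatives are taken with respect to the
  full neighbourhood filter.\<close>

fun Ck_on :: "nat \<Rightarrow> ('a::real_normed_vector \<Rightarrow> 'b::real_normed_vector) \<Rightarrow> 'a set \<Rightarrow> bool" where
  "Ck_on 0 f U \<longleftrightarrow> continuous_on U f"
| "Ck_on (Suc n) f U \<longleftrightarrow>
     (\<forall>q\<in>U. f differentiable (at q)) \<and> (\<forall>h. Ck_on n (\<lambda>q. frechet_derivative f (at q) h) U)"

definition smooth_on :: "('a::real_normed_vector \<Rightarrow> 'b::real_normed_vector) \<Rightarrow> 'a set \<Rightarrow> bool" where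
  "smooth_on f U \<longleftrightarrow> (\<forall>n. Ck_on n f U)"


section \<open>Smooth 4-manifolds\<close>

text \<open>An atlas is given by local parametrizations, that is, by inverses of charts:
  a pair \<open>(V, \<psi>)\<close> consists of an open set \<open>V\<close> of coordinates and a homeomorphism \<open>\<psi>\<close> of \<open>V\<close>
  onto an open subset of the manifold.\<close>

type_synonym 'm param = "(real^4) set \<times> (real^4 \<Rightarrow> 'm)"

definition local_param :: "'m topology \<Rightarrow> 'm param \<Rightarrow> bool" where
  "local_param M = (\<lambda>(V, \<psi>). open V \<and> openin M (\<psi> ` V) \<and>
     homeomorphic_map (top_of_set V) (subtopology M (\<psi> ` V)) \<psi>)"

definition smooth_transition :: "'m param \<Rightarrow> 'm param \<Rightarrow> bool" where
  "smooth_transition = (\<lambda>(V, \<psi>) (V', \<psi>').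
     smooth_on (inv_into V' \<psi>' \<circ> \<psi>) {q \<in> V. \<psi> q \<in> \<psi>' ` V'})"

definition smooth_manifold :: "'m topology \<Rightarrow> 'm param set \<Rightarrow> bool" where
  "smooth_manifold M A \<longleftrightarrow>
     Hausdorff_space M \<and> second_countable M \<and>
     (\<forall>c\<in>A. local_param M c) \<and>
     topspace M = (\<Union>(V, \<psi>)\<in>A. \<psi> ` V) \<and>
     (\<forall>c\<in>A. \<forall>c'\<in>A. smooth_transition c c')"

text \<open>Membership in the maximal atlas generated by \<open>A\<close>.\<close>

definition admissible_param :: "'m topology \<Rightarrow> 'm param set \<Rightarrow> 'm param \<Rightarrow> bool" where
  "admissible_param M A c \<longleftrightarrow>
     local_param M c \<and> (\<forall>c'\<in>A. smooth_transition c c' \<and> smooth_transition c' c)"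

definition smooth_field :: "'m param set \<Rightarrow> ('m \<Rightarrow> 'b::real_normed_vector) \<Rightarrow> bool" where
  "smooth_field A f \<longleftrightarrow> (\<forall>(V, \<psi>)\<in>A. smooth_on (f \<circ> \<psi>) V)"


section \<open>Local geometry of a parametrized hypersurface\<close>

text \<open>In this section \<open>y\<close> is the coordinate expression of an immersion, defined near the
  point \<open>q\<close>. Tangent vectors are identified with their images in the ambient space, and
  functions and vector fields on the hypersurface are given in the coordinates of \<open>y\<close>.\<close>

definition tangent_space :: "(real^4 \<Rightarrow> real^5) \<Rightarrow> real^4 \<Rightarrow> (real^5) set" where
  "tangent_space y q = range (frechet_derivative y (at q))"

definition tangential_part :: "(real^4 \<Rightarrow> real^5) \<Rightarrow> real^4 \<Rightarrow> real^5 \<Rightarrow> real^5" where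
  "tangential_part y q w =
     (THE t. t \<in> tangent_space y q \<and> (\<forall>z \<in> tangent_space y q. sprod (w - t) z = 0))"

text \<open>The derivative of \<open>F\<close> in the direction of the tangent vector \<open>w\<close>, i.e. the flat
  connection when \<open>F\<close> takes values in the ambient space. The inverse is only applied to
  elements of the range of the (injective) differential of \<open>y\<close>.\<close>

definition deriv_along ::
    "(real^4 \<Rightarrow> real^5) \<Rightarrow> (real^4 \<Rightarrow> 'b::real_normed_vector) \<Rightarrow> real^4 \<Rightarrow> real^5 \<Rightarrow> 'b" where
  "deriv_along y F q w = frechet_derivative F (at q) (inv (frechet_derivative y (at q)) w)"

text \<open>The trace of an endomorphism of the tangent space, computed in the coordinate basis.\<close>

definition tangent_trace :: "(real^4 \<Rightarrow> real^5) \<Rightarrow> real^4 \<Rightarrow> (real^5 \<Rightarrow> real^5) \<Rightarrow> real" where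
  "tangent_trace y q L =
     trace (matrix (\<lambda>\<xi>. inv (frechet_derivative y (at q)) (L (frechet_derivative y (at q) \<xi>))))"

definition gradient :: "(real^4 \<Rightarrow> real^5) \<Rightarrow> (real^4 \<Rightarrow> real) \<Rightarrow> real^4 \<Rightarrow> real^5" where
  "gradient y f q =
     (THE t. t \<in> tangent_space y q \<and> (\<forall>z \<in> tangent_space y q. sprod t z = deriv_along y f q z))"

text \<open>The Levi-Civita connection of the induced metric is the tangential part of the flat
  connection.\<close>

definition levi_civita ::
    "(real^4 \<Rightarrow> real^5) \<Rightarrow> (real^4 \<Rightarrow> real^5) \<Rightarrow> real^4 \<Rightarrow> real^5 \<Rightarrow> real^5" where
  "levi_civita y Z q w = tangential_part y q (deriv_along y Z q w)"

definition div_tangent :: "(real^4 \<Rightarrow> real^5) \<Rightarrow> (real^4 \<Rightarrow> real^5) \<Rightarrow> real^4 \<Rightarrow> real" where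
  "div_tangent y Z q = tangent_trace y q (levi_civita y Z q)"

definition laplace :: "(real^4 \<Rightarrow> real^5) \<Rightarrow> (real^4 \<Rightarrow> real) \<Rightarrow> real^4 \<Rightarrow> real" where
  "laplace y f = div_tangent y (gradient y f)"

definition laplace_vec :: "(real^4 \<Rightarrow> real^5) \<Rightarrow> (real^4 \<Rightarrow> real^5) \<Rightarrow> real^4 \<Rightarrow> real^5" where
  "laplace_vec y F q = (\<chi> i. laplace y (\<lambda>r. F r $ i) q)"

definition shape_operator ::
    "(real^4 \<Rightarrow> real^5) \<Rightarrow> (real^4 \<Rightarrow> real^5) \<Rightarrow> real^4 \<Rightarrow> real^5 \<Rightarrow> real^5" where
  "shape_operator y n q w = - deriv_along y n q w"

definition mean_curvature :: "(real^4 \<Rightarrow> real^5) \<Rightarrow> (real^4 \<Rightarrow> real^5) \<Rightarrow> real^4 \<Rightarrow> real" where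
  "mean_curvature y n q = tangent_trace y q (shape_operator y n q) / 4"

definition grad_H :: "(real^4 \<Rightarrow> real^5) \<Rightarrow> (real^4 \<Rightarrow> real^5) \<Rightarrow> real^4 \<Rightarrow> real^5" where
  "grad_H y n = gradient y (mean_curvature y n)"

definition pnorm :: "real^5 \<Rightarrow> real" where
  "pnorm w = sqrt \<bar>sprod w w\<bar>"


section \<open>Hypersurfaces of index 2\<close>

text \<open>All pointwise notions below are invariant under change of parametrization; they are
  required in every parametrization of the atlas.\<close>

definition hypersurface_index2 ::
    "'m topology \<Rightarrow> 'm param set \<Rightarrow> ('m \<Rightarrow> real^5) \<Rightarrow> bool" where
  "hypersurface_index2 M A x \<longleftrightarrow>
     smooth_manifold M A \<and> connected_space M \<and> smooth_field A x \<and>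
     (\<forall>(V, \<psi>)\<in>A. \<forall>q\<in>V.
        inj (frechet_derivative (x \<circ> \<psi>) (at q)) \<and>
        nondegenerate_on (tangent_space (x \<circ> \<psi>) q) \<and>
        index_on (tangent_space (x \<circ> \<psi>) q) = 2)"

text \<open>An orientation of a hypersurface is a choice of a globally defined unit normal field.\<close>

definition unit_normal :: "'m param set \<Rightarrow> ('m \<Rightarrow> real^5) \<Rightarrow> ('m \<Rightarrow> real^5) \<Rightarrow> bool" where
  "unit_normal A x N \<longleftrightarrow>
     smooth_field A N \<and>
     (\<forall>(V, \<psi>)\<in>A. \<forall>q\<in>V. sprod (N (\<psi> q)) (N (\<psi> q)) = 1 \<and>
        (\<forall>w \<in> tangent_space (x \<circ> \<psi>) q. sprod (N (\<psi> q)) w = 0))"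

definition biconservative :: "'m param set \<Rightarrow> ('m \<Rightarrow> real^5) \<Rightarrow> bool" where
  "biconservative A x \<longleftrightarrow>
     (\<forall>(V, \<psi>)\<in>A. \<forall>q\<in>V. let y = x \<circ> \<psi> in
        tangential_part y q (laplace_vec y (laplace_vec y y) q) = 0)"

definition orthonormal_frame ::
    "'m param set \<Rightarrow> ('m \<Rightarrow> real^5) \<Rightarrow> (4 \<Rightarrow> 'm \<Rightarrow> real^5) \<Rightarrow> bool" where
  "orthonormal_frame A x e \<longleftrightarrow>
     (\<forall>i. smooth_field A (e i)) \<and>
     (\<forall>(V, \<psi>)\<in>A. \<forall>q\<in>V.
        (\<forall>i. e i (\<psi> q) \<in> tangent_space (x \<circ> \<psi>) q \<and> \<bar>sprod (e i (\<psi> q)) (e i (\<psi> q))\<bar> = 1) \<and>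
        (\<forall>i j. i \<noteq> j \<longrightarrow> sprod (e i (\<psi> q)) (e j (\<psi> q)) = 0))"

definition principal_frame ::
    "'m param set \<Rightarrow> ('m \<Rightarrow> real^5) \<Rightarrow> ('m \<Rightarrow> real^5) \<Rightarrow> (4 \<Rightarrow> 'm \<Rightarrow> real^5) \<Rightarrow> (4 \<Rightarrow> 'm \<Rightarrow> real) \<Rightarrow> bool"
  where
  "principal_frame A x N e k \<longleftrightarrow>
     orthonormal_frame A x e \<and>
     (\<forall>(V, \<psi>)\<in>A. \<forall>q\<in>V. \<forall>i.
        shape_operator (x \<circ> \<psi>) (N \<circ> \<psi>) q (e i (\<psi> q)) = k i (\<psi> q) *\<^sub>R e i (\<psi> q))"


section \<open>Generalized cylinders over surfaces\<close>

text \<open>\<open>vector\<close> enumerates the components as \<open>1, \<dots>, 5\<close>.\<close>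

lemma vector_5:
  "(vector [a, b, c, d, e] :: 'a::zero^5) $ 1 = a"
  "(vector [a, b, c, d, e] :: 'a::zero^5) $ 2 = b"
  "(vector [a, b, c, d, e] :: 'a::zero^5) $ 3 = c"
  "(vector [a, b, c, d, e] :: 'a::zero^5) $ 4 = d"
  "(vector [a, b, c, d, e] :: 'a::zero^5) $ 5 = e"
  unfolding vector_def by simp_all

text \<open>The immersion \<open>x\<close> is, near the point \<open>p\<close> and up to an isometry of the ambient space,
  parametrized by \<open>(s, t, u, v) \<mapsto> F s t u v\<close>, where \<open>s\<close> ranges within \<open>I\<close>.\<close>

definition congruent_near ::
    "'m topology \<Rightarrow> 'm param set \<Rightarrow> ('m \<Rightarrow> real^5) \<Rightarrow> 'm \<Rightarrow> real set \<Rightarrow>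
     (real \<Rightarrow> real \<Rightarrow> real \<Rightarrow> real \<Rightarrow> real^5) \<Rightarrow> bool" where
  "congruent_near M A x p I F \<longleftrightarrow>
     (\<exists>\<Phi> W \<theta>. pe_isometry \<Phi> \<and> admissible_param M A (W, \<theta>) \<and> p \<in> \<theta> ` W \<and>
        (\<forall>w\<in>W. w$1 \<in> I \<and> \<Phi> (x (\<theta> w)) = F (w$1) (w$2) (w$3) (w$4)))"

end

theory Submission
  imports Defs
begin

text \<open>
  With the dual coframe \<open>\<omega>\<^sub>1, \<dots>, \<omega>\<^sub>4\<close> of the principal frame, the \<open>e\<^sub>1\<close>-component of the bilaplacian of the
  position vector gives \<open>k\<^sub>4 = - 3 k\<^sub>1\<close>. The Codazzi equations and the symmetry of the Hessian of the mean
  curvature then show that \<open>e\<^sub>1\<close>, \<open>e\<^sub>4\<close> and the normal \<open>n\<close> are constant along \<open>e\<^sub>2\<close> and \<open>e\<^sub>3\<close>, and that their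
  derivatives along \<open>e\<^sub>1\<close> and \<open>e\<^sub>4\<close> involve only \<open>k\<^sub>4\<close> and one further function \<open>\<theta>\<close>. Hence the span of \<open>e\<^sub>1\<close>,
  \<open>e\<^sub>4\<close>, \<open>n\<close> is a fixed space, which splits off a plane of rulings. In this space the direction of
  \<open>\<theta> n + k\<^sub>4 e\<^sub>1\<close> is constant and the orthogonal companion \<open>k\<^sub>4 n - \<epsilon>\<^sub>1 \<theta> e\<^sub>1\<close> rotates with \<open>e\<^sub>4\<close>: the profile
  is a surface of revolution, whose axis is spacelike, timelike or lightlike. The arc length \<open>s\<close> and the angle \<open>v\<close>
  are primitives of the closed forms \<open>\<omega>\<^sub>1\<close> and \<open>g \<omega>\<^sub>4\<close>, with \<open>g\<close> the reciprocal radius; for a lightlike axis the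
  radius itself serves as \<open>s\<close>. Together with the two ruling coordinates they form a chart by the inverse function
  theorem, and counting signs by Sylvester's law of inertia leaves eight cases.
\<close>

section \<open>Smooth maps on open sets\<close>

text \<open>The obstacle is that the axis may be lightlike, so that it cannot be normalized by its
  length. Put w = \<theta> n + k_4 e_1; the structure equations give dw = -\<theta> \<omega>_1 w.
  Pairing w with a fixed vector c gives a function g with the same logarithmic derivative, so A =
  w/g is constant whatever its causal type, and the choice of c at one point scales \<tau> =
  \<epsilon>_1 <A,A> to -1, 0 or 1. With dv = g \<omega>_4 the companion B, for which <B,B> =
  \<tau>, obeys dB = -\<tau> e_4 dv and de_4 = \<epsilon>_4 B dv: the rotation is circular,
  hyperbolic or parabolic according as \<tau> \<epsilon>_4 is 1, -1 or 0. The count of eight: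
  (\<epsilon>_1, \<tau>) is (1,1), (-1,1), (-1,-1) or (-1,0), each with two values of \<epsilon>_4;
  the index of the ambient metric then fixes the signs of the two rulings up to their order. Neither
  the principal curvatures nor \<theta> come with any smoothness. They are recovered as quotients of
  smooth one-forms.\<close>

lemma Ck_on_cong1:
  assumes "open U" "Ck_on n f U" "\<And>q. q \<in> U \<Longrightarrow> f q = g q"
  shows "Ck_on n g U"
  using assms(2,3)
proof (induction n arbitrary: f g)
  case 0
  then show ?case by (simp add: continuous_on_eq)
next
  case (Suc n)
  have d: "f differentiable (at q)" if "q \<in> U" for q using Suc.prems that by simp
  have e: "frechet_derivative f (at q) = frechet_derivative g (at q)" if "q \<in> U" for q
    using frechet_derivative_transform_within_open[OF d[OF that] assms(1) that] Suc.prems(2) by blast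
  have "g differentiable (at q)" if "q \<in> U" for q
    using d[OF that] that assms(1) Suc.prems(2)
    by (meson differentiable_def has_derivative_transform_within_open)
  moreover have "Ck_on n (\<lambda>q. frechet_derivative g (at q) h) U" for h
    using Suc.IH[of "\<lambda>q. frechet_derivative f (at q) h"] Suc.prems(1) e by simp
  ultimately show ?case by simp
qed

text \<open>Allows any formula for the derivative that is valid on the open set in place of
  \<open>frechet_derivative\<close>; the inductive closure rules below pass through it.\<close>

lemma Ck_on_SucI:
  assumes "open U" "\<And>q. q \<in> U \<Longrightarrow> (f has_derivative f' q) (at q)"
    "\<And>h. Ck_on n (\<lambda>q. f' q h) U"
  shows "Ck_on (Suc n) f U"
proof -
  have "frechet_derivative f (at q) = f' q" if "q \<in> U" for q
    using frechet_derivative_at[OF assms(2)[OF that]] by simp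
  then have "Ck_on n (\<lambda>q. frechet_derivative f (at q) h) U" for h
    by (intro Ck_on_cong1[OF assms(1) assms(3)[of h]]) simp
  then show ?thesis using assms(2) unfolding Ck_on.simps differentiable_def by blast
qed

lemma Ck_on_SucD:
  assumes "Ck_on (Suc n) f U"
  shows "q \<in> U \<Longrightarrow> (f has_derivative frechet_derivative f (at q)) (at q)"
    "Ck_on n (\<lambda>q. frechet_derivative f (at q) h) U"
  using assms frechet_derivative_works by auto

lemma Ck_on_continuous: "Ck_on n f U \<Longrightarrow> continuous_on U f"
  by (cases n) (auto simp: continuous_at_imp_continuous_on differentiable_imp_continuous_within)

lemma Ck_on_Suc_le: "Ck_on (Suc n) f U \<Longrightarrow> Ck_on n f U"
proof (induction n arbitrary: f)
  case 0
  then show ?case using Ck_on_continuous by (metis Ck_on.simps(1))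
next
  case (Suc n)
  then show ?case by (metis Ck_on.simps(2))
qed

lemma Ck_on_subset: "Ck_on n f U \<Longrightarrow> V \<subseteq> U \<Longrightarrow> Ck_on n f V"
proof (induction n arbitrary: f)
  case 0
  then show ?case by (simp add: continuous_on_subset)
next
  case (Suc n)
  then show ?case unfolding Ck_on.simps by blast
qed

lemma Ck_on_const: "open U \<Longrightarrow> Ck_on n (\<lambda>q. c) U"
proof (induction n arbitrary: c)
  case (Suc n)
  show ?case
    by (rule Ck_on_SucI[where f' = "\<lambda>q h. 0"]) (use Suc in auto)
qed simp

lemma Ck_on_add:
  "open U \<Longrightarrow> Ck_on n f U \<Longrightarrow> Ck_on n g U \<Longrightarrow> Ck_on n (\<lambda>q. f q + g q) U"
proof (induction n arbitrary: f g)
  case 0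
  then show ?case by (simp add: continuous_on_add)
next
  case (Suc n)
  show ?case
    by (rule Ck_on_SucI[OF Suc.prems(1)], rule has_derivative_add)
       (use Suc Ck_on_SucD in blast)+
qed

lemma Ck_on_linear:
  assumes "bounded_linear L"
  shows "open U \<Longrightarrow> Ck_on n f U \<Longrightarrow> Ck_on n (\<lambda>q. L (f q)) U"
proof (induction n arbitrary: f)
  case 0
  then show ?case using assms by (simp add: bounded_linear.continuous_on)
next
  case (Suc n)
  show ?case
    by (rule Ck_on_SucI[OF Suc.prems(1)], rule bounded_linear.has_derivative[OF assms])
       (use Suc Ck_on_SucD in blast)+
qed

lemma Ck_on_id: "open U \<Longrightarrow> Ck_on n (\<lambda>q. q) U"
proof (cases n)
  case (Suc m)
  assume "open U"
  then show ?thesis unfolding Suc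
    by (intro Ck_on_SucI[where f' = "\<lambda>q h. h"]) (auto simp: Ck_on_const)
qed simp

lemma Ck_on_bilinear:
  assumes "bounded_bilinear B"
  shows "open U \<Longrightarrow> Ck_on n f U \<Longrightarrow> Ck_on n g U \<Longrightarrow> Ck_on n (\<lambda>q. B (f q) (g q)) U"
proof (induction n arbitrary: f g)
  case 0
  then show ?case using assms by (simp add: bounded_bilinear.continuous_on)
next
  case (Suc n)
  note D = Ck_on_SucD[OF Suc.prems(2)] Ck_on_SucD[OF Suc.prems(3)]
  show ?case
    by (rule Ck_on_SucI[OF Suc.prems(1)], rule bounded_bilinear.FDERIV[OF assms D(1,3)], assumption+)
       (intro Ck_on_add Suc.IH Suc.prems(1) D(2,4) Ck_on_Suc_le[OF Suc.prems(2)] Ck_on_Suc_le[OF Suc.prems(3)])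
qed

lemma Ck_on_inverse:
  fixes f :: "'a::real_normed_vector \<Rightarrow> real"
  assumes "open U" "\<And>q. q \<in> U \<Longrightarrow> f q \<noteq> 0"
  shows "Ck_on n f U \<Longrightarrow> Ck_on n (\<lambda>q. inverse (f q)) U"
proof (induction n)
  case 0
  then show ?case using assms by (simp add: continuous_on_inverse)
next
  case (Suc n)
  note M = Ck_on_bilinear[OF bounded_bilinear_mult assms(1)]
  have I: "Ck_on n (\<lambda>q. inverse (f q)) U" using Suc Ck_on_Suc_le by blast
  show ?case
  proof (rule Ck_on_SucI[OF assms(1)])
    show "((\<lambda>q. inverse (f q)) has_derivative
       (\<lambda>h. - (inverse (f q) * frechet_derivative f (at q) h * inverse (f q)))) (at q)" if "q \<in> U" for q
      by (rule Deriv.has_derivative_inverse) (use that assms Ck_on_SucD[OF Suc.prems] in auto)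
    show "Ck_on n (\<lambda>q. - (inverse (f q) * frechet_derivative f (at q) h * inverse (f q))) U" for h
      by (rule Ck_on_linear[OF bounded_linear_minus[OF bounded_linear_ident]])
         (use assms M[OF M[OF I Ck_on_SucD(2)[OF Suc.prems]] I] in auto)
  qed
qed

lemma Ck_on_sum:
  assumes "open U" "finite S" "\<And>i. i \<in> S \<Longrightarrow> Ck_on n (f i) U"
  shows "Ck_on n (\<lambda>q. \<Sum>i\<in>S. f i q) U"
  using assms(2,3) by (induction S) (auto simp: Ck_on_const Ck_on_add assms(1))

lemma Ck_on_compose:
  fixes f :: "'a::real_normed_vector \<Rightarrow> 'b::euclidean_space"
  assumes "open U" "open V" "f ` U \<subseteq> V"
  shows "Ck_on n f U \<Longrightarrow> Ck_on n g V \<Longrightarrow> Ck_on n (\<lambda>q. g (f q)) U"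
proof (induction n arbitrary: g)
  case 0
  then show ?case using assms by (auto intro: continuous_on_compose2)
next
  case (Suc n)
  show ?case
  proof (rule Ck_on_SucI[OF assms(1)])
    fix q assume q: "q \<in> U"
    let ?Dg = "frechet_derivative g (at (f q))" and ?Df = "frechet_derivative f (at q)"
    have g: "(g has_derivative ?Dg) (at (f q))"
      using Ck_on_SucD(1)[OF Suc.prems(2)] q assms by auto
    \<comment> \<open>The direction \<open>?Df h\<close> moves with the point, while the induction
      hypothesis covers derivatives of \<open>g\<close> in a fixed direction only; hence the
      expansion over \<open>Basis\<close>.\<close>
    have "?Dg (?Df h) = (\<Sum>b\<in>Basis. (?Df h \<bullet> b) *\<^sub>R ?Dg b)" for h
      using linear_sum[OF has_derivative_linear[OF g], of "\<lambda>b. (?Df h \<bullet> b) *\<^sub>R b" Basis]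
        linear_scale[OF has_derivative_linear[OF g]]
      by (simp add: euclidean_representation)
    then show "((\<lambda>q. g (f q)) has_derivative (\<lambda>h. \<Sum>b\<in>Basis. (?Df h \<bullet> b) *\<^sub>R ?Dg b)) (at q)"
      using has_derivative_compose[OF Ck_on_SucD(1)[OF Suc.prems(1) q] g] by simp
  next
    fix h
    show "Ck_on n (\<lambda>q. \<Sum>b\<in>Basis. (frechet_derivative f (at q) h \<bullet> b) *\<^sub>R
        frechet_derivative g (at (f q)) b) U"
      by (intro Ck_on_sum assms finite_Basis Ck_on_bilinear[OF bounded_bilinear_scaleR]
            Ck_on_linear[OF bounded_linear_inner_left] Ck_on_SucD(2)[OF Suc.prems(1)]
            Suc.IH[OF Ck_on_Suc_le[OF Suc.prems(1)] Ck_on_SucD(2)[OF Suc.prems(2)]])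
  qed
qed

section \<open>Calculus of smooth maps\<close>

lemma smooth_on_cong:
  "open U \<Longrightarrow> smooth_on f U \<Longrightarrow> (\<And>q. q \<in> U \<Longrightarrow> f q = g q) \<Longrightarrow> smooth_on g U"
  unfolding smooth_on_def using Ck_on_cong1 by blast

lemma smooth_on_subset: "smooth_on f U \<Longrightarrow> V \<subseteq> U \<Longrightarrow> smooth_on f V"
  unfolding smooth_on_def using Ck_on_subset by blast

lemma smooth_on_has_derivative:
  "smooth_on f U \<Longrightarrow> q \<in> U \<Longrightarrow> (f has_derivative frechet_derivative f (at q)) (at q)"
  unfolding smooth_on_def using Ck_on_SucD(1) by blast

lemma smooth_on_frechet_derivative:
  "smooth_on f U \<Longrightarrow> smooth_on (\<lambda>q. frechet_derivative f (at q) h) U"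
  unfolding smooth_on_def using Ck_on_SucD(2) by blast

lemma smooth_on_continuous_on: "smooth_on f U \<Longrightarrow> continuous_on U f"
  unfolding smooth_on_def using Ck_on_continuous by blast

text \<open>For each n, smooth coefficients of the derivative put \<open>f\<close> into class
  C^(n+1), hence into C^n.\<close>

lemma smooth_onI:
  assumes "open U" "\<And>q. q \<in> U \<Longrightarrow> (f has_derivative f' q) (at q)"
    "\<And>h. smooth_on (\<lambda>q. f' q h) U"
  shows "smooth_on f U"
  unfolding smooth_on_def
proof
  fix n
  have "Ck_on (Suc n) f U"
    using assms by (intro Ck_on_SucI) (auto simp: smooth_on_def)
  then show "Ck_on n f U" by (rule Ck_on_Suc_le)
qed

lemma smooth_on_const: "open U \<Longrightarrow> smooth_on (\<lambda>q. c) U"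
  and smooth_on_id: "open U \<Longrightarrow> smooth_on (\<lambda>q. q) U"
  unfolding smooth_on_def using Ck_on_const Ck_on_id by blast+

lemma smooth_on_linear:
  "bounded_linear L \<Longrightarrow> open U \<Longrightarrow> smooth_on f U \<Longrightarrow> smooth_on (\<lambda>q. L (f q)) U"
  unfolding smooth_on_def using Ck_on_linear by blast

lemma smooth_on_bilinear:
  "bounded_bilinear B \<Longrightarrow> open U \<Longrightarrow> smooth_on f U \<Longrightarrow> smooth_on g U \<Longrightarrow>
    smooth_on (\<lambda>q. B (f q) (g q)) U"
  unfolding smooth_on_def using Ck_on_bilinear by blast

lemma smooth_on_add:
  "open U \<Longrightarrow> smooth_on f U \<Longrightarrow> smooth_on g U \<Longrightarrow> smooth_on (\<lambda>q. f q + g q) U"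
  unfolding smooth_on_def using Ck_on_add by blast

lemma smooth_on_minus: "open U \<Longrightarrow> smooth_on f U \<Longrightarrow> smooth_on (\<lambda>q. - f q) U"
  by (rule smooth_on_linear[OF bounded_linear_minus[OF bounded_linear_ident]])

lemma smooth_on_diff:
  "open U \<Longrightarrow> smooth_on f U \<Longrightarrow> smooth_on g U \<Longrightarrow> smooth_on (\<lambda>q. f q - g q) U"
  using smooth_on_add[of U f "\<lambda>q. - g q"] smooth_on_minus[of U g] by simp

lemmas smooth_on_mult = smooth_on_bilinear[OF bounded_bilinear_mult]
  and smooth_on_scaleR = smooth_on_bilinear[OF bounded_bilinear_scaleR]
  and smooth_on_vec_nth = smooth_on_linear[OF bounded_linear_vec_nth]

lemma smooth_on_inverse:
  fixes f :: "'a::real_normed_vector \<Rightarrow> real"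
  shows "open U \<Longrightarrow> smooth_on f U \<Longrightarrow> (\<And>q. q \<in> U \<Longrightarrow> f q \<noteq> 0) \<Longrightarrow> smooth_on (\<lambda>q. inverse (f q)) U"
  unfolding smooth_on_def using Ck_on_inverse by blast

lemma smooth_on_divide:
  fixes f :: "'a::real_normed_vector \<Rightarrow> real"
  shows "open U \<Longrightarrow> smooth_on f U \<Longrightarrow> smooth_on g U \<Longrightarrow> (\<And>q. q \<in> U \<Longrightarrow> g q \<noteq> 0) \<Longrightarrow>
    smooth_on (\<lambda>q. f q / g q) U"
  using smooth_on_mult[of U f "\<lambda>q. inverse (g q)"] smooth_on_inverse[of U g]
  by (simp add: divide_inverse)

lemma smooth_on_sum:
  "open U \<Longrightarrow> finite S \<Longrightarrow> (\<And>i. i \<in> S \<Longrightarrow> smooth_on (f i) U) \<Longrightarrow> smooth_on (\<lambda>q. \<Sum>i\<in>S. f i q) U"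
  unfolding smooth_on_def using Ck_on_sum by blast

lemma smooth_on_prod:
  fixes f :: "'i \<Rightarrow> 'a::real_normed_vector \<Rightarrow> real"
  assumes "open U" "finite S" "\<And>i. i \<in> S \<Longrightarrow> smooth_on (f i) U"
  shows "smooth_on (\<lambda>q. \<Prod>i\<in>S. f i q) U"
  using assms(2,3) by (induction S) (auto simp: smooth_on_const smooth_on_mult assms(1))

lemma smooth_on_compose:
  fixes f :: "'a::real_normed_vector \<Rightarrow> 'b::euclidean_space"
  assumes "open U" "open V" "f ` U \<subseteq> V" "smooth_on f U" "smooth_on g V"
  shows "smooth_on (\<lambda>q. g (f q)) U"
  using assms Ck_on_compose unfolding smooth_on_def by blast

lemma smooth_on_vec:
  fixes f :: "'a::real_normed_vector \<Rightarrow> real^'n"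
  assumes "open U" "\<And>i. smooth_on (\<lambda>q. f q $ i) U"
  shows "smooth_on f U"
proof -
  have "smooth_on (\<lambda>q. \<Sum>i\<in>UNIV. (f q $ i) *\<^sub>R axis i (1::real)) U"
    by (intro smooth_on_sum smooth_on_scaleR smooth_on_const assms finite_UNIV) auto
  moreover have "(\<Sum>i\<in>UNIV. (f q $ i) *\<^sub>R axis i (1::real)) = f q" for q
    by (simp add: vec_eq_iff axis_def if_distrib cong: if_cong)
  ultimately show ?thesis by simp
qed

lemma smooth_on_det:
  fixes f :: "'a::real_normed_vector \<Rightarrow> real^'n^'n"
  assumes "open U" "\<And>i j. smooth_on (\<lambda>q. f q $ i $ j) U"
  shows "smooth_on (\<lambda>q. det (f q)) U"
  unfolding det_def
  by (intro smooth_on_sum smooth_on_mult smooth_on_prod smooth_on_const assms finite_permutations) auto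

lemma Ck_on_local:
  assumes "\<And>q. q \<in> U \<Longrightarrow> \<exists>W. open W \<and> q \<in> W \<and> Ck_on n f W"
  shows "Ck_on n f U"
  using assms
proof (induction n arbitrary: f)
  case 0
  have "continuous (at q) f" if "q \<in> U" for q
    using 0[OF that] by (auto simp: continuous_on_eq_continuous_at)
  then show ?case by (simp add: continuous_at_imp_continuous_on)
next
  case (Suc n)
  have "f differentiable (at q)" if "q \<in> U" for q using Suc.prems[OF that] by auto
  moreover have "Ck_on n (\<lambda>q. frechet_derivative f (at q) h) U" for h
  proof (rule Suc.IH)
    fix q assume "q \<in> U"
    then obtain W where "open W" "q \<in> W" "Ck_on (Suc n) f W" using Suc.prems by blast
    then show "\<exists>W. open W \<and> q \<in> W \<and> Ck_on n (\<lambda>q. frechet_derivative f (at q) h) W"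
      using Ck_on_SucD(2) by blast
  qed
  ultimately show ?case by simp
qed

lemma smooth_on_local:
  assumes "\<And>q. q \<in> U \<Longrightarrow> \<exists>W. open W \<and> q \<in> W \<and> smooth_on f W"
  shows "smooth_on f U"
  unfolding smooth_on_def
proof
  fix n show "Ck_on n f U"
    by (rule Ck_on_local) (use assms in \<open>unfold smooth_on_def, blast\<close>)
qed

text \<open>Near a point, divide the values of the two one-forms on one fixed vector where
  \<open>\<omega>\<close> does not vanish. This makes \<open>k\<close>, \<open>\<rho>\<close> and
  \<open>\<theta>\<close> smooth: the first is given without regularity, the other two are
  derivatives in directions that vary with the point.\<close>

lemma smooth_on_coefficient:
  fixes l :: "'a::real_normed_vector \<Rightarrow> real" and \<omega> :: "'a \<Rightarrow> 'h \<Rightarrow> real"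
  assumes U: "open U" and "\<And>h. smooth_on (\<lambda>q. \<omega> q h) U" "\<And>h. smooth_on (\<lambda>q. \<alpha> q h) U"
    and eq: "\<And>q h. q \<in> U \<Longrightarrow> \<alpha> q h = l q * \<omega> q h"
    and nz: "\<And>q. q \<in> U \<Longrightarrow> \<exists>h. \<omega> q h \<noteq> 0"
  shows "smooth_on l U"
proof (rule smooth_on_local)
  fix q assume q: "q \<in> U"
  then obtain h where h: "\<omega> q h \<noteq> 0" using nz by blast
  let ?W = "U \<inter> (\<lambda>q. \<omega> q h) -` (- {0})"
  have W: "open ?W"
    using smooth_on_continuous_on[OF assms(2)] U by (auto intro: continuous_open_preimage)
  have "smooth_on (\<lambda>q. \<alpha> q h / \<omega> q h) ?W"
    by (rule smooth_on_divide[OF W]) (use assms in \<open>auto intro: smooth_on_subset\<close>)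
  then have "smooth_on l ?W" by (rule smooth_on_cong[OF W]) (use eq in auto)
  then show "\<exists>W. open W \<and> q \<in> W \<and> smooth_on l W" using W q h by (intro exI[of _ ?W]) auto
qed

section \<open>Symmetry of second derivatives\<close>

lemma second_difference_mvt:
  fixes f :: "'a::real_normed_vector \<Rightarrow> real"
  assumes f: "\<And>p. p \<in> U \<Longrightarrow> (f has_derivative f' p) (at p)"
    and f2: "\<And>p. p \<in> U \<Longrightarrow> ((\<lambda>p. f' p h) has_derivative f'' p) (at p)"
    and t: "t > 0" and U: "\<And>r s. 0 \<le> r \<Longrightarrow> r \<le> t \<Longrightarrow> 0 \<le> s \<Longrightarrow> s \<le> t \<Longrightarrow> q + r *\<^sub>R h + s *\<^sub>R k \<in> U"
  shows "\<exists>r s. 0 \<le> r \<and> r \<le> t \<and> 0 \<le> s \<and> s \<le> t \<and>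
    f (q + t *\<^sub>R h + t *\<^sub>R k) - f (q + t *\<^sub>R h) - f (q + t *\<^sub>R k) + f q = t\<^sup>2 * f'' (q + r *\<^sub>R h + s *\<^sub>R k) k"
proof -
  have D: "((\<lambda>r. f (q + r *\<^sub>R h + s *\<^sub>R k)) has_real_derivative f' (q + r *\<^sub>R h + s *\<^sub>R k) h) (at r)"
    if "0 \<le> r" "r \<le> t" "0 \<le> s" "s \<le> t" for r s
  proof -
    have *: "((\<lambda>r. q + r *\<^sub>R h + s *\<^sub>R k) has_derivative (\<lambda>c. c *\<^sub>R h)) (at r)"
      by (auto intro!: derivative_eq_intros)
    have p: "q + r *\<^sub>R h + s *\<^sub>R k \<in> U" using U that by blast
    show ?thesis unfolding has_field_derivative_def
      by (rule has_derivative_eq_rhs[OF has_derivative_compose[OF * f[OF p]]])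
         (simp add: fun_eq_iff linear_scale[OF has_derivative_linear[OF f[OF p]]])
  qed
  \<comment> \<open>The mean value theorem is applied in the direction \<open>h\<close> to the
    increment of \<open>f\<close> in the direction \<open>k\<close>, and afterwards in the direction
    \<open>k\<close> to \<open>f'\<close>.\<close>
  have "\<exists>r. 0 < r \<and> r < t \<and> (f (q + t *\<^sub>R h + t *\<^sub>R k) - f (q + t *\<^sub>R h + 0 *\<^sub>R k))
      - (f (q + 0 *\<^sub>R h + t *\<^sub>R k) - f (q + 0 *\<^sub>R h + 0 *\<^sub>R k))
    = (t - 0) * (f' (q + r *\<^sub>R h + t *\<^sub>R k) h - f' (q + r *\<^sub>R h + 0 *\<^sub>R k) h)"
    by (rule MVT2[OF t], rule DERIV_diff) (rule D; use t in simp)+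
  then obtain r where r: "0 < r" "r < t" and 1: "f (q + t *\<^sub>R h + t *\<^sub>R k) - f (q + t *\<^sub>R h)
      - (f (q + t *\<^sub>R k) - f q) = t * (f' (q + r *\<^sub>R h + t *\<^sub>R k) h - f' (q + r *\<^sub>R h + 0 *\<^sub>R k) h)"
    by auto
  have "\<exists>s. 0 < s \<and> s < t \<and> f' (q + r *\<^sub>R h + t *\<^sub>R k) h - f' (q + r *\<^sub>R h + 0 *\<^sub>R k) h
    = (t - 0) * f'' (q + r *\<^sub>R h + s *\<^sub>R k) k"
  proof (rule MVT2[OF t])
    fix s assume s: "0 \<le> s" "s \<le> t"
    have *: "((\<lambda>s. q + r *\<^sub>R h + s *\<^sub>R k) has_derivative (\<lambda>c. c *\<^sub>R k)) (at s)"
      by (auto intro!: derivative_eq_intros)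
    have p: "q + r *\<^sub>R h + s *\<^sub>R k \<in> U" using U r s by simp
    show "((\<lambda>s. f' (q + r *\<^sub>R h + s *\<^sub>R k) h) has_real_derivative f'' (q + r *\<^sub>R h + s *\<^sub>R k) k) (at s)"
      unfolding has_field_derivative_def
      by (rule has_derivative_eq_rhs[OF has_derivative_compose[OF * f2[OF p]]])
         (simp add: fun_eq_iff linear_scale[OF has_derivative_linear[OF f2[OF p]]])
  qed
  then obtain s where "0 < s" "s < t" "f' (q + r *\<^sub>R h + t *\<^sub>R k) h - f' (q + r *\<^sub>R h + 0 *\<^sub>R k) h
    = t * f'' (q + r *\<^sub>R h + s *\<^sub>R k) k" by auto
  then show ?thesis using r 1 by (intro exI[of _ r] exI[of _ s]) (auto simp: power2_eq_square)
qed

text \<open>The second difference over a parallelogram is symmetric in \<open>h\<close> and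
  \<open>k\<close>, so the two mixed derivatives agree at two points close to \<open>q\<close>;
  continuity carries both values to \<open>q\<close>.\<close>

lemma second_derivative_symmetric_real:
  fixes f :: "'a::real_normed_vector \<Rightarrow> real"
  assumes U: "open U" "q \<in> U" and f: "smooth_on f U"
  shows "frechet_derivative (\<lambda>r. frechet_derivative f (at r) h) (at q) k =
         frechet_derivative (\<lambda>r. frechet_derivative f (at r) k) (at q) h"
proof (rule ccontr)
  let ?A = "\<lambda>h k p. frechet_derivative (\<lambda>r. frechet_derivative f (at r) h) (at p) k"
  \<comment> \<open>Half the supposed gap: values closer than this to the two limits cannot
    coincide.\<close>
  let ?e = "\<bar>?A h k q - ?A k h q\<bar> / 2"
  assume "?A h k q \<noteq> ?A k h q"
  then have e: "?e > 0" by simp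
  have "continuous (at q) (?A h' k')" for h' k'
    using smooth_on_continuous_on[OF smooth_on_frechet_derivative[OF smooth_on_frechet_derivative[OF f]]] U
    by (simp add: continuous_on_eq_continuous_at)
  then have c: "\<exists>d>0. \<forall>p. dist p q < d \<longrightarrow> dist (?A h' k' p) (?A h' k' q) < ?e" for h' k'
    using e unfolding continuous_at_eps_delta by blast
  obtain d1 where d1: "d1 > 0" "\<And>p. dist p q < d1 \<Longrightarrow> dist (?A h k p) (?A h k q) < ?e" using c by blast
  obtain d2 where d2: "d2 > 0" "\<And>p. dist p q < d2 \<Longrightarrow> dist (?A k h p) (?A k h q) < ?e" using c by blast
  obtain d3 where d3: "d3 > 0" "ball q d3 \<subseteq> U" using U open_contains_ball by blast
  define d where "d = min d1 (min d2 d3)"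
  have d: "d > 0" using d1 d2 d3 by (simp add: d_def)
  define t where "t = d / (2 * (norm h + norm k + 1))"
  have n1: "norm h + norm k + 1 > 0" by (simp add: add_nonneg_pos)
  have t: "t > 0" using d n1 by (simp add: t_def)
  have small: "dist (q + r *\<^sub>R h + s *\<^sub>R k) q < d" if "0 \<le> r" "r \<le> t" "0 \<le> s" "s \<le> t" for r s
  proof -
    have "dist (q + r *\<^sub>R h + s *\<^sub>R k) q = norm (r *\<^sub>R h + s *\<^sub>R k)" by (simp add: dist_norm add.assoc)
    also have "\<dots> \<le> r * norm h + s * norm k" using norm_triangle_ineq[of "r *\<^sub>R h" "s *\<^sub>R k"] that by simp
    also have "\<dots> \<le> t * norm h + t * norm k" using that by (intro add_mono mult_right_mono) auto
    also have "\<dots> < 2 * (t * (norm h + norm k + 1))"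
    proof -
      have "0 \<le> t * norm h" "0 \<le> t * norm k" using t by simp_all
      then have "0 < t * norm h + (t * norm k + t * 2)" using t by linarith
      then show ?thesis by (simp add: algebra_simps)
    qed
    also have "\<dots> = d" using n1 by (simp add: t_def field_simps)
    finally show ?thesis .
  qed
  have inU: "q + r *\<^sub>R h + s *\<^sub>R k \<in> U" "q + r *\<^sub>R k + s *\<^sub>R h \<in> U"
    if "0 \<le> r" "r \<le> t" "0 \<le> s" "s \<le> t" for r s
    using small[of r s] small[of s r] that d3 by (auto simp: d_def dist_commute algebra_simps subset_iff)
  note D = smooth_on_has_derivative[OF f] smooth_on_has_derivative[OF smooth_on_frechet_derivative[OF f]]
  obtain r s where 1: "0 \<le> r" "r \<le> t" "0 \<le> s" "s \<le> t" "f (q + t *\<^sub>R h + t *\<^sub>R k) - f (q + t *\<^sub>R h) -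
      f (q + t *\<^sub>R k) + f q = t\<^sup>2 * ?A h k (q + r *\<^sub>R h + s *\<^sub>R k)"
    using second_difference_mvt[OF D(1) D(2) t inU(1)] by blast
  obtain r' s' where 2: "0 \<le> r'" "r' \<le> t" "0 \<le> s'" "s' \<le> t" "f (q + t *\<^sub>R k + t *\<^sub>R h) - f (q + t *\<^sub>R k) -
      f (q + t *\<^sub>R h) + f q = t\<^sup>2 * ?A k h (q + r' *\<^sub>R k + s' *\<^sub>R h)"
    using second_difference_mvt[OF D(1) D(2) t inU(2)] by blast
  have "t\<^sup>2 * ?A h k (q + r *\<^sub>R h + s *\<^sub>R k) = t\<^sup>2 * ?A k h (q + r' *\<^sub>R k + s' *\<^sub>R h)"
    using 1(5) 2(5) by (simp add: algebra_simps)
  then have "?A h k (q + r *\<^sub>R h + s *\<^sub>R k) = ?A k h (q + r' *\<^sub>R k + s' *\<^sub>R h)" using t by simp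
  moreover have "dist (?A h k (q + r *\<^sub>R h + s *\<^sub>R k)) (?A h k q) < ?e"
    using small[OF 1(1-4)] by (intro d1) (simp add: d_def)
  moreover have "dist (?A k h (q + r' *\<^sub>R k + s' *\<^sub>R h)) (?A k h q) < ?e"
    using small[OF 2(3,4,1,2)] by (intro d2) (simp add: d_def algebra_simps)
  ultimately show False by (simp add: dist_real_def abs_if split: if_splits)
qed

lemma frechet_derivative_linear_comp:
  "bounded_linear L \<Longrightarrow> (f has_derivative f') (at q) \<Longrightarrow> frechet_derivative (\<lambda>r. L (f r)) (at q) h = L (f' h)"
  using frechet_derivative_at[OF bounded_linear.has_derivative] by metis

lemma second_derivative_symmetric:
  fixes f :: "'a::real_normed_vector \<Rightarrow> 'b::euclidean_space"
  assumes U: "open U" "q \<in> U" and f: "smooth_on f U"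
  shows "frechet_derivative (\<lambda>r. frechet_derivative f (at r) h) (at q) k =
         frechet_derivative (\<lambda>r. frechet_derivative f (at r) k) (at q) h"
proof (rule euclidean_eqI)
  fix b :: 'b
  let ?g = "\<lambda>r. f r \<bullet> b"
  have g: "smooth_on ?g U" by (rule smooth_on_linear[OF bounded_linear_inner_left U(1) f])
  have 1: "frechet_derivative ?g (at r) h = frechet_derivative f (at r) h \<bullet> b" if "r \<in> U" for r h
    by (rule frechet_derivative_linear_comp[OF bounded_linear_inner_left smooth_on_has_derivative[OF f that]])
  have 2: "frechet_derivative (\<lambda>r. frechet_derivative ?g (at r) h) (at q) k
      = frechet_derivative (\<lambda>r. frechet_derivative f (at r) h) (at q) k \<bullet> b" for h k
  proof -
    have "(\<lambda>r. frechet_derivative ?g (at r) h) differentiable (at q)"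
      using smooth_on_has_derivative[OF smooth_on_frechet_derivative[OF g] U(2)] by (auto simp: differentiable_def)
    then have "frechet_derivative (\<lambda>r. frechet_derivative ?g (at r) h) (at q) =
       frechet_derivative (\<lambda>r. frechet_derivative f (at r) h \<bullet> b) (at q)"
      by (rule frechet_derivative_transform_within_open[OF _ U]) (rule 1)
    then show ?thesis
      using frechet_derivative_linear_comp[OF bounded_linear_inner_left
        smooth_on_has_derivative[OF smooth_on_frechet_derivative[OF f] U(2)]] by simp
  qed
  show "frechet_derivative (\<lambda>r. frechet_derivative f (at r) h) (at q) k \<bullet> b =
        frechet_derivative (\<lambda>r. frechet_derivative f (at r) k) (at q) h \<bullet> b"
    using second_derivative_symmetric_real[OF U g] by (simp add: 2)
qed

text \<open>Smoothness of the inverse is a bootstrap. Cramer's rule solves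
  \<open>?D q (X h q) = h\<close> by a smooth function \<open>X h\<close> of the base point, and
  \<open>g' y h = X h (g y)\<close> then raises the order of \<open>g\<close> by one.\<close>

theorem smooth_inverse_function:
  fixes f :: "real^'n \<Rightarrow> real^'n"
  assumes U: "open U" "q0 \<in> U" and f: "smooth_on f U"
    and inj: "\<And>h. frechet_derivative f (at q0) h = 0 \<Longrightarrow> h = 0"
  obtains V W g where "open V" "V \<subseteq> U" "q0 \<in> V" "open W" "homeomorphism V W f g" "smooth_on g W"
    "\<And>w h. w \<in> W \<Longrightarrow> frechet_derivative f (at (g w)) (frechet_derivative g (at w) h) = h"
proof -
  let ?D = "\<lambda>q. frechet_derivative f (at q)"
  note fD = smooth_on_has_derivative[OF f]
  define f' where "f' = (\<lambda>q. Blinfun (?D q))"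
  have f': "blinfun_apply (f' q) = ?D q" if "q \<in> U" for q
    unfolding f'_def using has_derivative_bounded_linear[OF fD[OF that]] bounded_linear_Blinfun_apply by blast
  have cont: "continuous_on U f'"
  proof (rule continuous_on_blinfun_componentwise)
    fix i :: "real^'n"
    show "continuous_on U (\<lambda>x. blinfun_apply (f' x) i)"
      using smooth_on_continuous_on[OF smooth_on_frechet_derivative[OF f, of i]] f'
      by (simp cong: continuous_on_cong)
  qed
  have lin: "linear (?D q0)" using fD U has_derivative_linear by blast
  then have "inj (?D q0)" using inj by (simp add: linear_injective_0)
  then obtain G where G: "linear G" "G \<circ> ?D q0 = id"
    using linear_injective_left_inverse lin by blast
  have "Blinfun G o\<^sub>L f' q0 = id_blinfun"
    using G f' U by (intro blinfun_eqI) (simp add: bounded_linear_Blinfun_apply linear_conv_bounded_linear fun_eq_iff)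
  from inverse_function_theorem[OF U(1) _ cont U(2) this] f' fD
  obtain V W g g' where V: "open V" "V \<subseteq> U" "q0 \<in> V" and W: "open W" and hom: "homeomorphism V W f g"
    and g: "\<And>y. y \<in> W \<Longrightarrow> (g has_derivative g' y) (at y)"
    and g': "\<And>y. y \<in> W \<Longrightarrow> g' y = inv (blinfun_apply (f' (g y)))"
    and bij: "\<And>y. y \<in> W \<Longrightarrow> bij (blinfun_apply (f' (g y)))" by metis
  have gV: "g y \<in> V" if "y \<in> W" for y using hom that by (auto simp: homeomorphism_def)
  let ?M = "\<lambda>q. matrix (?D q)"
  have linD: "linear (?D q)" if "q \<in> V" for q using that V fD has_derivative_linear by blast
  have bijD: "bij (?D q)" if "q \<in> V" for q
  proof -
    have "f q \<in> W" "g (f q) = q" using hom that by (auto simp: homeomorphism_def)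
    then show ?thesis using bij[of "f q"] f' V that by auto
  qed
  have det: "det (?M q) \<noteq> 0" if "q \<in> V" for q
    using det_nz_iff_inj[OF linD[OF that]] bijD[OF that] by (simp add: bij_def)
  define X where "X = (\<lambda>h q. (\<chi> k. det (\<chi> i j. if j = k then h $ i else ?M q $ i $ j) / det (?M q)) :: real^'n)"
  have X: "smooth_on (X h) V" for h
  proof (rule smooth_on_vec[OF V(1)])
    fix k
    have M: "smooth_on (\<lambda>q. ?M q $ i $ j) V" for i j
      unfolding matrix_def using smooth_on_vec_nth[OF U(1) smooth_on_frechet_derivative[OF f]]
      by (auto intro: smooth_on_subset[OF _ V(2)])
    have "smooth_on (\<lambda>q. det (\<chi> i j. if j = k then h $ i else ?M q $ i $ j) / det (?M q)) V"
    proof (intro smooth_on_divide smooth_on_det V(1) M det)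
      fix i j show "smooth_on (\<lambda>q. (\<chi> i j. if j = k then h $ i else ?M q $ i $ j) $ i $ j) V"
        by (cases "j = k") (use M in \<open>auto intro: smooth_on_const V\<close>)
    qed
    then show "smooth_on (\<lambda>q. X h q $ k) V" by (simp add: X_def)
  qed
  have DX: "?D q (X h q) = h" if "q \<in> V" for q h
  proof -
    have "?M q *v X h q = h" using cramer[OF det[OF that], of "X h q" h] by (simp add: X_def)
    then show ?thesis using fun_cong[OF matrix_vector_mul(2)[OF linD[OF that]]] by simp
  qed
  have g'X: "g' y h = X h (g y)" if "y \<in> W" for y h
    using g'[OF that] f' gV[OF that] V bijD[OF gV[OF that]] DX[OF gV[OF that], of h]
    by (metis bij_inv_eq_iff subsetD)
  have Ck: "Ck_on n g W" for n
  proof (induction n)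
    case 0
    then show ?case using hom by (auto simp: homeomorphism_def)
  next
    case (Suc n)
    show ?case
    proof (rule Ck_on_SucI[OF W g])
      fix h
      have "Ck_on n (\<lambda>y. X h (g y)) W"
        by (rule Ck_on_compose[OF W V(1)]) (use gV Suc X[of h] in \<open>auto simp: smooth_on_def\<close>)
      then show "Ck_on n (\<lambda>y. g' y h) W" by (rule Ck_on_cong1[OF W]) (simp add: g'X)
    qed
  qed
  have "?D (g w) (frechet_derivative g (at w) h) = h" if "w \<in> W" for w h
    using frechet_derivative_at[OF g[OF that]] g'X[OF that] DX[OF gV[OF that]] by metis
  then show thesis using that[OF V W hom] Ck by (auto simp: smooth_on_def)
qed

text \<open>The primitive is the integral of the form along segments from \<open>q0\<close>. After
  differentiation under the integral sign, closedness makes the integrand the derivative in t of t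
  times the form at the point with parameter t.\<close>

theorem poincare_1form:
  fixes \<omega> :: "'a::euclidean_space \<Rightarrow> 'a \<Rightarrow> real"
  assumes lin: "\<And>q. q \<in> ball q0 r \<Longrightarrow> linear (\<omega> q)"
    and sm: "\<And>h. smooth_on (\<lambda>q. \<omega> q h) (ball q0 r)"
    and closed: "\<And>q h k. q \<in> ball q0 r \<Longrightarrow>
      frechet_derivative (\<lambda>q. \<omega> q h) (at q) k = frechet_derivative (\<lambda>q. \<omega> q k) (at q) h"
  shows "\<exists>F. F q0 = 0 \<and> (\<forall>q \<in> ball q0 r. (F has_derivative \<omega> q) (at q))"
proof -
  let ?U = "ball q0 r" and ?I = "cbox 0 (1::real)"
  let ?p = "\<lambda>q t. q0 + t *\<^sub>R (q - q0)"
  let ?D = "\<lambda>q k. frechet_derivative (\<lambda>q. \<omega> q k) (at q)"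
  note D = smooth_on_has_derivative[OF sm]
  have p: "?p q t \<in> ?U" if "q \<in> ?U" "t \<in> ?I" for q t
  proof -
    have "t * norm (q - q0) \<le> 1 * norm (q - q0)" using that by (intro mult_right_mono) auto
    then show ?thesis using that by (simp add: dist_norm norm_minus_commute)
  qed
  define F' where "F' = (\<lambda>q t k. \<omega> (?p q t) k + t * ?D (?p q t) k (q - q0))"
  have lin\<omega>: "\<omega> q h = (\<Sum>b\<in>Basis. (h \<bullet> b) * \<omega> q b)" if "q \<in> ?U" for q h
    using linear_sum[OF lin[OF that], of "\<lambda>b. (h \<bullet> b) *\<^sub>R b" Basis] linear_scale[OF lin[OF that]]
    by (simp add: euclidean_representation)
  \<comment> \<open>Closedness enters here: the direction of differentiation and the argument of the
    form change places.\<close>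
  have linD: "?D q k h = (\<Sum>b\<in>Basis. (h \<bullet> b) * ?D q b k)" if "q \<in> ?U" for q h k
    using linear_sum[OF has_derivative_linear[OF D[OF that, of k]], of "\<lambda>b. (h \<bullet> b) *\<^sub>R b" Basis]
      linear_scale[OF has_derivative_linear[OF D[OF that, of k]]] closed[OF that, of k]
    by (simp add: euclidean_representation)
  \<comment> \<open>This is the form at \<open>?p q t\<close> applied to \<open>q - q0\<close>.
    Smoothness is known for fixed arguments only, so the moving argument is expanded.\<close>
  define F where "F = (\<lambda>q t. \<Sum>b\<in>Basis. ((q - q0) \<bullet> b) * \<omega> (?p q t) b)"
  have F: "((\<lambda>q. F q t) has_derivative F' q t) (at q)" if q: "q \<in> ?U" and t: "t \<in> ?I" for q t
  proof -
    have 1: "((\<lambda>q. \<omega> (?p q t) b) has_derivative (\<lambda>k. t * ?D (?p q t) b k)) (at q)" for b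
    proof -
      have "((\<lambda>q. ?p q t) has_derivative (\<lambda>k. t *\<^sub>R k)) (at q)"
        by (auto intro!: derivative_eq_intros)
      from has_derivative_compose[OF this D[OF p[OF q t]]] show ?thesis
        by (simp add: linear_scale[OF has_derivative_linear[OF D[OF p[OF q t]]]])
    qed
    have "((\<lambda>q. F q t) has_derivative (\<lambda>k. \<Sum>b\<in>Basis. (k \<bullet> b) * \<omega> (?p q t) b
        + ((q - q0) \<bullet> b) * (t * ?D (?p q t) b k))) (at q)"
      unfolding F_def by (auto intro!: derivative_eq_intros 1 simp: add.commute)
    then show ?thesis
      by (rule has_derivative_eq_rhs)
         (simp add: F'_def fun_eq_iff lin\<omega>[OF p[OF q t], symmetric] linD[OF p[OF q t], of _ "q - q0"]
           sum.distrib sum_distrib_left mult_ac)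
  qed
  have bl: "bounded_linear (F' q t)" if "q \<in> ?U" "t \<in> ?I" for q t
    using F[OF that] has_derivative_bounded_linear by blast
  define B where "B = (\<lambda>q t. Blinfun (F' q t))"
  have B: "blinfun_apply (B q t) = F' q t" if "q \<in> ?U" "t \<in> ?I" for q t
    unfolding B_def using bl[OF that] bounded_linear_Blinfun_apply by blast
  have cp: "continuous_on (?U \<times> ?I) (\<lambda>z. ?p (fst z) (snd z))"
    by (intro continuous_intros)
  have comp: "continuous_on (?U \<times> ?I) (\<lambda>z. f (?p (fst z) (snd z)))" if "continuous_on ?U f" for f :: "'a \<Rightarrow> real"
    by (rule continuous_on_compose2[OF that cp]) (use p in auto)
  have contB: "continuous_on (?U \<times> ?I) (\<lambda>(q, t). B q t)"
  proof (rule continuous_on_blinfun_componentwise)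
    fix k :: 'a
    have "continuous_on (?U \<times> ?I) (\<lambda>z. \<omega> (?p (fst z) (snd z)) k + snd z *
        (\<Sum>b\<in>Basis. ((fst z - q0) \<bullet> b) * ?D (?p (fst z) (snd z)) b k))"
      by (intro continuous_intros comp smooth_on_continuous_on sm smooth_on_frechet_derivative)
    then show "continuous_on (?U \<times> ?I) (\<lambda>x. blinfun_apply (case x of (q, t) \<Rightarrow> B q t) k)"
      by (rule continuous_on_eq) (auto simp: B F'_def linD[OF p])
  qed
  have FI: "(\<lambda>t. F q t) integrable_on ?I" if "q \<in> ?U" for q
  proof (rule integrable_continuous)
    have "continuous_on ?I (\<lambda>t. \<omega> (?p q t) b)" for b
      by (rule continuous_on_compose2[OF smooth_on_continuous_on[OF sm]])
         (use p[OF that] in \<open>auto intro!: continuous_intros\<close>)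
    then show "continuous_on ?I (F q)" unfolding F_def by (intro continuous_intros)
  qed
  define G where "G = (\<lambda>q. integral ?I (F q))"
  have G: "(G has_derivative \<omega> q) (at q)" if q: "q \<in> ?U" for q
  proof -
    have 1: "(G has_derivative integral ?I (B q)) (at q within ?U)"
      unfolding G_def by (rule leibniz_rule[OF _ FI contB q convex_ball])
        (use F B has_derivative_at_withinI in force)+
    have cB: "continuous_on ?I (B q)"
    proof -
      have "continuous_on ?I (\<lambda>t. (q, t))" by (intro continuous_intros)
      moreover have "(\<lambda>t. (q, t)) ` ?I \<subseteq> ?U \<times> ?I" using q by blast
      ultimately have "continuous_on ?I (\<lambda>t. case (q, t) of (q, t) \<Rightarrow> B q t)"
        using continuous_on_compose2[OF contB] by blast
      then show ?thesis by simp
    qed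
    have "integral ?I (B q) k = \<omega> q k" for k
    proof -
      have "((\<lambda>t. F' q t k) has_integral (1 * \<omega> (?p q 1) k - 0 * \<omega> (?p q 0) k)) {0..1}"
      proof (rule fundamental_theorem_of_calculus)
        fix t :: real assume t: "t \<in> {0..1}"
        have pt: "?p q t \<in> ?U" using p[OF q] t by auto
        have "((\<lambda>t. ?p q t) has_derivative (\<lambda>c. c *\<^sub>R (q - q0))) (at t)"
          by (auto intro!: derivative_eq_intros)
        from has_derivative_compose[OF this D[OF pt, of k]]
        have "((\<lambda>t. \<omega> (?p q t) k) has_vector_derivative ?D (?p q t) k (q - q0)) (at t)"
          unfolding has_vector_derivative_def
          by (simp add: linear_scale[OF has_derivative_linear[OF D[OF pt]]])
        then have "((\<lambda>t. t * \<omega> (?p q t) k) has_vector_derivative F' q t k) (at t)"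
          unfolding F'_def by (auto intro!: derivative_eq_intros)
        then show "((\<lambda>t. t * \<omega> (?p q t) k) has_vector_derivative F' q t k) (at t within {0..1})"
          by (rule has_vector_derivative_at_within)
      qed simp
      then have "integral ?I (\<lambda>t. F' q t k) = \<omega> q k" by (auto intro: integral_unique)
      moreover have "integral ?I (B q) k = integral ?I (\<lambda>t. F' q t k)"
        using blinfun_apply_integral[OF integrable_continuous[OF cB]] B[OF q]
        by (metis (no_types, lifting) integral_cong)
      ultimately show ?thesis by simp
    qed
    then show ?thesis using 1 at_within_open[OF q open_ball] by (metis ext)
  qed
  have "((\<lambda>q. G q - G q0) has_derivative \<omega> q) (at q)" if "q \<in> ?U" for q
    using has_derivative_diff[OF G[OF that] has_derivative_const] by simp
  then show ?thesis by (intro exI[of _ "\<lambda>q. G q - G q0"]) simp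
qed

section \<open>Orthonormal bases of the pseudo-Euclidean space\<close>

lemma bounded_bilinear_sprod: "bounded_bilinear sprod"
  unfolding bilinear_conv_bounded_bilinear[symmetric] bilinear_def
  by (auto simp: linear_iff sprod_def algebra_simps)

interpretation sprod: bounded_bilinear sprod
  by (rule bounded_bilinear_sprod)

lemma sprod_commute: "sprod a b = sprod b a"
  by (simp add: sprod_def mult.commute)

lemmas sprod_simps = sprod.add_left sprod.add_right sprod.diff_left sprod.diff_right
  sprod.minus_left sprod.minus_right sprod.scaleR_left sprod.scaleR_right
  sprod.sum_left sprod.sum_right sprod.zero_left sprod.zero_right

lemma exhaust_5: "(i::5) = 1 \<or> i = 2 \<or> i = 3 \<or> i = 4 \<or> i = 5"
proof (induct i)
  case (of_int z)
  then have "z = 0 \<or> z = 1 \<or> z = 2 \<or> z = 3 \<or> z = 4" by auto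
  then show ?case by auto
qed

lemma UNIV_5: "UNIV = {1, 2, 3, 4, 5::5}"
  using exhaust_5 by auto

lemma forall_5: "(\<forall>i::5. P i) \<longleftrightarrow> P 1 \<and> P 2 \<and> P 3 \<and> P 4 \<and> P 5"
  by (metis exhaust_5)

lemma sum_5: "sum f (UNIV::5 set) = f 1 + f 2 + f 3 + f 4 + f 5"
  unfolding UNIV_5 by (simp add: ac_simps)

text \<open>The metric dual of the i-th coordinate; the sign compensates the two negative
  axes.\<close>

definition coaxis :: "5 \<Rightarrow> real^5" where
  "coaxis i = (if i = 1 \<or> i = 2 then - axis i 1 else axis i 1)"

lemma sprod_coaxis: "sprod (coaxis i) w = w $ i"
  using exhaust_5[of i] by (auto simp: coaxis_def sprod_def axis_def)

definition orthonormal5 :: "(5 \<Rightarrow> real^5) \<Rightarrow> (5 \<Rightarrow> real) \<Rightarrow> bool" where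
  "orthonormal5 b \<eta> \<longleftrightarrow> (\<forall>i. \<eta> i * \<eta> i = 1) \<and> (\<forall>i j. sprod (b i) (b j) = (if i = j then \<eta> i else 0))"

lemma orthonormal5_combination:
  assumes "orthonormal5 b \<eta>"
  shows "sprod (\<Sum>i\<in>UNIV. u $ i *\<^sub>R b i) (b j) = u $ j * \<eta> j"
    and "sprod (\<Sum>i\<in>UNIV. u $ i *\<^sub>R b i) (\<Sum>i\<in>UNIV. v $ i *\<^sub>R b i) = (\<Sum>i\<in>UNIV. u $ i * v $ i * \<eta> i)"
    and "inj (\<lambda>u. \<Sum>i\<in>UNIV. u $ i *\<^sub>R b i)"
proof -
  show 1: "sprod (\<Sum>i\<in>UNIV. u $ i *\<^sub>R b i) (b j) = u $ j * \<eta> j" for u j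
  proof -
    have "sprod (\<Sum>i\<in>UNIV. u $ i *\<^sub>R b i) (b j) = (\<Sum>i\<in>UNIV. if i = j then u $ j * \<eta> j else 0)"
      unfolding sprod.sum_left by (intro sum.cong) (use assms in \<open>auto simp: orthonormal5_def sprod_simps\<close>)
    then show ?thesis by simp
  qed
  show "sprod (\<Sum>i\<in>UNIV. u $ i *\<^sub>R b i) (\<Sum>i\<in>UNIV. v $ i *\<^sub>R b i) = (\<Sum>i\<in>UNIV. u $ i * v $ i * \<eta> i)"
    by (subst sprod.sum_right) (simp add: 1 sprod.scaleR_right mult_ac)
  show "inj (\<lambda>u. \<Sum>i\<in>UNIV. u $ i *\<^sub>R b i)"
  proof (rule injI)
    fix u v :: "real^5"
    assume "(\<Sum>i\<in>UNIV. u $ i *\<^sub>R b i) = (\<Sum>i\<in>UNIV. v $ i *\<^sub>R b i)"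
    then have "u $ j * \<eta> j = v $ j * \<eta> j" for j using 1 by metis
    moreover have "\<eta> j \<noteq> 0" for j using assms by (metis orthonormal5_def mult_zero_left zero_neq_one)
    ultimately show "u = v" by (simp add: vec_eq_iff)
  qed
qed

lemma linear_combination: "linear (\<lambda>u::real^5. \<Sum>i\<in>UNIV. u $ i *\<^sub>R b i)" for b :: "5 \<Rightarrow> real^5"
  by (auto simp: linear_iff scaleR_left_distrib sum.distrib scaleR_sum_right)

text \<open>Pairing with \<open>b j\<close> recovers the coefficients, so the combination map is
  injective, and in dimension 5 also surjective.\<close>

lemma orthonormal5_expansion:
  assumes "orthonormal5 b \<eta>"
  shows "w = (\<Sum>i\<in>UNIV. (\<eta> i * sprod w (b i)) *\<^sub>R b i)"
proof -
  have "surj (\<lambda>u. \<Sum>i\<in>UNIV. u $ i *\<^sub>R b i)"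
    by (rule linear_inj_imp_surj[OF linear_combination orthonormal5_combination(3)[OF assms]])
  then obtain u where u: "w = (\<Sum>i\<in>UNIV. u $ i *\<^sub>R b i)" unfolding surj_def by blast
  have "\<eta> j * \<eta> j = 1" for j using assms by (simp add: orthonormal5_def)
  then have "\<eta> j * sprod w (b j) = u $ j" for j
    unfolding u orthonormal5_combination(1)[OF assms] by (simp add: mult.left_commute)
  then show ?thesis using u by (simp only:)
qed

text \<open>Sylvester's law of inertia: two of the five signs are negative.\<close>

lemma orthonormal5_signature:
  assumes b: "orthonormal5 b \<eta>"
  shows "(\<Sum>i\<in>UNIV. \<eta> i) = 1"
proof -
  let ?T = "\<lambda>u. \<Sum>i\<in>UNIV. u $ i *\<^sub>R b i"
  let ?C = "\<lambda>d. {u::real^5. \<forall>i. i \<notin> d \<longrightarrow> u $ i = 0}"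
  have sub: "subspace (?C d)" for d by (auto simp: subspace_def)
  have dimC: "dim (?C d) = card d" for d
    unfolding dim_vec_eq[symmetric] by (rule dim_substandard_cart)
  \<comment> \<open>Otherwise the sum of the two subspaces would be direct and have dimension above
    5.\<close>
  have meet: "\<exists>u. u \<noteq> 0 \<and> u \<in> ?C N \<and> ?T u \<in> ?C d" if "card N + card d > 5" for N d
  proof (rule ccontr)
    assume "\<not> ?thesis"
    then have "?T u = 0" if "u \<in> ?C N" "?T u \<in> ?C d" for u
      using that by (cases "u = 0") (simp, blast)
    then have "?T ` ?C N \<inter> ?C d \<subseteq> {0}" by blast
    then have 0: "dim (?T ` ?C N \<inter> ?C d) = 0" unfolding dim_eq_0 .
    have 1: "subspace (?T ` ?C N)" by (rule linear_subspace_image[OF linear_combination sub])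
    have 2: "dim (?T ` ?C N) = card N"
      unfolding dim_image_eq[OF linear_combination inj_on_subset[OF orthonormal5_combination(3)[OF b] subset_UNIV]]
      by (rule dimC)
    have "dim {x + z |x z. x \<in> ?T ` ?C N \<and> z \<in> ?C d} = card N + card d"
      using dim_sums_Int[OF 1 sub[of d]] 0 2 dimC[of d] by linarith
    moreover have "dim {x + z |x z. x \<in> ?T ` ?C N \<and> z \<in> ?C d} \<le> 5"
      using dim_subset_UNIV_cart[of "{x + z |x z. x \<in> ?T ` ?C N \<and> z \<in> ?C d}"] by simp
    ultimately show False using that by simp
  qed
  have \<eta>: "\<eta> i = 1 \<or> \<eta> i = -1" for i
    using b by (simp add: orthonormal5_def square_eq_1_iff)
  have pos: "0 < (\<Sum>i\<in>UNIV. u $ i * u $ i)" if "u \<noteq> 0" for u :: "real^5"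
    using that by (metis inner_gt_zero_iff inner_vec_def inner_real_def)
  let ?N = "{i. \<eta> i = -1}" and ?P = "{i. \<eta> i = 1}"
  \<comment> \<open>A common vector would have negative square as a combination of negative
    \<open>b i\<close> and nonnegative square as a vector with spacelike coordinates only. The bound
    for \<open>?P\<close> is the mirror image.\<close>
  have "card ?N \<le> 2"
  proof (rule ccontr)
    assume "\<not> ?thesis"
    then have "card ?N + card {3, 4, 5::5} > 5" by simp
    from meet[OF this] obtain u where u: "u \<noteq> 0" "u \<in> ?C ?N" "?T u \<in> ?C {3, 4, 5}" by blast
    have "sprod (?T u) (?T u) = - (\<Sum>i\<in>UNIV. u $ i * u $ i)"
      unfolding orthonormal5_combination(2)[OF b] sum_negf[symmetric]
    proof (intro sum.cong refl)
      fix i show "u $ i * u $ i * \<eta> i = - (u $ i * u $ i)"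
        using u(2) by (cases "\<eta> i = -1") auto
    qed
    moreover have "sprod (?T u) (?T u) \<ge> 0" using u(3) by (auto simp: sprod_def)
    ultimately show False using pos[OF u(1)] by simp
  qed
  moreover have "card ?P \<le> 3"
  proof (rule ccontr)
    assume "\<not> ?thesis"
    then have "card ?P + card {1, 2::5} > 5" by simp
    from meet[OF this] obtain u where u: "u \<noteq> 0" "u \<in> ?C ?P" "?T u \<in> ?C {1, 2}" by blast
    have "sprod (?T u) (?T u) = (\<Sum>i\<in>UNIV. u $ i * u $ i)"
      unfolding orthonormal5_combination(2)[OF b]
    proof (intro sum.cong refl)
      fix i show "u $ i * u $ i * \<eta> i = u $ i * u $ i"
        using u(2) by (cases "\<eta> i = 1") auto
    qed
    moreover have "sprod (?T u) (?T u) \<le> 0" using u(3) by (auto simp: sprod_def)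
    ultimately show False using pos[OF u(1)] by simp
  qed
  moreover have U: "?N \<union> ?P = UNIV" "?N \<inter> ?P = {}" using \<eta> by auto
  then have "card ?N + card ?P = 5"
    using card_Un_disjoint[of ?N ?P] by simp
  moreover have "(\<Sum>i\<in>UNIV. \<eta> i) = (\<Sum>i\<in>?N. \<eta> i) + (\<Sum>i\<in>?P. \<eta> i)"
    using sum.union_disjoint[of ?N ?P \<eta>] U by simp
  ultimately show ?thesis by simp
qed

abbreviation standard_signs :: "5 \<Rightarrow> real" where
  "standard_signs i \<equiv> (if i = 1 \<or> i = 2 then -1 else 1)"

text \<open>Taking coefficients in \<open>b\<close> preserves \<open>sprod\<close>, because
  \<open>b\<close> carries the signs of the standard axes; a translation brings \<open>c\<close> to
  the origin.\<close>

lemma isometry_to_standard_axes: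
  assumes b: "orthonormal5 b standard_signs"
  shows "\<exists>\<Phi>. pe_isometry \<Phi> \<and> (\<forall>u. \<Phi> (c + (\<Sum>i\<in>UNIV. u $ i *\<^sub>R b i)) = u)"
proof -
  define L where "L = (\<lambda>w. \<chi> i. standard_signs i * sprod w (b i))"
  have L: "L (\<Sum>i\<in>UNIV. u $ i *\<^sub>R b i) = u" for u
    using orthonormal5_combination(1)[OF b] by (simp add: L_def vec_eq_iff)
  have "linear L" by (auto simp: linear_iff L_def vec_eq_iff sprod_simps algebra_simps)
  moreover have "sprod (L v) (L w) = sprod v w" for v w
  proof -
    have e: "x = (\<Sum>i\<in>UNIV. L x $ i *\<^sub>R b i)" for x
      using orthonormal5_expansion[OF b, of x] unfolding L_def vec_lambda_beta by simp
    have "sprod v w = (\<Sum>i\<in>UNIV. L v $ i * L w $ i * standard_signs i)"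
      using orthonormal5_combination(2)[OF b, of "L v" "L w"] e[of v] e[of w] by simp
    then show ?thesis by (simp add: sprod_def sum_5)
  qed
  ultimately have "pe_isometry (\<lambda>w. L w + L (- c))" unfolding pe_isometry_def by blast
  moreover have "L (c + v) + L (- c) = L v" for v
    using linear_add[OF \<open>linear L\<close>, of "c + v" "- c"] by simp
  ultimately show ?thesis using L by (intro exI[of _ "\<lambda>w. L w + L (- c)"]) simp
qed

section \<open>Hypersurfaces with a principal frame, in a chart\<close>

abbreviation Fd :: "('a::real_normed_vector \<Rightarrow> 'b::real_normed_vector) \<Rightarrow> 'a \<Rightarrow> 'a \<Rightarrow> 'b" where
  "Fd F q \<equiv> frechet_derivative F (at q)"

lemma Fd_eqI: "(F has_derivative F') (at q) \<Longrightarrow> Fd F q h = F' h"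
  using frechet_derivative_at by metis

text \<open>Identities between functions are available on \<open>U\<close> only; openness is what
  lets them be differentiated.\<close>

lemma Fd_cong:
  assumes "open U" "q \<in> U" "smooth_on F U" "\<And>r. r \<in> U \<Longrightarrow> F r = G r"
  shows "Fd G q = Fd F q"
proof -
  have "F differentiable (at q)"
    using smooth_on_has_derivative[OF assms(3,2)] unfolding differentiable_def by blast
  from frechet_derivative_transform_within_open[OF this assms(1,2,4)] show ?thesis by simp
qed

lemmas smooth_on_sprod = smooth_on_bilinear[OF bounded_bilinear_sprod]

lemma Fd_sprod:
  "smooth_on F U \<Longrightarrow> smooth_on G U \<Longrightarrow> q \<in> U \<Longrightarrow>
    Fd (\<lambda>r. sprod (F r) (G r)) q h = sprod (F q) (Fd G q h) + sprod (Fd F q h) (G q)"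
  by (rule Fd_eqI, rule sprod.FDERIV) (rule smooth_on_has_derivative; assumption)+

lemma Fd_mult:
  fixes f g :: "'a::real_normed_vector \<Rightarrow> real"
  shows "smooth_on f U \<Longrightarrow> smooth_on g U \<Longrightarrow> q \<in> U \<Longrightarrow>
    Fd (\<lambda>r. f r * g r) q h = f q * Fd g q h + Fd f q h * g q"
  by (rule Fd_eqI, rule has_derivative_mult) (rule smooth_on_has_derivative; assumption)+

lemma Fd_scaleR:
  fixes f :: "'a::real_normed_vector \<Rightarrow> real"
  shows "smooth_on f U \<Longrightarrow> smooth_on g U \<Longrightarrow> q \<in> U \<Longrightarrow>
    Fd (\<lambda>r. f r *\<^sub>R g r) q h = f q *\<^sub>R Fd g q h + Fd f q h *\<^sub>R g q"
  by (rule Fd_eqI, rule has_derivative_scaleR) (rule smooth_on_has_derivative; assumption)+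

lemma Fd_add:
  "smooth_on F U \<Longrightarrow> smooth_on G U \<Longrightarrow> q \<in> U \<Longrightarrow> Fd (\<lambda>r. F r + G r) q h = Fd F q h + Fd G q h"
  by (rule Fd_eqI, rule has_derivative_add) (rule smooth_on_has_derivative; assumption)+

lemma Fd_diff:
  "smooth_on F U \<Longrightarrow> smooth_on G U \<Longrightarrow> q \<in> U \<Longrightarrow> Fd (\<lambda>r. F r - G r) q h = Fd F q h - Fd G q h"
  by (rule Fd_eqI, rule has_derivative_diff) (rule smooth_on_has_derivative; assumption)+

lemma Fd_const: "Fd (\<lambda>r. c) q h = 0"
  by (rule Fd_eqI) (rule has_derivative_const)

lemma Fd_sprod_const:
  "smooth_on F U \<Longrightarrow> q \<in> U \<Longrightarrow> Fd (\<lambda>r. sprod c (F r)) q h = sprod c (Fd F q h)"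
  by (rule Fd_eqI, rule bounded_linear.has_derivative[OF sprod.bounded_linear_right])
     (rule smooth_on_has_derivative; assumption)

text \<open>The signs \<open>\<epsilon>\<close> do not vary with the point; on a ball this follows
  from continuity. Smoothness of \<open>k\<close> is derived below.\<close>

locale principal_chart =
  fixes U :: "(real^4) set" and y n :: "real^4 \<Rightarrow> real^5" and e :: "4 \<Rightarrow> real^4 \<Rightarrow> real^5"
    and \<epsilon> :: "4 \<Rightarrow> real" and k :: "4 \<Rightarrow> real^4 \<Rightarrow> real"
  assumes open_U: "open U"
    and smooth_y: "smooth_on y U" and smooth_n: "smooth_on n U" and smooth_e: "smooth_on (e i) U"
    and inj_y: "q \<in> U \<Longrightarrow> inj (Fd y q)"
    and e_tangent: "q \<in> U \<Longrightarrow> e i q \<in> range (Fd y q)"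
    and e_orth: "q \<in> U \<Longrightarrow> sprod (e i q) (e j q) = (if i = j then \<epsilon> i else 0)"
    and eps: "\<epsilon> i * \<epsilon> i = 1"
    and n_unit: "q \<in> U \<Longrightarrow> sprod (n q) (n q) = 1"
    and n_orth: "q \<in> U \<Longrightarrow> sprod (n q) (Fd y q h) = 0"
    and shape: "q \<in> U \<Longrightarrow> Fd n q (inv (Fd y q) (e i q)) = - (k i q *\<^sub>R e i q)"
begin

text \<open>The coordinate vector of \<open>e i\<close>: derivatives along the frame are taken in
  this direction.\<close>

definition \<xi> :: "4 \<Rightarrow> real^4 \<Rightarrow> real^4" where
  "\<xi> i q = inv (Fd y q) (e i q)"

definition \<omega> :: "4 \<Rightarrow> real^4 \<Rightarrow> real^4 \<Rightarrow> real" where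
  "\<omega> i q h = \<epsilon> i * sprod (Fd y q h) (e i q)"

lemma linear_Fd: "smooth_on F U \<Longrightarrow> q \<in> U \<Longrightarrow> linear (Fd F q)"
  using smooth_on_has_derivative has_derivative_linear by blast

lemma smooth_Dy: "smooth_on (\<lambda>q. Fd y q h) U"
  by (rule smooth_on_frechet_derivative[OF smooth_y])

lemma smooth_\<omega>: "smooth_on (\<lambda>q. \<omega> i q h) U"
  unfolding \<omega>_def
  by (intro smooth_on_mult smooth_on_const smooth_on_sprod open_U smooth_Dy smooth_e)

lemma linear_\<omega>: "q \<in> U \<Longrightarrow> linear (\<omega> i q)"
  using linear_Fd[OF smooth_y, of q] by (simp add: linear_iff \<omega>_def sprod_simps algebra_simps)

lemma eps_cancel: "\<epsilon> i * (\<epsilon> i * a) = a"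
  using eps[of i] by (simp add: mult.assoc[symmetric])

lemma eps_nonzero: "\<epsilon> i \<noteq> 0"
  using eps[of i] by auto

lemma Dy_\<xi>: "q \<in> U \<Longrightarrow> Fd y q (\<xi> i q) = e i q"
  unfolding \<xi>_def by (rule f_inv_into_f[OF e_tangent])

lemma \<omega>_\<xi>: "q \<in> U \<Longrightarrow> \<omega> i q (\<xi> j q) = (if i = j then 1 else 0)"
  by (simp add: \<omega>_def Dy_\<xi> e_orth eps)

lemma \<omega>_combination:
  assumes q: "q \<in> U" shows "\<omega> i q (\<Sum>j\<in>UNIV. c j *\<^sub>R \<xi> j q) = c i"
proof -
  have "\<omega> i q (\<Sum>j\<in>UNIV. c j *\<^sub>R \<xi> j q) = (\<Sum>j\<in>UNIV. if i = j then c j else 0)"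
    unfolding linear_sum[OF linear_\<omega>[OF q]] linear_scale[OF linear_\<omega>[OF q]] \<omega>_\<xi>[OF q]
    by (intro sum.cong) auto
  then show ?thesis by simp
qed

lemma e_n: "q \<in> U \<Longrightarrow> sprod (e i q) (n q) = 0"
  using n_orth[of q "\<xi> i q"] by (simp add: Dy_\<xi> sprod_commute)

lemma n_e: "q \<in> U \<Longrightarrow> sprod (n q) (e i q) = 0"
  using e_n by (simp add: sprod_commute)

lemma sprod_Dy_e: "sprod (Fd y q h) (e i q) = \<epsilon> i * \<omega> i q h"
  by (simp add: \<omega>_def eps_cancel)

lemma frame_orthonormal5:
  assumes "q \<in> U"
  shows "orthonormal5 (\<lambda>i. if i = 1 then e 1 q else if i = 2 then e 2 q else if i = 3 then e 3 q
      else if i = 4 then e 4 q else n q)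
    (\<lambda>i. if i = 1 then \<epsilon> 1 else if i = 2 then \<epsilon> 2 else if i = 3 then \<epsilon> 3 else if i = 4 then \<epsilon> 4 else 1)"
  unfolding orthonormal5_def forall_5
  using assms by (simp add: e_orth eps n_unit n_e e_n)

lemma frame_expansion:
  "q \<in> U \<Longrightarrow> w = (\<Sum>i\<in>UNIV. (\<epsilon> i * sprod w (e i q)) *\<^sub>R e i q) + sprod w (n q) *\<^sub>R n q"
  using orthonormal5_expansion[OF frame_orthonormal5, of q w] by (simp add: sum_5 sum_4)

lemma Dy_expansion:
  assumes "q \<in> U" shows "Fd y q h = (\<Sum>i\<in>UNIV. \<omega> i q h *\<^sub>R e i q)"
  using frame_expansion[OF assms, of "Fd y q h"] n_orth[OF assms, of h]
  by (simp add: \<omega>_def sprod_commute[of _ "n q"])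

lemma tangent_expansion:
  assumes "q \<in> U" "t \<in> range (Fd y q)"
  shows "t = (\<Sum>i\<in>UNIV. (\<epsilon> i * sprod t (e i q)) *\<^sub>R e i q)"
proof -
  obtain h where h: "t = Fd y q h" using assms(2) by blast
  show ?thesis using Dy_expansion[OF assms(1), of h] unfolding \<omega>_def h .
qed

lemma vector_expansion:
  assumes "q \<in> U" shows "h = (\<Sum>i\<in>UNIV. \<omega> i q h *\<^sub>R \<xi> i q)"
proof (rule injD[OF inj_y[OF assms]])
  show "Fd y q h = Fd y q (\<Sum>i\<in>UNIV. \<omega> i q h *\<^sub>R \<xi> i q)"
    using Dy_expansion[OF assms, of h] linear_Fd[OF smooth_y assms]
    by (simp add: linear_sum linear_scale Dy_\<xi>[OF assms])
qed

lemma linear_expansion: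
  assumes "q \<in> U" "linear L" shows "L h = (\<Sum>i\<in>UNIV. \<omega> i q h *\<^sub>R L (\<xi> i q))"
proof -
  have "L h = L (\<Sum>i\<in>UNIV. \<omega> i q h *\<^sub>R \<xi> i q)" using vector_expansion[OF assms(1)] by simp
  then show ?thesis using assms(2) by (simp add: linear_sum linear_scale)
qed

lemma Dn_\<xi>: "q \<in> U \<Longrightarrow> Fd n q (\<xi> i q) = - (k i q *\<^sub>R e i q)"
  unfolding \<xi>_def by (rule shape)

text \<open>The Weingarten equation tested against \<open>e j\<close>. Being an identity of
  one-forms, it yields the smoothness of \<open>k j\<close> and, once differentiated, the Codazzi
  equation.\<close>

lemma Dn_e: assumes "q \<in> U" shows "sprod (Fd n q h) (e j q) = - k j q * sprod (Fd y q h) (e j q)"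
proof -
  have "sprod (Fd n q h) (e j q) = (\<Sum>i\<in>UNIV. if i = j then - k j q * (\<epsilon> j * \<omega> j q h) else 0)"
    unfolding linear_expansion[OF assms linear_Fd[OF smooth_n assms], of h] sprod.sum_left
    by (intro sum.cong refl) (simp add: sprod_simps Dn_\<xi> e_orth assms)
  then show ?thesis by (simp add: sprod_Dy_e)
qed

lemma De_n: assumes "q \<in> U" shows "sprod (Fd (e j) q h) (n q) = k j q * sprod (Fd y q h) (e j q)"
proof -
  have "Fd (\<lambda>r. sprod (e j r) (n r)) q h = Fd (\<lambda>r. 0) q h"
    by (rule fun_cong[OF Fd_cong[OF open_U assms]]) (simp_all add: smooth_on_const open_U e_n)
  then show ?thesis
    using Dn_e[OF assms, of h j] unfolding Fd_sprod[OF smooth_e smooth_n assms] Fd_const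
    by (simp add: sprod_commute[of "e j q"])
qed

lemma De_e: assumes "q \<in> U" shows "sprod (Fd (e i) q h) (e j q) = - sprod (Fd (e j) q h) (e i q)"
proof -
  have "Fd (\<lambda>r. sprod (e i r) (e j r)) q h = Fd (\<lambda>r. if i = j then \<epsilon> i else 0) q h"
    by (rule fun_cong[OF Fd_cong[OF open_U assms]]) (simp_all add: smooth_on_const open_U e_orth)
  then show ?thesis
    unfolding Fd_sprod[OF smooth_e smooth_e assms] Fd_const
    by (simp add: sprod_commute[of "e i q"])
qed

lemma smooth_k: "smooth_on (k j) U"
proof (rule smooth_on_coefficient[OF open_U, where \<alpha> = "\<lambda>q h. sprod (Fd n q h) (e j q)"])
  show "smooth_on (\<lambda>q. - sprod (Fd y q h) (e j q)) U" for h
    by (intro smooth_on_minus smooth_on_sprod open_U smooth_Dy smooth_e)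
  show "smooth_on (\<lambda>q. sprod (Fd n q h) (e j q)) U" for h
    by (intro smooth_on_sprod open_U smooth_on_frechet_derivative smooth_n smooth_e)
  show "sprod (Fd n q h) (e j q) = k j q * - sprod (Fd y q h) (e j q)" if "q \<in> U" for q h
    using Dn_e[OF that] by simp
  show "\<exists>h. - sprod (Fd y q h) (e j q) \<noteq> 0" if "q \<in> U" for q
    by (rule exI[of _ "\<xi> j q"]) (simp add: that Dy_\<xi> e_orth eps_nonzero)
qed

lemma Dy_symmetric: "q \<in> U \<Longrightarrow> Fd (\<lambda>r. Fd y r h) q h' = Fd (\<lambda>r. Fd y r h') q h"
  and Dn_symmetric: "q \<in> U \<Longrightarrow> Fd (\<lambda>r. Fd n r h) q h' = Fd (\<lambda>r. Fd n r h') q h"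
  using second_derivative_symmetric[OF open_U] smooth_y smooth_n by blast+

text \<open>The exterior derivative of the one-form <E, dy>: symmetry removes the second derivatives
  of \<open>y\<close>. It serves as the first structure equation and avoids Lie brackets of the
  frame.\<close>

lemma exterior_derivative:
  assumes "q \<in> U" "smooth_on E U"
  shows "Fd (\<lambda>r. sprod (E r) (Fd y r h)) q h' - Fd (\<lambda>r. sprod (E r) (Fd y r h')) q h =
    sprod (Fd E q h') (Fd y q h) - sprod (Fd E q h) (Fd y q h')"
  by (simp add: Fd_sprod[OF assms(2) smooth_Dy assms(1)] Dy_symmetric[OF assms(1), of h h'])

text \<open>Differentiate \<open>\<langle>dn, e\<^sub>j\<rangle> = - k\<^sub>j \<langle>dy, e\<^sub>j\<rangle>\<close> and antisymmetrize: the second derivatives of \<open>y\<close> and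
  \<open>n\<close> cancel.\<close>

lemma codazzi:
  assumes q: "q \<in> U"
  shows "sprod (Fd n q h) (Fd (e j) q h') - sprod (Fd n q h') (Fd (e j) q h) =
    - Fd (k j) q h' * sprod (Fd y q h) (e j q) + Fd (k j) q h * sprod (Fd y q h') (e j q)
    - k j q * (sprod (Fd y q h) (Fd (e j) q h') - sprod (Fd y q h') (Fd (e j) q h))"
proof -
  have *: "sprod (Fd n q h) (Fd (e j) q h') + sprod (Fd (\<lambda>r. Fd n r h) q h') (e j q) =
     - (k j q * (sprod (Fd y q h) (Fd (e j) q h') + sprod (Fd (\<lambda>r. Fd y r h) q h') (e j q))
        + Fd (k j) q h' * sprod (Fd y q h) (e j q))" for h h'
  proof -
    note sm = smooth_on_sprod[OF open_U smooth_Dy smooth_e]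
    have "Fd (\<lambda>r. sprod (Fd n r h) (e j r)) q h' = Fd (\<lambda>r. 0 - k j r * sprod (Fd y r h) (e j r)) q h'"
      by (rule fun_cong[OF Fd_cong[OF open_U q smooth_on_diff[OF open_U smooth_on_const[OF open_U]
            smooth_on_mult[OF open_U smooth_k sm]]]]) (simp add: Dn_e)
    also have "\<dots> = 0 - Fd (\<lambda>r. k j r * sprod (Fd y r h) (e j r)) q h'"
      unfolding Fd_diff[OF smooth_on_const[OF open_U] smooth_on_mult[OF open_U smooth_k sm] q] Fd_const ..
    finally show ?thesis
      by (simp add: Fd_mult[OF smooth_k sm q] Fd_sprod[OF smooth_Dy smooth_e q]
          Fd_sprod[OF smooth_on_frechet_derivative[OF smooth_n] smooth_e q])
  qed
  show ?thesis
    using *[of h h'] *[of h' h] Dy_symmetric[OF q, of h h'] Dn_symmetric[OF q, of h h']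
    by (simp add: algebra_simps)
qed

text \<open>Connection coefficients: direction, differentiated vector, component. The last index is
  lowered, hence the factors \<open>\<epsilon> l\<close> in expansions.\<close>

definition G :: "4 \<Rightarrow> 4 \<Rightarrow> 4 \<Rightarrow> real^4 \<Rightarrow> real" where
  "G i j l q = sprod (Fd (e j) q (\<xi> i q)) (e l q)"

lemma G_antisym: "q \<in> U \<Longrightarrow> G i j l q = - G i l j q"
  unfolding G_def by (rule De_e)

lemma G_self: "q \<in> U \<Longrightarrow> G i j j q = 0"
  using G_antisym[of q i j j] by simp

text \<open>With l = j different from i it gives the derivative of \<open>k j\<close> along
  \<open>e i\<close>; with three distinct indices it is a linear relation between two connection
  coefficients.\<close>

lemma codazzi_frame:
  assumes q: "q \<in> U"
  shows "(k j q - k i q) * G l j i q + (k l q - k j q) * G i j l q =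
    (if l = j then \<epsilon> j * Fd (k j) q (\<xi> i q) else 0) - (if i = j then \<epsilon> j * Fd (k j) q (\<xi> l q) else 0)"
  using codazzi[OF q, of "\<xi> i q" j "\<xi> l q"]
  by (simp add: Dn_\<xi>[OF q] Dy_\<xi>[OF q] e_orth[OF q] sprod_simps sprod_commute[of "e _ q" "Fd (e _) q _"] G_def[symmetric])
     (auto simp: algebra_simps split: if_splits)

lemma De_expansion:
  assumes q: "q \<in> U"
  shows "Fd (e j) q (\<xi> i q) = (\<Sum>l\<in>UNIV. (\<epsilon> l * G i j l q) *\<^sub>R e l q) +
    (if i = j then (\<epsilon> j * k j q) *\<^sub>R n q else 0)"
  using frame_expansion[OF q, of "Fd (e j) q (\<xi> i q)"] De_n[OF q, of j "\<xi> i q"]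
  by (simp add: G_def Dy_\<xi>[OF q] e_orth[OF q] mult.commute[of "\<epsilon> _" "k _ _"] split: if_splits)

section \<open>Gradient, divergence and Laplacian in the moving frame\<close>

lemma tangential_part_frame:
  assumes q: "q \<in> U"
  shows "tangential_part y q w = (\<Sum>i\<in>UNIV. (\<epsilon> i * sprod w (e i q)) *\<^sub>R e i q)" (is "_ = ?t")
  unfolding tangential_part_def tangent_space_def
proof (rule the_equality)
  note lin = linear_Fd[OF smooth_y q]
  have "?t = Fd y q (\<Sum>i\<in>UNIV. (\<epsilon> i * sprod w (e i q)) *\<^sub>R \<xi> i q)"
    using lin by (simp add: linear_sum linear_scale Dy_\<xi>[OF q])
  moreover have "sprod (w - ?t) (Fd y q h) = 0" for h
  proof -
    have "w - ?t = sprod w (n q) *\<^sub>R n q" using frame_expansion[OF q, of w] by (simp add: algebra_simps)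
    then show ?thesis by (simp add: sprod_simps n_orth[OF q])
  qed
  ultimately show "?t \<in> range (Fd y q) \<and> (\<forall>z\<in>range (Fd y q). sprod (w - ?t) z = 0)"
    by (blast intro: range_eqI)
  fix t assume t: "t \<in> range (Fd y q) \<and> (\<forall>z\<in>range (Fd y q). sprod (w - t) z = 0)"
  have "sprod w (Fd y q h) = sprod t (Fd y q h)" for h
    using t by (simp add: sprod_simps)
  from this[of "\<xi> _ q"] have "sprod w (e i q) = sprod t (e i q)" for i
    unfolding Dy_\<xi>[OF q] .
  then have *: "(\<Sum>i\<in>UNIV. (\<epsilon> i * sprod t (e i q)) *\<^sub>R e i q) = ?t" by simp
  show "t = ?t" by (rule trans[OF tangent_expansion[OF q conjunct1[OF t]] *])
qed

text \<open>The trace is defined in the coordinate basis. Expanding the axes in \<open>\<xi>\<close>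
  and the images \<open>L (\<xi> i q)\<close> in the axes, and exchanging the sums, turns it into a
  trace over the frame.\<close>

lemma trace_frame:
  assumes q: "q \<in> U" and L: "linear L"
  shows "trace (matrix L) = (\<Sum>i\<in>UNIV. \<omega> i q (L (\<xi> i q)))"
proof -
  have ax: "L (\<xi> i q) = (\<Sum>a\<in>UNIV. (L (\<xi> i q) $ a) *\<^sub>R axis a 1)" for i
    by (simp add: vec_eq_iff axis_def if_distrib cong: if_cong)
  have "trace (matrix L) = (\<Sum>a\<in>UNIV. \<Sum>i\<in>UNIV. \<omega> i q (axis a 1) * L (\<xi> i q) $ a)"
  proof -
    have "L h $ a = (\<Sum>i\<in>UNIV. \<omega> i q h * L (\<xi> i q) $ a)" for h a
      by (subst linear_expansion[OF q L, of h]) simp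
    then show ?thesis unfolding trace_def matrix_def vec_lambda_beta by (intro sum.cong refl)
  qed
  also have "\<dots> = (\<Sum>i\<in>UNIV. \<Sum>a\<in>UNIV. L (\<xi> i q) $ a * \<omega> i q (axis a 1))"
    by (subst sum.swap) (simp add: mult.commute)
  also have "\<dots> = (\<Sum>i\<in>UNIV. \<omega> i q (L (\<xi> i q)))"
  proof (rule sum.cong[OF refl])
    fix i
    show "(\<Sum>a\<in>UNIV. L (\<xi> i q) $ a * \<omega> i q (axis a 1)) = \<omega> i q (L (\<xi> i q))"
      by (subst (2) ax) (simp add: linear_sum[OF linear_\<omega>[OF q]] linear_scale[OF linear_\<omega>[OF q]])
  qed
  finally show ?thesis .
qed

lemma inv_Dy: "q \<in> U \<Longrightarrow> inv (Fd y q) (Fd y q h) = h"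
  by (rule inv_f_f[OF inj_y])

text \<open>\<open>Z'\<close> is meant to be a gradient given by a definite description, and
  \<open>Z\<close> an explicit formula for it on \<open>U\<close>.\<close>

lemma div_tangent_frame:
  assumes q: "q \<in> U" and Z: "smooth_on Z U" "\<And>r. r \<in> U \<Longrightarrow> Z' r = Z r"
  shows "div_tangent y Z' q = (\<Sum>i\<in>UNIV. \<epsilon> i * sprod (Fd Z q (\<xi> i q)) (e i q))"
proof -
  have Z': "Fd Z' q = Fd Z q" by (rule Fd_cong[OF open_U q Z(1)]) (simp add: Z(2))
  define L where "L = (\<lambda>h. inv (Fd y q) (levi_civita y Z' q (Fd y q h)))"
  have L: "L h = (\<Sum>i\<in>UNIV. (\<epsilon> i * sprod (Fd Z q h) (e i q)) *\<^sub>R \<xi> i q)" for h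
  proof -
    have "levi_civita y Z' q (Fd y q h) = (\<Sum>i\<in>UNIV. (\<epsilon> i * sprod (Fd Z q h) (e i q)) *\<^sub>R e i q)"
      by (simp add: levi_civita_def deriv_along_def inv_Dy[OF q] Z' tangential_part_frame[OF q])
    also have "\<dots> = Fd y q (\<Sum>i\<in>UNIV. (\<epsilon> i * sprod (Fd Z q h) (e i q)) *\<^sub>R \<xi> i q)"
      using linear_Fd[OF smooth_y q] by (simp add: linear_sum linear_scale Dy_\<xi>[OF q])
    finally show ?thesis by (simp add: L_def inv_Dy[OF q])
  qed
  have "linear L"
    unfolding L linear_iff using linear_Fd[OF Z(1) q]
    by (simp add: linear_add linear_scale sprod_simps algebra_simps sum.distrib scaleR_sum_right)
  then have "div_tangent y Z' q = (\<Sum>i\<in>UNIV. \<omega> i q (L (\<xi> i q)))"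
    unfolding div_tangent_def tangent_trace_def L_def using trace_frame[OF q] by blast
  moreover have "\<omega> i q (L h) = \<epsilon> i * sprod (Fd Z q h) (e i q)" for i h
    unfolding L by (rule \<omega>_combination[OF q])
  ultimately show ?thesis by simp
qed

lemma gradientI:
  assumes q: "q \<in> U" and t: "t \<in> range (Fd y q)" "\<And>h. sprod t (Fd y q h) = Fd f q h"
  shows "gradient y f q = t"
  unfolding gradient_def tangent_space_def deriv_along_def
proof (rule the_equality)
  show "t \<in> range (Fd y q) \<and> (\<forall>z\<in>range (Fd y q). sprod t z = Fd f q (inv (Fd y q) z))"
    using t inv_Dy[OF q] by auto
  fix t' assume t': "t' \<in> range (Fd y q) \<and> (\<forall>z\<in>range (Fd y q). sprod t' z = Fd f q (inv (Fd y q) z))"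
  then have "sprod t' (Fd y q h) = sprod t (Fd y q h)" for h
    by (simp add: t(2) inv_Dy[OF q])
  from this[of "\<xi> _ q"] have "sprod t' (e i q) = sprod t (e i q)" for i
    unfolding Dy_\<xi>[OF q] .
  then have *: "(\<Sum>i\<in>UNIV. (\<epsilon> i * sprod t' (e i q)) *\<^sub>R e i q) =
      (\<Sum>i\<in>UNIV. (\<epsilon> i * sprod t (e i q)) *\<^sub>R e i q)" by simp
  show "t' = t"
    by (rule trans[OF tangent_expansion[OF q conjunct1[OF t']] trans[OF * tangent_expansion[OF q t(1), symmetric]]])
qed

lemma laplace_frame:
  assumes q: "q \<in> U" and Z: "smooth_on Z U" "\<And>r. r \<in> U \<Longrightarrow> Z r \<in> range (Fd y r)"
    "\<And>r h. r \<in> U \<Longrightarrow> sprod (Z r) (Fd y r h) = Fd f r h"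
  shows "laplace y f q = (\<Sum>i\<in>UNIV. \<epsilon> i * sprod (Fd Z q (\<xi> i q)) (e i q))"
  unfolding laplace_def by (rule div_tangent_frame[OF q Z(1)]) (rule gradientI[OF _ Z(2,3)])

lemma mean_curvature_frame:
  assumes q: "q \<in> U" shows "mean_curvature y n q = (\<Sum>i\<in>UNIV. k i q) / 4"
proof -
  define L where "L = (\<lambda>h. inv (Fd y q) (shape_operator y n q (Fd y q h)))"
  have L: "L h = (\<Sum>i\<in>UNIV. (k i q * \<omega> i q h) *\<^sub>R \<xi> i q)" for h
  proof -
    have "shape_operator y n q (Fd y q h) = - Fd n q h"
      by (simp add: shape_operator_def deriv_along_def inv_Dy[OF q])
    also have "\<dots> = (\<Sum>i\<in>UNIV. (k i q * \<omega> i q h) *\<^sub>R e i q)"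
      using linear_expansion[OF q linear_Fd[OF smooth_n q], of h]
      by (simp add: Dn_\<xi>[OF q] sum_negf mult.commute)
    also have "\<dots> = Fd y q (\<Sum>i\<in>UNIV. (k i q * \<omega> i q h) *\<^sub>R \<xi> i q)"
      using linear_Fd[OF smooth_y q] by (simp add: linear_sum linear_scale Dy_\<xi>[OF q])
    finally show ?thesis by (simp add: L_def inv_Dy[OF q])
  qed
  have "linear L"
    unfolding L linear_iff using linear_\<omega>[OF q]
    by (simp add: linear_add linear_scale algebra_simps sum.distrib scaleR_sum_right)
  then have "tangent_trace y q (shape_operator y n q) = (\<Sum>i\<in>UNIV. \<omega> i q (L (\<xi> i q)))"
    unfolding tangent_trace_def L_def using trace_frame[OF q] by blast
  moreover have "\<omega> i q (L h) = k i q * \<omega> i q h" for i h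
    unfolding L by (rule \<omega>_combination[OF q])
  ultimately show ?thesis by (simp add: mean_curvature_def \<omega>_\<xi>[OF q])
qed

lemma tangentI: "q \<in> U \<Longrightarrow> (\<Sum>i\<in>UNIV. c i *\<^sub>R e i q) \<in> range (Fd y q)"
  by (rule range_eqI[of _ _ "\<Sum>i\<in>UNIV. c i *\<^sub>R \<xi> i q"])
     (simp add: linear_sum linear_scale linear_Fd[OF smooth_y] Dy_\<xi>)

text \<open>Beltrami's formula, \<Delta>y = 4 H n. The gradient of a coordinate function is the
  tangential part of the dual axis vector.\<close>

lemma laplace_position:
  assumes q: "q \<in> U"
  shows "laplace_vec y y q = (\<Sum>i\<in>UNIV. k i q) *\<^sub>R n q"
proof -
  have "laplace y (\<lambda>r. y r $ a) q = (\<Sum>i\<in>UNIV. k i q) * n q $ a" for a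
  proof -
    define Z where "Z = (\<lambda>r. coaxis a - sprod (coaxis a) (n r) *\<^sub>R n r)"
    have sc: "smooth_on (\<lambda>r. sprod (coaxis a) (n r)) U"
      by (intro smooth_on_sprod smooth_on_const open_U smooth_n)
    have sn: "smooth_on (\<lambda>r. sprod (coaxis a) (n r) *\<^sub>R n r) U"
      by (intro smooth_on_scaleR open_U smooth_n sc)
    have Z: "smooth_on Z U"
      unfolding Z_def by (intro smooth_on_diff smooth_on_const open_U sn)
    have "laplace y (\<lambda>r. y r $ a) q = (\<Sum>i\<in>UNIV. \<epsilon> i * sprod (Fd Z q (\<xi> i q)) (e i q))"
    proof (rule laplace_frame[OF q Z])
      fix r assume r: "r \<in> U"
      have "Z r = (\<Sum>i\<in>UNIV. (\<epsilon> i * sprod (coaxis a) (e i r)) *\<^sub>R e i r)"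
        using frame_expansion[OF r, of "coaxis a"] by (simp add: Z_def algebra_simps)
      then show "Z r \<in> range (Fd y r)" using tangentI[OF r] by simp
      fix h
      have "Fd (\<lambda>r. y r $ a) r h = Fd y r h $ a"
        by (rule Fd_eqI[OF bounded_linear.has_derivative[OF bounded_linear_vec_nth
              smooth_on_has_derivative[OF smooth_y r]]])
      then show "sprod (Z r) (Fd y r h) = Fd (\<lambda>r. y r $ a) r h"
        by (simp add: Z_def sprod_simps n_orth[OF r] sprod_coaxis)
    qed
    moreover have "\<epsilon> i * sprod (Fd Z q (\<xi> i q)) (e i q) = n q $ a * k i q" for i
    proof -
      have "Fd Z q (\<xi> i q) = - (sprod (coaxis a) (n q) *\<^sub>R Fd n q (\<xi> i q)
          + sprod (coaxis a) (Fd n q (\<xi> i q)) *\<^sub>R n q)"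
        unfolding Z_def
        by (simp add: Fd_diff[OF smooth_on_const[OF open_U] sn q] Fd_const
            Fd_scaleR[OF sc smooth_n q] Fd_sprod_const[OF smooth_n q])
      then show ?thesis
        by (simp add: sprod_simps Dn_\<xi>[OF q] e_orth[OF q] n_e[OF q]
            sprod_coaxis eps_cancel mult.left_commute[of "\<epsilon> _"])
           (simp add: mult.commute mult.left_commute eps)
    qed
    ultimately show ?thesis by (simp add: sum_distrib_left[symmetric])
  qed
  then show ?thesis by (simp add: laplace_vec_def vec_eq_iff)
qed

end

section \<open>Biconservativity and the structure equations\<close>

text \<open>The bilaplacian is defined componentwise. Its component a is a functional linear in c,
  evaluated at \<open>coaxis a\<close>; hence its product with \<open>e 1\<close> is that functional
  evaluated at \<open>e 1\<close>.\<close>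

lemma sprod_linear_functional:
  assumes "linear W" shows "sprod (\<chi> a. W (coaxis a)) w = W w"
proof -
  have "w = (- w $ 1) *\<^sub>R coaxis 1 + ((- w $ 2) *\<^sub>R coaxis 2 + (w $ 3 *\<^sub>R coaxis 3 + (w $ 4 *\<^sub>R coaxis 4 +
      w $ 5 *\<^sub>R coaxis 5)))"
    unfolding vec_eq_iff forall_5 by (simp add: coaxis_def axis_def)
  then have "W w = W ((- w $ 1) *\<^sub>R coaxis 1 + ((- w $ 2) *\<^sub>R coaxis 2 + (w $ 3 *\<^sub>R coaxis 3 +
      (w $ 4 *\<^sub>R coaxis 4 + w $ 5 *\<^sub>R coaxis 5))))" by (rule arg_cong)
  also have "\<dots> = sprod (\<chi> a. W (coaxis a)) w"
    unfolding linear_add[OF assms] linear_scale[OF assms] sprod_def by simp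
  finally show ?thesis ..
qed

locale bicons_chart = principal_chart +
  assumes bicons: "q \<in> U \<Longrightarrow> tangential_part y q (laplace_vec y (laplace_vec y y) q) = 0"
    and grad_H_e1: "q \<in> U \<Longrightarrow> \<exists>c. c \<noteq> 0 \<and> grad_H y n q = c *\<^sub>R e 1 q"
    and k1_distinct: "q \<in> U \<Longrightarrow> i \<noteq> 1 \<Longrightarrow> k 1 q \<noteq> k i q"
    and k2: "q \<in> U \<Longrightarrow> k 2 q = 0" and k3: "q \<in> U \<Longrightarrow> k 3 q = 0"
    and k4: "q \<in> U \<Longrightarrow> k 4 q \<noteq> 0"
begin

lemma k1_nonzero: "q \<in> U \<Longrightarrow> k 1 q \<noteq> 0"
  using k1_distinct[of q 2] k2[of q] by simp

lemma k1_k4: "q \<in> U \<Longrightarrow> k 1 q \<noteq> k 4 q"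
  using k1_distinct[of q 4] by simp

text \<open>Four times the mean curvature, since \<open>k 2\<close> and \<open>k 3\<close>
  vanish.\<close>

definition f :: "real^4 \<Rightarrow> real" where "f q = k 1 q + k 4 q"

text \<open>The gradient of \<open>f\<close> is \<open>\<rho>\<close> times
  \<open>e 1\<close>.\<close>

definition \<rho> :: "real^4 \<Rightarrow> real" where "\<rho> q = \<epsilon> 1 * Fd f q (\<xi> 1 q)"

lemma smooth_f: "smooth_on f U"
  unfolding f_def using smooth_on_add[OF open_U smooth_k smooth_k] .

lemma Df_\<rho>: assumes q: "q \<in> U" shows "Fd f q h = \<rho> q * sprod (e 1 q) (Fd y q h)" and "\<rho> q \<noteq> 0"
proof -
  have mc: "Fd (mean_curvature y n) q h = Fd f q h / 4" for h
  proof -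
    have "Fd (mean_curvature y n) q = Fd (\<lambda>r. f r * (1/4)) q"
      by (rule Fd_cong[OF open_U q smooth_on_mult[OF open_U smooth_f smooth_on_const[OF open_U]]])
         (simp add: mean_curvature_frame sum_4 k2 k3 f_def)
    then show ?thesis
      using Fd_mult[OF smooth_f smooth_on_const[OF open_U] q, of "1/4"] by (simp add: Fd_const)
  qed
  define t where "t = (\<Sum>i\<in>UNIV. (\<epsilon> i * Fd f q (\<xi> i q) / 4) *\<^sub>R e i q)"
  have t: "sprod t (Fd y q h) = Fd (mean_curvature y n) q h" for h
  proof -
    have "sprod t (Fd y q h) = (\<Sum>i\<in>UNIV. \<omega> i q h * Fd f q (\<xi> i q)) / 4"
      unfolding t_def sprod.sum_left sum_divide_distrib
      by (intro sum.cong refl)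
         (simp add: sprod_simps sprod_commute[of "e _ q" "Fd y q h"] sprod_Dy_e eps_cancel mult_ac)
    then show ?thesis
      using linear_expansion[OF q linear_Fd[OF smooth_f q], of h] mc[of h] by simp
  qed
  have "grad_H y n q = t"
    unfolding grad_H_def by (rule gradientI[OF q _ t]) (unfold t_def, rule tangentI[OF q])
  then obtain c where c: "c \<noteq> 0" "t = c *\<^sub>R e 1 q" using grad_H_e1[OF q] by auto
  have *: "Fd f q h = 4 * c * sprod (e 1 q) (Fd y q h)" for h
    using t[of h] mc[of h] c(2) by (simp add: sprod_simps)
  then have "\<rho> q = 4 * c" by (simp add: \<rho>_def Dy_\<xi>[OF q] e_orth[OF q] eps_cancel mult.left_commute[of "\<epsilon> 1"] eps)
  then show "Fd f q h = \<rho> q * sprod (e 1 q) (Fd y q h)" and "\<rho> q \<noteq> 0" using * c(1) by simp_all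
qed

lemma smooth_\<rho>: "smooth_on \<rho> U"
proof (rule smooth_on_coefficient[OF open_U, where \<alpha> = "\<lambda>q h. Fd f q h"])
  show "smooth_on (\<lambda>q. sprod (e 1 q) (Fd y q h)) U" for h
    by (rule smooth_on_sprod[OF open_U smooth_e smooth_Dy])
  show "smooth_on (\<lambda>q. Fd f q h) U" for h by (rule smooth_on_frechet_derivative[OF smooth_f])
  show "Fd f q h = \<rho> q * sprod (e 1 q) (Fd y q h)" if "q \<in> U" for q h by (rule Df_\<rho>(1)[OF that])
  show "\<exists>h. sprod (e 1 q) (Fd y q h) \<noteq> 0" if "q \<in> U" for q
    by (rule exI[of _ "\<xi> 1 q"]) (simp add: that Dy_\<xi> e_orth eps_nonzero)
qed

lemma Dk_zero: "q \<in> U \<Longrightarrow> Fd (k 2) q h = 0" "q \<in> U \<Longrightarrow> Fd (k 3) q h = 0"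
  using Fd_cong[OF open_U _ smooth_on_const[OF open_U, of 0], of q "k 2"]
    Fd_cong[OF open_U _ smooth_on_const[OF open_U, of 0], of q "k 3"]
  by (simp_all add: k2 k3 Fd_const)

text \<open>Codazzi with a repeated index: \<open>k 2\<close> and \<open>k 3\<close> vanish together
  with their derivatives, while \<open>k 1\<close> is never zero.\<close>

lemma G_aa1: assumes q: "q \<in> U" shows "G 2 1 2 q = 0" "G 3 1 3 q = 0"
  using codazzi_frame[OF q, of 2 1 2] codazzi_frame[OF q, of 3 1 3] k1_nonzero[OF q]
    G_antisym[OF q, of 2 1 2] G_antisym[OF q, of 3 1 3]
    codazzi_frame[OF q, of 2 2 1] codazzi_frame[OF q, of 3 3 1]
  by (simp_all add: k2[OF q] k3[OF q] Dk_zero[OF q])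

lemma Dk4_\<xi>1: assumes q: "q \<in> U" shows "Fd (k 4) q (\<xi> 1 q) = \<epsilon> 4 * (k 1 q - k 4 q) * G 4 1 4 q"
proof -
  have "(k 4 q - k 1 q) * G 4 4 1 q = \<epsilon> 4 * Fd (k 4) q (\<xi> 1 q)"
    using codazzi_frame[OF q, of 4 1 4] by simp
  then have "Fd (k 4) q (\<xi> 1 q) = \<epsilon> 4 * ((k 4 q - k 1 q) * G 4 4 1 q)"
    by (simp only: eps_cancel)
  then show ?thesis using G_antisym[OF q, of 4 4 1] by (simp add: algebra_simps)
qed

text \<open>\<open>Z c\<close> is the gradient of \<open>\<langle>c, f n\<rangle>\<close>, where \<open>f n\<close> is the Laplacian of the position vector.\<close>

definition Z :: "real^5 \<Rightarrow> real^4 \<Rightarrow> real^5" where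
  "Z c r = (sprod c (n r) * \<rho> r - f r * k 1 r * (\<epsilon> 1 * sprod c (e 1 r))) *\<^sub>R e 1 r
     - (f r * k 4 r * (\<epsilon> 4 * sprod c (e 4 r))) *\<^sub>R e 4 r"

lemma smooth_sprod_const: "smooth_on F U \<Longrightarrow> smooth_on (\<lambda>r. sprod c (F r)) U"
  by (rule smooth_on_sprod[OF open_U smooth_on_const[OF open_U]])

lemma smooth_Z_coefficients:
  "smooth_on (\<lambda>r. sprod c (n r) * \<rho> r - f r * k 1 r * (\<epsilon> 1 * sprod c (e 1 r))) U"
  "smooth_on (\<lambda>r. f r * k 4 r * (\<epsilon> 4 * sprod c (e 4 r))) U"
  by (intro smooth_on_diff smooth_on_mult smooth_on_const smooth_sprod_const open_U smooth_\<rho> smooth_f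
      smooth_k smooth_n smooth_e)+

lemma smooth_Z: "smooth_on (Z c) U"
  unfolding Z_def[abs_def]
  by (intro smooth_on_diff[OF open_U] smooth_on_scaleR[OF open_U] smooth_Z_coefficients smooth_e)

lemma DZ:
  assumes q: "q \<in> U"
  shows "Fd (Z c) q h =
    (sprod c (n q) * \<rho> q - f q * k 1 q * (\<epsilon> 1 * sprod c (e 1 q))) *\<^sub>R Fd (e 1) q h
    + (sprod c (n q) * Fd \<rho> q h + sprod c (Fd n q h) * \<rho> q
      - (f q * k 1 q * (\<epsilon> 1 * sprod c (Fd (e 1) q h))
         + (f q * Fd (k 1) q h + Fd f q h * k 1 q) * (\<epsilon> 1 * sprod c (e 1 q)))) *\<^sub>R e 1 q
    - ((f q * k 4 q * (\<epsilon> 4 * sprod c (e 4 q))) *\<^sub>R Fd (e 4) q h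
      + (f q * k 4 q * (\<epsilon> 4 * sprod c (Fd (e 4) q h))
         + (f q * Fd (k 4) q h + Fd f q h * k 4 q) * (\<epsilon> 4 * sprod c (e 4 q))) *\<^sub>R e 4 q)"
proof -
  note sE = smooth_sprod_const[OF smooth_e, of c] and sn = smooth_sprod_const[OF smooth_n, of c]
  note sc = smooth_on_const[OF open_U]
  note sm = smooth_on_mult[OF open_U]
  have s: "Fd (\<lambda>r. \<epsilon> i * sprod c (e i r)) q h = \<epsilon> i * sprod c (Fd (e i) q h)" for i
    using Fd_mult[OF sc sE q] by (simp add: Fd_const Fd_sprod_const[OF smooth_e q])
  have 1: "Fd (\<lambda>r. f r * k i r * (\<epsilon> i * sprod c (e i r))) q h =
      f q * k i q * (\<epsilon> i * sprod c (Fd (e i) q h))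
         + (f q * Fd (k i) q h + Fd f q h * k i q) * (\<epsilon> i * sprod c (e i q))" for i
    unfolding Fd_mult[OF sm[OF smooth_f smooth_k] sm[OF sc sE] q] Fd_mult[OF smooth_f smooth_k q] s ..
  have 2: "Fd (\<lambda>r. sprod c (n r) * \<rho> r) q h = sprod c (n q) * Fd \<rho> q h + sprod c (Fd n q h) * \<rho> q"
    unfolding Fd_mult[OF sn smooth_\<rho> q] Fd_sprod_const[OF smooth_n q] ..
  have 3: "Fd (\<lambda>r. sprod c (n r) * \<rho> r - f r * k 1 r * (\<epsilon> 1 * sprod c (e 1 r))) q h =
    sprod c (n q) * Fd \<rho> q h + sprod c (Fd n q h) * \<rho> q
      - (f q * k 1 q * (\<epsilon> 1 * sprod c (Fd (e 1) q h))
         + (f q * Fd (k 1) q h + Fd f q h * k 1 q) * (\<epsilon> 1 * sprod c (e 1 q)))"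
    unfolding Fd_diff[OF sm[OF sn smooth_\<rho>] sm[OF sm[OF smooth_f smooth_k] sm[OF sc sE]] q] 1 2 ..
  have 4: "Fd (Z c) q h =
      Fd (\<lambda>r. (sprod c (n r) * \<rho> r - f r * k 1 r * (\<epsilon> 1 * sprod c (e 1 r))) *\<^sub>R e 1 r) q h
      - Fd (\<lambda>r. (f r * k 4 r * (\<epsilon> 4 * sprod c (e 4 r))) *\<^sub>R e 4 r) q h"
    unfolding Z_def[abs_def]
    by (rule Fd_diff[OF smooth_on_scaleR[OF open_U smooth_Z_coefficients(1) smooth_e]
          smooth_on_scaleR[OF open_U smooth_Z_coefficients(2) smooth_e] q])
  show ?thesis
    unfolding 4 Fd_scaleR[OF smooth_Z_coefficients(1) smooth_e q]
      Fd_scaleR[OF smooth_Z_coefficients(2) smooth_e q] 1 3 ..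
qed

lemma bilaplace:
  assumes q: "q \<in> U"
  shows "laplace_vec y (laplace_vec y y) q $ a =
    (\<Sum>i\<in>UNIV. \<epsilon> i * sprod (Fd (Z (coaxis a)) q (\<xi> i q)) (e i q))"
proof -
  let ?c = "coaxis a"
  have "laplace y (\<lambda>r. laplace_vec y y r $ a) q =
    (\<Sum>i\<in>UNIV. \<epsilon> i * sprod (Fd (Z ?c) q (\<xi> i q)) (e i q))"
  proof (rule laplace_frame[OF q smooth_Z])
    fix r assume r: "r \<in> U"
    have "Z ?c r = (\<Sum>i\<in>UNIV. (if i = 1 then sprod ?c (n r) * \<rho> r - f r * k 1 r * (\<epsilon> 1 * sprod ?c (e 1 r))
        else if i = 4 then - (f r * k 4 r * (\<epsilon> 4 * sprod ?c (e 4 r))) else 0) *\<^sub>R e i r)"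
      by (simp add: sum_4 Z_def)
    then show "Z ?c r \<in> range (Fd y r)" using tangentI[OF r] by simp
    fix h
    note sn = smooth_sprod_const[OF smooth_n, of ?c]
    have "Fd (\<lambda>r. laplace_vec y y r $ a) r = Fd (\<lambda>r. f r * sprod ?c (n r)) r"
      by (rule Fd_cong[OF open_U r smooth_on_mult[OF open_U smooth_f sn]])
         (simp add: laplace_position sum_4 k2 k3 f_def sprod_coaxis)
    then have "Fd (\<lambda>r. laplace_vec y y r $ a) r h = f r * sprod ?c (Fd n r h) + Fd f r h * sprod ?c (n r)"
      using Fd_mult[OF smooth_f sn r] Fd_sprod_const[OF smooth_n r, of ?c] by simp
    moreover have "sprod ?c (Fd n r h) = - (k 1 r * \<omega> 1 r h * sprod ?c (e 1 r)) - k 4 r * \<omega> 4 r h * sprod ?c (e 4 r)"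
      using linear_expansion[OF r linear_Fd[OF smooth_n r], of h]
      by (simp add: Dn_\<xi>[OF r] sum_4 k2[OF r] k3[OF r] sprod_simps mult_ac)
    ultimately show "sprod (Z ?c r) (Fd y r h) = Fd (\<lambda>r. laplace_vec y y r $ a) r h"
      unfolding Df_\<rho>(1)[OF r]
      by (simp add: Z_def sprod_simps sprod_commute[of "e _ r" "Fd y r h"] sprod_Dy_e eps_cancel)
         (simp add: algebra_simps eps_cancel)
  qed
  then show ?thesis by (simp add: laplace_vec_def)
qed

text \<open>The Codazzi equation rewrites the connection term in the \<open>e 1\<close> component of
  the bilaplacian through the derivative of \<open>k 4\<close> along \<open>e 1\<close>. Everything
  collapses to \<rho> (f + 2 k_1) = 0, and f = 4 H makes this the relation k_1 = -2 H.\<close>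

lemma k4_eq: assumes q: "q \<in> U" shows "k 4 q = - 3 * k 1 q"
proof -
  let ?W = "\<lambda>c. \<Sum>i\<in>UNIV. \<epsilon> i * sprod (Fd (Z c) q (\<xi> i q)) (e i q)"
  let ?v = "laplace_vec y (laplace_vec y y) q"
  have "linear ?W"
    unfolding DZ[OF q] linear_iff
    by (simp add: sprod_simps algebra_simps sum.distrib sum_subtractf sum_distrib_left)
  then have "sprod (\<chi> a. ?W (coaxis a)) (e 1 q) = ?W (e 1 q)" by (rule sprod_linear_functional)
  moreover have "?v = (\<chi> a. ?W (coaxis a))" unfolding vec_eq_iff using bilaplace[OF q] by simp
  moreover have "sprod ?v (e 1 q) = 0"
  proof -
    have "sprod (\<Sum>i\<in>UNIV. (\<epsilon> i * sprod ?v (e i q)) *\<^sub>R e i q) (e 1 q) = 0"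
      using bicons[OF q] unfolding tangential_part_frame[OF q] by (simp add: sprod_simps)
    then show ?thesis by (simp add: sum_4 sprod_simps e_orth[OF q] mult_ac eps_cancel)
  qed
  ultimately have W: "?W (e 1 q) = 0" by simp
  have e1: "sprod (e 1 q) (Fd (e 1) q h) = 0" for h
    using De_e[OF q, of 1 h 1] by (simp add: sprod_commute)
  \<comment> \<open>The constant vector is frozen at the value of \<open>e 1\<close> at
    \<open>q\<close>, so it is not differentiated and orthonormality removes most terms.\<close>
  have "Fd (Z (e 1 q)) q h = - (f q * k 1 q) *\<^sub>R Fd (e 1) q h
      + (sprod (e 1 q) (Fd n q h) * \<rho> q - (f q * Fd (k 1) q h + Fd f q h * k 1 q)) *\<^sub>R e 1 q
      - (f q * k 4 q * (\<epsilon> 4 * sprod (e 1 q) (Fd (e 4) q h))) *\<^sub>R e 4 q" for h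
    unfolding DZ[OF q] by (simp add: e_orth[OF q] e_n[OF q] e1 eps)
  then have "?W (e 1 q) = \<epsilon> 1 * ((- k 1 q * \<epsilon> 1 * \<rho> q - (f q * Fd (k 1) q (\<xi> 1 q) + Fd f q (\<xi> 1 q) * k 1 q)) * \<epsilon> 1)
      + \<epsilon> 4 * (- f q * k 1 q * G 4 1 4 q - f q * k 4 q * (\<epsilon> 4 * G 4 4 1 q) * \<epsilon> 4)"
    by (simp add: sum_4 sprod_simps e_orth[OF q] Dn_\<xi>[OF q] G_def[symmetric] G_aa1[OF q] G_self[OF q]
        sprod_commute[of "e 1 q" "Fd (e 4) q _"])
  also have "\<dots> = - k 1 q * \<epsilon> 1 * \<rho> q - f q * Fd (k 1) q (\<xi> 1 q) - Fd f q (\<xi> 1 q) * k 1 q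
      - f q * (\<epsilon> 4 * (k 1 q - k 4 q) * G 4 1 4 q)"
    using G_antisym[OF q, of 4 4 1] by (simp add: algebra_simps eps_cancel)
  also have "\<dots> = - k 1 q * \<epsilon> 1 * \<rho> q - f q * (Fd (k 1) q (\<xi> 1 q) + Fd (k 4) q (\<xi> 1 q)) - Fd f q (\<xi> 1 q) * k 1 q"
    unfolding Dk4_\<xi>1[OF q, symmetric] by (simp add: algebra_simps)
  also have "Fd (k 1) q (\<xi> 1 q) + Fd (k 4) q (\<xi> 1 q) = Fd f q (\<xi> 1 q)"
    unfolding f_def[abs_def] by (rule Fd_add[OF smooth_k smooth_k q, symmetric])
  also have "Fd f q (\<xi> 1 q) = \<rho> q * \<epsilon> 1"
    unfolding Df_\<rho>(1)[OF q] by (simp add: Dy_\<xi>[OF q] e_orth[OF q])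
  finally have "\<rho> q * \<epsilon> 1 * (f q + 2 * k 1 q) = 0" using W by (simp add: algebra_simps)
  then show ?thesis using Df_\<rho>(2)[OF q] eps_nonzero[of 1] by (simp add: f_def)
qed

section \<open>Vanishing of connection coefficients\<close>

lemma Dk_f:
  assumes q: "q \<in> U"
  shows "Fd (k 1) q h = - Fd f q h / 2" "Fd (k 4) q h = 3 / 2 * Fd f q h"
proof -
  note sc = smooth_on_const[OF open_U]
  have 1: "Fd (k 1) q = Fd (\<lambda>r. (- 1/2) * f r) q"
    by (rule Fd_cong[OF open_U q smooth_on_mult[OF open_U sc smooth_f]]) (simp add: f_def k4_eq)
  have 4: "Fd (k 4) q = Fd (\<lambda>r. (3/2) * f r) q"
    by (rule Fd_cong[OF open_U q smooth_on_mult[OF open_U sc smooth_f]]) (simp add: f_def k4_eq)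
  show "Fd (k 1) q h = - Fd f q h / 2" "Fd (k 4) q h = 3 / 2 * Fd f q h"
    unfolding 1 4 Fd_mult[OF sc smooth_f q] Fd_const by simp_all
qed

lemma Df_\<xi>: "q \<in> U \<Longrightarrow> i \<noteq> 1 \<Longrightarrow> Fd f q (\<xi> i q) = 0"
  by (simp add: Df_\<rho>(1) Dy_\<xi> e_orth)

text \<open>The symmetry of the Hessian of F when grad F = m e_1, written without covariant
  derivatives. It is applied to \<open>f\<close> and later to \<open>k 4\<close>.\<close>

lemma dual_oneform_closed:
  assumes q: "q \<in> U" and m: "smooth_on m U" and F: "smooth_on F U"
    and DF: "\<And>r h. r \<in> U \<Longrightarrow> Fd F r h = m r * sprod (e 1 r) (Fd y r h)"
  shows "m q * sprod (Fd (e 1) q h') (Fd y q h) + Fd m q h' * sprod (e 1 q) (Fd y q h) =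
    m q * sprod (Fd (e 1) q h) (Fd y q h') + Fd m q h * sprod (e 1 q) (Fd y q h')"
proof -
  let ?E = "\<lambda>r. m r *\<^sub>R e 1 r"
  have E: "smooth_on ?E U" by (rule smooth_on_scaleR[OF open_U m smooth_e])
  have "Fd (\<lambda>r. sprod (?E r) (Fd y r h)) q = Fd (\<lambda>r. Fd F r h) q" for h
    by (rule Fd_cong[OF open_U q smooth_on_frechet_derivative[OF F]]) (simp add: DF sprod_simps)
  then have "Fd (\<lambda>r. sprod (?E r) (Fd y r h)) q h' - Fd (\<lambda>r. sprod (?E r) (Fd y r h')) q h = 0"
    using second_derivative_symmetric[OF open_U q F, of h h'] by simp
  then show ?thesis
    unfolding exterior_derivative[OF q E] Fd_scaleR[OF m smooth_e q] by (simp add: sprod_simps)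
qed

text \<open>For distinct indices the Codazzi equations only make \<open>G\<^bsub>a14\<^esub>\<close> and \<open>G\<^bsub>41a\<^esub>\<close> proportional;
  the symmetry of the Hessian of \<open>f\<close> makes them equal, hence zero.\<close>

lemma G_vanishing:
  assumes q: "q \<in> U" and a: "a = 2 \<or> a = 3"
  shows "G a 1 l q = 0" "G a 4 l q = 0" "G 1 1 l q = 0" "G 1 4 a q = 0" "G 4 1 a q = 0" "G 4 4 a q = 0"
proof -
  have ka: "k a q = 0" "\<And>h. Fd (k a) q h = 0" "a \<noteq> 1" "a \<noteq> 4"
    using a k2[OF q] k3[OF q] Dk_zero[OF q] by auto
  note nz = k1_nonzero[OF q] k1_k4[OF q] k4[OF q]
  have D0: "Fd (k 1) q (\<xi> i q) = 0" "Fd (k 4) q (\<xi> i q) = 0" if "i \<noteq> 1" for i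
    unfolding Dk_f[OF q] Df_\<xi>[OF q that] by simp_all
  have aa1: "G a a 1 q = 0" using codazzi_frame[OF q, of a 1 a] ka nz by simp
  have aa4: "G a a 4 q = 0" using codazzi_frame[OF q, of a 4 a] ka nz by simp
  have 11: "G 1 1 b q = 0" if "b = 2 \<or> b = 3" for b
    using codazzi_frame[OF q, of 1 b 1] that nz D0 k2[OF q] k3[OF q] by auto
  have 114: "G 1 1 4 q = 0" using codazzi_frame[OF q, of 1 4 1] nz D0 by simp
  have 44: "G 4 4 a q = 0" using codazzi_frame[OF q, of 4 a 4] nz D0 ka by simp
  have ab: "G a b 1 q = 0 \<and> G a b 4 q = 0" if "b = 2 \<or> b = 3" "b \<noteq> a" for b
  proof -
    have kb: "k b q = 0" "b \<noteq> 1" "b \<noteq> 4" using that k2[OF q] k3[OF q] by auto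
    show ?thesis
      using codazzi_frame[OF q, of b a 1] codazzi_frame[OF q, of b a 4] kb ka nz that(2) by auto
  qed
  have X: "G a 1 4 q = G 4 1 a q"
    using dual_oneform_closed[OF q smooth_\<rho> smooth_f Df_\<rho>(1), of "\<xi> 4 q" "\<xi> a q"] ka Df_\<rho>(2)[OF q]
    by (simp add: Dy_\<xi>[OF q] e_orth[OF q] G_def)
  \<comment> \<open>Once the two coefficients are equal, this reads
    \<open>k 4 q * G a 1 4 q = 0\<close>.\<close>
  have "k 1 q * G 4 1 a q + (k 4 q - k 1 q) * G a 1 4 q = 0"
    using codazzi_frame[OF q, of 1 a 4] ka by simp
  then have a14: "G a 1 4 q = 0" using X nz by (simp add: algebra_simps)
  then show 41: "G 4 1 a q = 0" using X by simp
  have "(k 4 q - k 1 q) * G a 4 1 q + (0 - k 4 q) * G 1 4 a q = 0"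
    using codazzi_frame[OF q, of 4 1 a] ka by simp
  then show "G 1 4 a q = 0" using a14 G_antisym[OF q, of a 4 1] nz by simp
  show "G 4 4 a q = 0" by (rule 44)
  have l: "l = 1 \<or> l = 4 \<or> l = a \<or> (l = 2 \<or> l = 3) \<and> l \<noteq> a" using exhaust_4[of l] a by auto
  then show "G a 1 l q = 0"
    using G_self[OF q] a14 aa1 ab[of l] G_antisym[OF q, of a 1 l] by auto
  show "G a 4 l q = 0"
    using l G_self[OF q] a14 aa4 ab[of l] G_antisym[OF q, of a 4 l] by auto
  show "G 1 1 l q = 0" using exhaust_4[of l] G_self[OF q] 114 11[of l] by auto
qed

lemma G_14: "q \<in> U \<Longrightarrow> G 1 4 l q = 0"
  using exhaust_4[of l] G_vanishing(4)[of q] G_self[of q 1 4] G_vanishing(3)[of q 2 4] G_antisym[of q 1 4 1]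
  by auto

text \<open>The \<open>e 4\<close> coefficient of the derivative of \<open>e 1\<close> along
  \<open>e 4\<close>; it turns out to be the logarithmic derivative of the radius along
  \<open>e 1\<close>.\<close>

definition \<theta> :: "real^4 \<Rightarrow> real" where "\<theta> q = \<epsilon> 4 * G 4 1 4 q"

section \<open>Structure equations of the profile surface\<close>

lemma Dn: assumes q: "q \<in> U" shows "Fd n q h = - (k 1 q * \<omega> 1 q h) *\<^sub>R e 1 q - (k 4 q * \<omega> 4 q h) *\<^sub>R e 4 q"
  by (subst linear_expansion[OF q linear_Fd[OF smooth_n q], where h = h])
     (simp add: sum_4 Dn_\<xi>[OF q] k2[OF q] k3[OF q] mult_ac)

lemma De1:
  assumes q: "q \<in> U"
  shows "Fd (e 1) q h = (\<epsilon> 1 * k 1 q * \<omega> 1 q h) *\<^sub>R n q + (\<theta> q * \<omega> 4 q h) *\<^sub>R e 4 q"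
  by (subst linear_expansion[OF q linear_Fd[OF smooth_e q], where h = h])
     (simp add: sum_4 De_expansion[OF q] G_vanishing[OF q] G_vanishing(3)[OF q, of 2] G_self[OF q]
       \<theta>_def mult_ac scaleR_add_right)

text \<open>Up to the factor \<open>\<epsilon> 4\<close>, the derivative of \<open>e 4\<close> along
  itself: the acceleration of the orbits of the rotation.\<close>

definition V :: "real^4 \<Rightarrow> real^5" where "V q = k 4 q *\<^sub>R n q - (\<epsilon> 1 * \<theta> q) *\<^sub>R e 1 q"

lemma De4:
  assumes q: "q \<in> U"
  shows "Fd (e 4) q h = (\<epsilon> 4 * \<omega> 4 q h) *\<^sub>R V q"
  by (subst linear_expansion[OF q linear_Fd[OF smooth_e q], where h = h])
     (simp add: sum_4 De_expansion[OF q] G_vanishing[OF q] G_14[OF q] G_self[OF q] \<theta>_def V_def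
       G_antisym[OF q, of 4 4 1] algebra_simps eps_cancel)

lemma smooth_\<theta>: "smooth_on \<theta> U"
proof (rule smooth_on_coefficient[OF open_U, where \<alpha> = "\<lambda>q h. sprod (Fd (e 1) q h) (e 4 q)"])
  show "smooth_on (\<lambda>q. \<epsilon> 4 * \<omega> 4 q h) U" for h
    by (intro smooth_on_mult smooth_on_const open_U smooth_\<omega>)
  show "smooth_on (\<lambda>q. sprod (Fd (e 1) q h) (e 4 q)) U" for h
    by (intro smooth_on_sprod open_U smooth_on_frechet_derivative smooth_e)
  show "sprod (Fd (e 1) q h) (e 4 q) = \<theta> q * (\<epsilon> 4 * \<omega> 4 q h)" if "q \<in> U" for q h
    using that by (simp add: De1 sprod_simps n_e e_orth)
  show "\<exists>h. \<epsilon> 4 * \<omega> 4 q h \<noteq> 0" if "q \<in> U" for q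
    by (rule exI[of _ "\<xi> 4 q"]) (simp add: that \<omega>_\<xi> eps_nonzero)
qed

lemma smooth_V: "smooth_on V U"
  unfolding V_def[abs_def]
  by (intro smooth_on_diff smooth_on_scaleR smooth_on_mult smooth_on_const open_U smooth_k smooth_n
      smooth_e smooth_\<theta>)

lemma Dk4: assumes q: "q \<in> U" shows "Fd (k 4) q h = - (4/3) * k 4 q * \<theta> q * \<omega> 1 q h"
proof -
  have "Fd (k 4) q (\<xi> i q) = 0" if "i \<noteq> 1" for i
    unfolding Dk_f[OF q] Df_\<xi>[OF q that] by simp
  moreover have "Fd (k 4) q (\<xi> 1 q) = - (4/3) * k 4 q * \<theta> q"
    unfolding Dk4_\<xi>1[OF q] \<theta>_def k4_eq[OF q] by (simp add: algebra_simps)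
  ultimately show ?thesis
    by (subst linear_expansion[OF q linear_Fd[OF smooth_k q], where h = h]) (simp add: sum_4)
qed

text \<open>Integrability of de_4 = <e_4, dy> V. It takes the place of the Gauss equation in the
  computation of d\<theta>.\<close>

lemma De4_closed:
  assumes q: "q \<in> U"
  shows "sprod (e 4 q) (Fd y q h) *\<^sub>R Fd V q h' - sprod (e 4 q) (Fd y q h') *\<^sub>R Fd V q h +
    (sprod (Fd (e 4) q h') (Fd y q h) - sprod (Fd (e 4) q h) (Fd y q h')) *\<^sub>R V q = 0"
proof -
  let ?s = "\<lambda>h r. sprod (e 4 r) (Fd y r h)"
  have s: "smooth_on (?s h) U" for h by (rule smooth_on_sprod[OF open_U smooth_e smooth_Dy])
  have "Fd (\<lambda>r. ?s h r *\<^sub>R V r) q = Fd (\<lambda>r. Fd (e 4) r h) q" for h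
    by (rule Fd_cong[OF open_U q smooth_on_frechet_derivative[OF smooth_e]])
       (simp add: De4 sprod_commute[of "e 4 _" "Fd y _ _"] sprod_Dy_e)
  then have "Fd (\<lambda>r. ?s h r *\<^sub>R V r) q h' - Fd (\<lambda>r. ?s h' r *\<^sub>R V r) q h = 0"
    using second_derivative_symmetric[OF open_U q smooth_e[of 4], of h h'] by simp
  then show ?thesis
    unfolding exterior_derivative[OF q smooth_e, symmetric] Fd_scaleR[OF s smooth_V q]
    by (simp add: algebra_simps)
qed

text \<open>A Riccati equation along \<open>e 1\<close>. Integrability of de_4, evaluated on
  \<open>\<xi> 4\<close> and another frame direction, gives the derivatives along
  \<open>\<xi> 1\<close>, \<open>\<xi> 2\<close> and \<open>\<xi> 3\<close>; it is void for the
  direction \<open>\<xi> 4\<close> itself, which is settled by the closedness of dk_4.\<close>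

lemma D\<theta>: assumes q: "q \<in> U" shows "Fd \<theta> q h = (- (\<theta> q)\<^sup>2 + \<epsilon> 1 * (k 4 q)\<^sup>2 / 3) * \<omega> 1 q h"
proof -
  note sc = smooth_on_const[OF open_U]
  have k1: "k 1 q = - k 4 q / 3" using k4_eq[OF q] by simp
  have Ve1: "sprod (V q) (e 1 q) = - \<theta> q"
    by (simp add: V_def sprod_simps n_e[OF q] e_orth[OF q] mult_ac eps_cancel)
  have Vei: "sprod (V q) (e i q) = 0" if "i \<noteq> 1" for i
    using that by (simp add: V_def sprod_simps n_e[OF q] e_orth[OF q])
  have DV: "sprod (Fd V q h) (e 1 q) = k 4 q * sprod (Fd n q h) (e 1 q) - Fd \<theta> q h" for h
  proof -
    have e1: "sprod (Fd (e 1) q h) (e 1 q) = 0" using De_e[OF q, of 1 h 1] by simp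
    have et: "Fd (\<lambda>r. \<epsilon> 1 * \<theta> r) q h = \<epsilon> 1 * Fd \<theta> q h"
      unfolding Fd_mult[OF sc smooth_\<theta> q] Fd_const by simp
    have "Fd V q h = k 4 q *\<^sub>R Fd n q h + Fd (k 4) q h *\<^sub>R n q - ((\<epsilon> 1 * \<theta> q) *\<^sub>R Fd (e 1) q h +
        (\<epsilon> 1 * Fd \<theta> q h) *\<^sub>R e 1 q)"
      unfolding V_def[abs_def] Fd_diff[OF smooth_on_scaleR[OF open_U smooth_k smooth_n]
          smooth_on_scaleR[OF open_U smooth_on_mult[OF open_U sc smooth_\<theta>] smooth_e] q]
        Fd_scaleR[OF smooth_k smooth_n q] Fd_scaleR[OF smooth_on_mult[OF open_U sc smooth_\<theta>] smooth_e q] et ..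
    then show ?thesis
      by (simp add: sprod_simps e1 n_e[OF q] e_orth[OF q] mult_ac eps_cancel)
  qed
  note frame = Dy_\<xi>[OF q] e_orth[OF q] De4[OF q] \<omega>_\<xi>[OF q] sprod_simps Ve1 Vei
  have "\<epsilon> 4 *\<^sub>R Fd V q (\<xi> 1 q) + (\<epsilon> 4 * \<theta> q) *\<^sub>R V q = 0"
    using De4_closed[OF q, of "\<xi> 4 q" "\<xi> 1 q"] by (simp add: frame)
  then have "\<epsilon> 4 *\<^sub>R (Fd V q (\<xi> 1 q) + \<theta> q *\<^sub>R V q) = 0" by (simp add: scaleR_add_right)
  then have "Fd V q (\<xi> 1 q) = - \<theta> q *\<^sub>R V q" using eps_nonzero[of 4] by (simp add: eq_neg_iff_add_eq_0)
  then have 1: "Fd \<theta> q (\<xi> 1 q) = - (\<theta> q)\<^sup>2 + \<epsilon> 1 * (k 4 q)\<^sup>2 / 3"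
    using DV[of "\<xi> 1 q"] by (simp add: frame Dn_\<xi>[OF q] k1 power2_eq_square)
  have 2: "Fd \<theta> q (\<xi> a q) = 0" if "a = 2 \<or> a = 3" for a
  proof -
    have a: "a \<noteq> 1" "a \<noteq> 4" "k a q = 0" using that k2[OF q] k3[OF q] by auto
    have "\<epsilon> 4 *\<^sub>R Fd V q (\<xi> a q) = 0"
      using De4_closed[OF q, of "\<xi> 4 q" "\<xi> a q"] a by (simp add: frame)
    then show ?thesis using DV[of "\<xi> a q"] eps_nonzero[of 4] a by (simp add: Dn_\<xi>[OF q] sprod_simps)
  qed
  have 4: "Fd \<theta> q (\<xi> 4 q) = 0"
  proof -
    \<comment> \<open>Read off from \<open>Dk4\<close>: with this factor, dk_4 = m <e_1,
      dy>.\<close>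
    let ?m = "\<lambda>r. - (4/3) * \<epsilon> 1 * (k 4 r * \<theta> r)"
    have sk: "smooth_on (\<lambda>r. k 4 r * \<theta> r) U" by (rule smooth_on_mult[OF open_U smooth_k smooth_\<theta>])
    have m: "smooth_on ?m U" by (rule smooth_on_mult[OF open_U sc sk])
    have "Fd (k 4) r h = ?m r * sprod (e 1 r) (Fd y r h)" if "r \<in> U" for r h
      unfolding Dk4[OF that] by (simp add: sprod_commute[of "e 1 r" "Fd y r h"] sprod_Dy_e mult_ac eps_cancel)
    from dual_oneform_closed[OF q m smooth_k this, of "\<xi> 4 q" "\<xi> 1 q"]
    have "Fd ?m q (\<xi> 4 q) * \<epsilon> 1 = 0"
      using De1[OF q, of "\<xi> 1 q"] De_e[OF q, of 1 "\<xi> 4 q" 1] by (auto simp add: frame n_e[OF q])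
    moreover have "Fd ?m q (\<xi> 4 q) = - (4/3) * \<epsilon> 1 * (k 4 q * Fd \<theta> q (\<xi> 4 q))"
      unfolding Fd_mult[OF sc sk q] Fd_const Fd_mult[OF smooth_k smooth_\<theta> q] Dk4[OF q]
      by (simp add: \<omega>_\<xi>[OF q])
    ultimately show ?thesis using k4[OF q] eps_nonzero[of 1] by simp
  qed
  show ?thesis
    by (subst linear_expansion[OF q linear_Fd[OF smooth_\<theta> q], where h = h]) (simp add: sum_4 1 2 4)
qed

end

lemma bicons_chart_subset:
  assumes "bicons_chart U y n e \<epsilon> k" "open U'" "U' \<subseteq> U"
  shows "bicons_chart U' y n e \<epsilon> k"
proof -
  interpret bicons_chart U y n e \<epsilon> k by (rule assms(1))
  have sub: "q \<in> U" if "q \<in> U'" for q using that assms(3) by blast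
  show ?thesis
    by (intro bicons_chart.intro principal_chart.intro bicons_chart_axioms.intro assms(2)
        smooth_on_subset[OF smooth_y assms(3)] smooth_on_subset[OF smooth_n assms(3)]
        smooth_on_subset[OF smooth_e assms(3)] inj_y[OF sub] e_tangent[OF sub] e_orth[OF sub] eps
        n_unit[OF sub] n_orth[OF sub] shape[OF sub] bicons[OF sub] grad_H_e1[OF sub] k1_distinct[OF sub]
        k2[OF sub] k3[OF sub] k4[OF sub]; assumption)
qed

section \<open>Adapted coordinates\<close>

lemma Fd_vec_nth: "(F has_derivative F') (at q) \<Longrightarrow> Fd (\<lambda>r. F r $ i) q h = F' h $ i"
  by (rule Fd_eqI, rule bounded_linear.has_derivative[OF bounded_linear_vec_nth])

lemma constant_along_segment:
  fixes F :: "real^'n \<Rightarrow> real"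
  assumes W: "convex W" "w \<in> W" "w' \<in> W" "w $ i = w' $ i"
    and F: "\<And>w. w \<in> W \<Longrightarrow> (F has_derivative (\<lambda>h. d w * h $ i)) (at w)"
  shows "F w = F w'"
proof -
  let ?p = "\<lambda>r. w + r *\<^sub>R (w' - w)"
  have p: "?p r \<in> W" if "r \<in> {0..1}" for r
  proof -
    have "(1 - r) *\<^sub>R w + r *\<^sub>R w' \<in> W" using W(1-3) that by (intro convexD_alt) auto
    then show ?thesis by (simp add: algebra_simps)
  qed
  define H where "H = (\<lambda>r. F (?p r))"
  have H: "(H has_derivative (\<lambda>h. 0)) (at r within {0..1})" if r: "r \<in> {0..1}" for r
  proof -
    have "((\<lambda>r. w + r *\<^sub>R (w' - w)) has_derivative (\<lambda>c. c *\<^sub>R (w' - w))) (at r)"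
      by (auto intro!: derivative_eq_intros)
    from has_derivative_compose[OF this F[OF p[OF r]]] have "(H has_derivative (\<lambda>h. 0)) (at r)"
      unfolding H_def using W(4) by simp
    then show ?thesis by (rule has_derivative_at_withinI)
  qed
  have "H 0 = H 1"
    using has_derivative_zero_constant[OF convex_real_interval(5)[of 0 1] H] by auto
  then show ?thesis by (simp add: H_def)
qed

text \<open>A function whose differential is a multiple of ds depends on the first coordinate alone,
  since the coordinate domain is a ball and its slices are convex. Both derivatives in the last
  conclusion refer to one point \<open>q\<close>, so that a pointwise relation between
  \<open>d1\<close> and \<open>d2\<close> becomes a differential relation between the profile
  functions.\<close>

theorem adapted_coordinates:
  fixes s t u v f1 f2 :: "real^4 \<Rightarrow> real"
  assumes U: "open U" "q0 \<in> U"
    and s: "smooth_on s U" and t: "smooth_on t U" and u: "smooth_on u U" and v: "smooth_on v U"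
    and indep: "\<And>h. Fd s q0 h = 0 \<Longrightarrow> Fd t q0 h = 0 \<Longrightarrow> Fd u q0 h = 0 \<Longrightarrow> Fd v q0 h = 0 \<Longrightarrow> h = 0"
    and f1: "smooth_on f1 U" "\<And>q h. q \<in> U \<Longrightarrow> Fd f1 q h = d1 q * Fd s q h"
    and f2: "smooth_on f2 U" "\<And>q h. q \<in> U \<Longrightarrow> Fd f2 q h = d2 q * Fd s q h"
  obtains W :: "(real^4) set" and I \<Gamma> g \<phi>1 \<phi>2 where "open W" "open (g ` W)" "g ` W \<subseteq> U" "q0 \<in> g ` W"
    "homeomorphism (g ` W) W \<Gamma> g" "smooth_on \<Gamma> (g ` W)" "smooth_on g W"
    "open I" "is_interval I" "smooth_on \<phi>1 I" "smooth_on \<phi>2 I"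
    "\<And>w. w \<in> W \<Longrightarrow> w $ 1 \<in> I \<and> s (g w) = w $ 1 \<and> t (g w) = w $ 2 \<and> u (g w) = w $ 3 \<and> v (g w) = w $ 4 \<and>
      f1 (g w) = \<phi>1 (w $ 1) \<and> f2 (g w) = \<phi>2 (w $ 1)"
    "\<And>x. x \<in> I \<Longrightarrow> \<exists>q\<in>U. deriv \<phi>1 x = d1 q \<and> deriv \<phi>2 x = d2 q"
proof -
  define \<Gamma> :: "real^4 \<Rightarrow> real^4" where
    "\<Gamma> = (\<lambda>q. \<chi> i. if i = 1 then s q else if i = 2 then t q else if i = 3 then u q else v q)"
  have \<Gamma>i: "\<Gamma> q $ 1 = s q" "\<Gamma> q $ 2 = t q" "\<Gamma> q $ 3 = u q" "\<Gamma> q $ 4 = v q" for q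
    by (simp_all add: \<Gamma>_def)
  have sm: "smooth_on \<Gamma> U"
  proof (rule smooth_on_vec[OF U(1)])
    fix i :: 4 show "smooth_on (\<lambda>q. \<Gamma> q $ i) U"
      using exhaust_4[of i] s t u v by (auto simp: \<Gamma>i)
  qed
  note D\<Gamma> = smooth_on_has_derivative[OF sm]
  have Ds: "Fd s q h = Fd \<Gamma> q h $ 1" "Fd t q h = Fd \<Gamma> q h $ 2" "Fd u q h = Fd \<Gamma> q h $ 3" "Fd v q h = Fd \<Gamma> q h $ 4"
    if "q \<in> U" for q h
    using Fd_vec_nth[OF D\<Gamma>[OF that], of 1 h] Fd_vec_nth[OF D\<Gamma>[OF that], of 2 h]
      Fd_vec_nth[OF D\<Gamma>[OF that], of 3 h] Fd_vec_nth[OF D\<Gamma>[OF that], of 4 h] by (simp_all add: \<Gamma>i)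
  have "h = 0" if "Fd \<Gamma> q0 h = 0" for h
    by (rule indep) (use that Ds[OF U(2)] in simp_all)
  from smooth_inverse_function[OF U sm this]
  obtain V W0 g where V: "open V" "V \<subseteq> U" "q0 \<in> V" and W0: "open W0" and hom: "homeomorphism V W0 \<Gamma> g"
    and g: "smooth_on g W0" and Dg: "\<And>w h. w \<in> W0 \<Longrightarrow> Fd \<Gamma> (g w) (Fd g w h) = h" by metis
  have gV: "g w \<in> V" "\<Gamma> (g w) = w" if "w \<in> W0" for w using hom that by (auto simp: homeomorphism_def)
  define w0 where "w0 = \<Gamma> q0"
  have w0: "w0 \<in> W0" "g w0 = q0" using hom V(3) by (auto simp: homeomorphism_def w0_def)
  obtain r where r: "r > 0" "ball w0 r \<subseteq> W0" using W0 w0(1) open_contains_ball by blast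
  let ?W = "ball w0 r" and ?I = "ball (w0 $ 1) r"
  \<comment> \<open>The line through \<open>w0\<close> parallel to the first axis; restriction to it
    produces the profile functions.\<close>
  let ?l = "\<lambda>x. w0 + (x - w0 $ 1) *\<^sub>R axis 1 1"
  have l: "?l x \<in> ?W" if "x \<in> ?I" for x
    using that by (simp add: dist_norm norm_minus_commute)
  have l1: "?l x $ 1 = x" for x by (simp add: axis_def)
  have FD: "((\<lambda>w. f (g w)) has_derivative (\<lambda>h. d (g w) * h $ 1)) (at w)"
    if f: "smooth_on f U" "\<And>q h. q \<in> U \<Longrightarrow> Fd f q h = d q * Fd s q h" and w: "w \<in> ?W" for f d w
  proof -
    have w: "w \<in> W0" "g w \<in> U" using w r(2) gV(1) V(2) by blast+
    have "Fd f (g w) (Fd g w h) = d (g w) * h $ 1" for h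
      by (simp add: f(2)[OF w(2)] Ds[OF w(2)] Dg[OF w(1)])
    then show ?thesis
      using has_derivative_compose[OF smooth_on_has_derivative[OF g w(1)] smooth_on_has_derivative[OF f(1) w(2)]]
      by simp
  qed
  have \<phi>: "smooth_on (\<lambda>x. f (g (?l x))) ?I \<and> (\<forall>w\<in>?W. f (g w) = f (g (?l (w $ 1)))) \<and>
      (\<forall>x\<in>?I. deriv (\<lambda>x. f (g (?l x))) x = d (g (?l x)))"
    if f: "smooth_on f U" "\<And>q h. q \<in> U \<Longrightarrow> Fd f q h = d q * Fd s q h" for f d
  proof (intro conjI ballI)
    have sl: "smooth_on ?l ?I" 
      by (intro smooth_on_add smooth_on_scaleR smooth_on_diff smooth_on_const smooth_on_id open_ball)
    have gW: "smooth_on g ?W" using g r(2) smooth_on_subset by blast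
    have sg: "smooth_on (\<lambda>x. g (?l x)) ?I"
      by (rule smooth_on_compose[OF open_ball open_ball _ sl gW]) (use l in blast)
    show "smooth_on (\<lambda>x. f (g (?l x))) ?I"
      by (rule smooth_on_compose[OF open_ball U(1) _ sg f(1)]) (use l r(2) gV(1) V(2) in blast)
    fix w assume w: "w \<in> ?W"
    have "\<bar>(w0 - w) $ 1\<bar> \<le> norm (w0 - w)" by (rule component_le_norm_cart)
    then have "w $ 1 \<in> ?I" using w by (simp add: dist_norm)
    then show "f (g w) = f (g (?l (w $ 1)))"
      using constant_along_segment[OF convex_ball w l _ FD[OF f]] l1 by metis
  next
    fix x assume x: "x \<in> ?I"
    have "(?l has_derivative (\<lambda>c. c *\<^sub>R axis 1 1)) (at x)" by (auto intro!: derivative_eq_intros)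
    from has_derivative_compose[OF this FD[of f d, OF f(1) f(2) l[OF x]]]
    have "((\<lambda>x. f (g (?l x))) has_derivative (\<lambda>c. d (g (?l x)) * c)) (at x)"
      by (simp add: axis_def)
    then have "((\<lambda>x. f (g (?l x))) has_field_derivative d (g (?l x))) (at x)"
      unfolding has_field_derivative_def .
    then show "deriv (\<lambda>x. f (g (?l x))) x = d (g (?l x))" by (rule DERIV_imp_deriv)
  qed
  have gW: "g ` ?W = V \<inter> \<Gamma> -` ?W"
  proof (intro equalityI subsetI)
    fix x assume "x \<in> g ` ?W"
    then obtain w where w: "w \<in> ?W" "x = g w" by blast
    then have "w \<in> W0" using r(2) by blast
    then show "x \<in> V \<inter> \<Gamma> -` ?W" using gV[of w] w by simp
  next
    fix x assume x: "x \<in> V \<inter> \<Gamma> -` ?W"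
    then have "g (\<Gamma> x) = x" using hom by (simp add: homeomorphism_def)
    then show "x \<in> g ` ?W" using x by (metis IntD2 image_eqI vimage_eq)
  qed
  have hom': "homeomorphism (g ` ?W) ?W \<Gamma> g"
  proof (rule homeomorphism_of_subsets[OF hom])
    show "g ` ?W \<subseteq> V" using gV r(2) by blast
    have "\<Gamma> (g w) = w" if "w \<in> ?W" for w by (rule gV(2)) (use that r(2) in blast)
    then have "(\<lambda>w. \<Gamma> (g w)) ` ?W = (\<lambda>w. w) ` ?W" by (rule image_cong[OF refl])
    then show "\<Gamma> ` g ` ?W = ?W" by (simp add: image_image)
  qed (use r in auto)
  have gWo: "open (g ` ?W)"
    unfolding gW using continuous_open_preimage[OF smooth_on_continuous_on[OF smooth_on_subset[OF sm V(2)]] V(1) open_ball] .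
  have P1: "smooth_on (\<lambda>x. f1 (g (?l x))) ?I" "\<And>w. w \<in> ?W \<Longrightarrow> f1 (g w) = f1 (g (?l (w $ 1)))"
      "\<And>x. x \<in> ?I \<Longrightarrow> deriv (\<lambda>x. f1 (g (?l x))) x = d1 (g (?l x))"
    using \<phi>[of f1 d1, OF f1(1)] f1(2) by blast+
  have P2: "smooth_on (\<lambda>x. f2 (g (?l x))) ?I" "\<And>w. w \<in> ?W \<Longrightarrow> f2 (g w) = f2 (g (?l (w $ 1)))"
      "\<And>x. x \<in> ?I \<Longrightarrow> deriv (\<lambda>x. f2 (g (?l x))) x = d2 (g (?l x))"
    using \<phi>[of f2 d2, OF f2(1)] f2(2) by blast+
  show thesis
  proof (rule that[OF open_ball gWo _ _ hom' _ _ open_ball _ P1(1) P2(1)])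
    show gU: "g ` ?W \<subseteq> U" using gV(1) r(2) V(2) by blast
    show "q0 \<in> g ` ?W" using w0(2) r(1) by (metis centre_in_ball image_eqI)
    show "smooth_on \<Gamma> (g ` ?W)" by (rule smooth_on_subset[OF sm gU])
    show "smooth_on g ?W" by (rule smooth_on_subset[OF g r(2)])
    show "is_interval ?I" by (simp add: is_interval_ball_real)
    fix w assume w: "w \<in> ?W"
    have "\<bar>(w0 - w) $ 1\<bar> \<le> norm (w0 - w)" by (rule component_le_norm_cart)
    then have "w $ 1 \<in> ?I" using w by (simp add: dist_norm)
    moreover have "\<Gamma> (g w) = w" using gV(2) w r(2) by blast
    ultimately show "w $ 1 \<in> ?I \<and> s (g w) = w $ 1 \<and> t (g w) = w $ 2 \<and> u (g w) = w $ 3 \<and> v (g w) = w $ 4 \<and>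
      f1 (g w) = f1 (g (?l (w $ 1))) \<and> f2 (g w) = f2 (g (?l (w $ 1)))"
      using \<Gamma>i[of "g w"] P1(2)[OF w] P2(2)[OF w] by (simp only:)
  next
    fix x assume x: "x \<in> ?I"
    have "g (?l x) \<in> U" using l[OF x] r(2) gV(1) V(2) by blast
    then show "\<exists>q\<in>U. deriv (\<lambda>x. f1 (g (?l x))) x = d1 q \<and> deriv (\<lambda>x. f2 (g (?l x))) x = d2 q"
      using P1(3)[OF x] P2(3)[OF x] by blast
  qed
qed

section \<open>Reparametrization within the maximal atlas\<close>

lemma openin_param_image:
  assumes c: "local_param M (V, \<psi>)" and X: "open X" "X \<subseteq> V"
  shows "openin M (\<psi> ` X)"
proof -
  have "openin (subtopology M (\<psi> ` V)) (\<psi> ` X)"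
    using c X homeomorphic_map_openness_eq[of "top_of_set V" "subtopology M (\<psi> ` V)" \<psi> X]
    by (auto simp: local_param_def openin_open)
  then show ?thesis using c openin_open_subtopology by (auto simp: local_param_def)
qed

lemma open_param_preimage:
  assumes c: "local_param M (V, \<psi>)" and Y: "openin M Y"
  shows "open {q \<in> V. \<psi> q \<in> Y}"
proof -
  have V: "open V" and h: "homeomorphic_map (top_of_set V) (subtopology M (\<psi> ` V)) \<psi>"
    using c by (auto simp: local_param_def)
  have "continuous_map (top_of_set V) M \<psi>"
    using homeomorphic_imp_continuous_map[OF h] continuous_map_in_subtopology by blast
  then have "openin (top_of_set V) {q \<in> topspace (top_of_set V). \<psi> q \<in> Y}"
    using Y openin_continuous_map_preimage by blast
  then show ?thesis using V openin_open_eq by auto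
qed

lemma param_inj: "local_param M (V, \<psi>) \<Longrightarrow> inj_on \<psi> V"
  using homeomorphic_imp_injective_map by (fastforce simp: local_param_def)

text \<open>The new transition maps are the old ones composed with \<open>g\<close> on one side or
  with its smooth inverse \<open>\<Gamma>\<close> on the other.\<close>

theorem admissible_reparametrization:
  assumes M: "smooth_manifold M A" and c: "(V, \<psi>) \<in> A"
    and W: "open W" "open (g ` W)" "g ` W \<subseteq> V" "homeomorphism (g ` W) W \<Gamma> g"
    and \<Gamma>: "smooth_on \<Gamma> (g ` W)" and g: "smooth_on g W"
  shows "admissible_param M A (W, \<psi> \<circ> g)"
proof -
  have lp: "local_param M c'" if "c' \<in> A" for c' using M that by (auto simp: smooth_manifold_def)
  have tr: "smooth_transition c1 c2" if "c1 \<in> A" "c2 \<in> A" for c1 c2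
    using M that by (auto simp: smooth_manifold_def)
  note V = lp[OF c]
  have gX: "\<Gamma> (g w) = w" if "w \<in> W" for w using W(4) that by (auto simp: homeomorphism_def)
  have \<Gamma>X: "g (\<Gamma> q) = q" "\<Gamma> q \<in> W" if "q \<in> g ` W" for q using W(4) that by (auto simp: homeomorphism_def)
  have im: "(\<psi> \<circ> g) ` W = \<psi> ` g ` W" by (simp add: image_comp)
  have loc: "local_param M (W, \<psi> \<circ> g)"
  proof -
    have h: "homeomorphic_map (top_of_set V) (subtopology M (\<psi> ` V)) \<psi>"
      using V by (auto simp: local_param_def)
    have tM: "\<psi> ` V \<subseteq> topspace M"
      using V openin_subset[of M "\<psi> ` V"] by (simp add: local_param_def)
    have "homeomorphic_map (subtopology (top_of_set V) (g ` W)) (subtopology (subtopology M (\<psi> ` V)) (\<psi> ` g ` W)) \<psi>"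
      by (rule homeomorphic_map_subtopologies[OF h]) (use W(3) tM in auto)
    then have 1: "homeomorphic_map (top_of_set (g ` W)) (subtopology M (\<psi> ` g ` W)) \<psi>"
      using W(3) by (simp add: subtopology_subtopology Int_absorb2 Int_absorb1 image_mono)
    have "homeomorphic_maps (top_of_set W) (top_of_set (g ` W)) g \<Gamma>"
      using W(4) unfolding homeomorphic_maps_def homeomorphism_def by auto
    then have "homeomorphic_map (top_of_set W) (top_of_set (g ` W)) g"
      using homeomorphic_map_maps by blast
    from homeomorphic_map_compose[OF this 1] show ?thesis
      unfolding local_param_def prod.case im using W(1) openin_param_image[OF V W(2,3)] by blast
  qed
  have "smooth_transition (W, \<psi> \<circ> g) c' \<and> smooth_transition c' (W, \<psi> \<circ> g)" if c': "c' \<in> A" for c'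
  proof -
    obtain V' \<psi>' where e: "c' = (V', \<psi>')" by (cases c')
    note V' = lp[OF c'[unfolded e]]
    let ?i = "inv_into V' \<psi>' \<circ> \<psi>" and ?j = "inv_into V \<psi> \<circ> \<psi>'"
    have o1: "open {q \<in> V. \<psi> q \<in> \<psi>' ` V'}"
      by (rule open_param_preimage[OF V]) (use V' in \<open>auto simp: local_param_def\<close>)
    have o2: "open {w \<in> W. (\<psi> \<circ> g) w \<in> \<psi>' ` V'}"
      by (rule open_param_preimage[OF loc]) (use V' in \<open>auto simp: local_param_def\<close>)
    have o3: "open {q \<in> V'. \<psi>' q \<in> (\<psi> \<circ> g) ` W}"
      by (rule open_param_preimage[OF V']) (use loc in \<open>auto simp: local_param_def\<close>)
    have si: "smooth_on ?i {q \<in> V. \<psi> q \<in> \<psi>' ` V'}" and sj: "smooth_on ?j {q \<in> V'. \<psi>' q \<in> \<psi> ` V}"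
      using tr[OF c c'] tr[OF c' c] by (auto simp: smooth_transition_def e)
    have "smooth_on (\<lambda>w. ?i (g w)) {w \<in> W. (\<psi> \<circ> g) w \<in> \<psi>' ` V'}"
      by (rule smooth_on_compose[OF o2 o1 _ smooth_on_subset[OF g] si]) (use W(3) in auto)
    moreover have "(\<lambda>w. ?i (g w)) = inv_into V' \<psi>' \<circ> (\<psi> \<circ> g)" by (simp add: fun_eq_iff)
    moreover have "smooth_on (inv_into W (\<psi> \<circ> g) \<circ> \<psi>') {q \<in> V'. \<psi>' q \<in> (\<psi> \<circ> g) ` W}"
    proof (rule smooth_on_cong[OF o3])
      have j: "?j q = p" if "\<psi>' q = \<psi> p" "p \<in> g ` W" for q p
      proof -
        have "inv_into V \<psi> (\<psi> p) = p" by (rule inv_into_f_f[OF param_inj[OF V]]) (use that W(3) in blast)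
        then show ?thesis using that by simp
      qed
      show "smooth_on (\<lambda>q. \<Gamma> (?j q)) {q \<in> V'. \<psi>' q \<in> (\<psi> \<circ> g) ` W}"
      proof (rule smooth_on_compose[OF o3 W(2) _ smooth_on_subset[OF sj] \<Gamma>])
        show "?j ` {q \<in> V'. \<psi>' q \<in> (\<psi> \<circ> g) ` W} \<subseteq> g ` W" 
          by (rule image_subsetI) (use j in auto)
        show "{q \<in> V'. \<psi>' q \<in> (\<psi> \<circ> g) ` W} \<subseteq> {q \<in> V'. \<psi>' q \<in> \<psi> ` V}" using W(3) by auto
      qed
      fix q assume "q \<in> {q \<in> V'. \<psi>' q \<in> (\<psi> \<circ> g) ` W}"
      then obtain w where w: "w \<in> W" "\<psi>' q = \<psi> (g w)" by auto
      have "?j q = g w" by (rule j[OF w(2)]) (use w in blast)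
      moreover have "inv_into W (\<psi> \<circ> g) ((\<psi> \<circ> g) w) = w" by (rule inv_into_f_f[OF param_inj[OF loc] w(1)])
      ultimately show "\<Gamma> (?j q) = (inv_into W (\<psi> \<circ> g) \<circ> \<psi>') q" using w gX by simp
    qed
    ultimately show ?thesis by (simp add: smooth_transition_def e)
  qed
  then show ?thesis using loc by (simp add: admissible_param_def)
qed

section \<open>Integration of the structure equations\<close>

text \<open>On a ball closed one-forms have primitives and maps with zero derivative are constant.
  The vector \<open>c\<close> measures the possibly lightlike axis vector \<theta> n + k_4 e_1;
  positivity allows division by this measure.\<close>

locale cylinder_ball = bicons_chart +
  fixes q0 :: "real^4" and r :: real and c :: "real^5"
  assumes r: "r > 0" and U_ball: "U = ball q0 r"
    and c_pos: "q \<in> U \<Longrightarrow> sprod c (\<theta> q *\<^sub>R n q + k 4 q *\<^sub>R e 1 q) > 0"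
begin

lemma q0: "q0 \<in> U"
  using r by (simp add: U_ball)

lemma zero_derivative_constant:
  fixes F :: "real^4 \<Rightarrow> 'b::real_normed_vector"
  assumes "\<And>q. q \<in> U \<Longrightarrow> (F has_derivative (\<lambda>h. 0)) (at q)" "q \<in> U"
  shows "F q = F q0"
proof -
  have "\<exists>a. \<forall>q\<in>U. F q = a"
    by (rule has_derivative_zero_constant) (use assms(1) in \<open>auto simp: U_ball intro: has_derivative_at_withinI\<close>)
  then show ?thesis using assms(2) q0 by auto
qed

definition g :: "real^4 \<Rightarrow> real" where "g q = sprod c (\<theta> q *\<^sub>R n q + k 4 q *\<^sub>R e 1 q)"

definition R :: "real^4 \<Rightarrow> real" where "R q = inverse (g q)"

text \<open>The vector \<open>\<theta> n + k\<^sub>4 e\<^sub>1\<close> only changes its length along the hypersurface, so that \<open>A\<close> is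
  constant: it spans the axis of rotation. Its companion \<open>B\<close> rotates together with \<open>e\<^sub>4\<close>.\<close>

definition A :: "real^4 \<Rightarrow> real^5" where "A q = R q *\<^sub>R (\<theta> q *\<^sub>R n q + k 4 q *\<^sub>R e 1 q)"

definition B :: "real^4 \<Rightarrow> real^5" where "B q = R q *\<^sub>R V q"

lemma g_pos: "q \<in> U \<Longrightarrow> g q > 0"
  unfolding g_def by (rule c_pos)

lemma R_pos: "q \<in> U \<Longrightarrow> R q > 0"
  using g_pos by (simp add: R_def)

lemma R_g: "q \<in> U \<Longrightarrow> R q * g q = 1"
  using g_pos[of q] by (simp add: R_def)

lemma k1_eq: "q \<in> U \<Longrightarrow> k 1 q = - k 4 q / 3"
  using k4_eq by simp

lemma D_n: assumes "q \<in> U"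
  shows "(n has_derivative (\<lambda>h. (k 4 q / 3 * \<omega> 1 q h) *\<^sub>R e 1 q - (k 4 q * \<omega> 4 q h) *\<^sub>R e 4 q)) (at q)"
  by (rule has_derivative_eq_rhs[OF smooth_on_has_derivative[OF smooth_n assms]])
     (rule ext, simp add: Dn[OF assms] k1_eq[OF assms])

lemma D_e1: assumes "q \<in> U"
  shows "(e 1 has_derivative (\<lambda>h. (\<theta> q * \<omega> 4 q h) *\<^sub>R e 4 q - (\<epsilon> 1 * (k 4 q / 3) * \<omega> 1 q h) *\<^sub>R n q)) (at q)"
  by (rule has_derivative_eq_rhs[OF smooth_on_has_derivative[OF smooth_e assms]])
     (rule ext, simp add: De1[OF assms] k1_eq[OF assms])

lemma D_e4: assumes "q \<in> U"
  shows "(e 4 has_derivative (\<lambda>h. (\<epsilon> 4 * \<omega> 4 q h) *\<^sub>R (k 4 q *\<^sub>R n q - (\<epsilon> 1 * \<theta> q) *\<^sub>R e 1 q))) (at q)"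
  by (rule has_derivative_eq_rhs[OF smooth_on_has_derivative[OF smooth_e assms]])
     (rule ext, simp add: De4[OF assms] V_def)

lemma D_k4: assumes "q \<in> U"
  shows "(k 4 has_derivative (\<lambda>h. - (4 * (k 4 q / 3)) * \<theta> q * \<omega> 1 q h)) (at q)"
  by (rule has_derivative_eq_rhs[OF smooth_on_has_derivative[OF smooth_k assms]])
     (rule ext, simp add: Dk4[OF assms])

lemma D_\<theta>: assumes "q \<in> U"
  shows "(\<theta> has_derivative (\<lambda>h. (\<epsilon> 1 * k 4 q * (k 4 q / 3) - \<theta> q * \<theta> q) * \<omega> 1 q h)) (at q)"
  by (rule has_derivative_eq_rhs[OF smooth_on_has_derivative[OF smooth_\<theta> assms]])
     (rule ext, simp add: D\<theta>[OF assms] power2_eq_square)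

text \<open>The \<open>e 4\<close> terms of dn and de_1 cancel, and the equations for k_4 and
  \<theta> make the remainder a multiple of the vector itself.\<close>

lemma D_U:
  assumes q: "q \<in> U"
  shows "((\<lambda>q. \<theta> q *\<^sub>R n q + k 4 q *\<^sub>R e 1 q) has_derivative
    (\<lambda>h. (- \<theta> q * \<omega> 1 q h) *\<^sub>R (\<theta> q *\<^sub>R n q + k 4 q *\<^sub>R e 1 q))) (at q)"
proof (rule has_derivative_eq_rhs)
  show "((\<lambda>q. \<theta> q *\<^sub>R n q + k 4 q *\<^sub>R e 1 q) has_derivative (\<lambda>h.
      (\<theta> q *\<^sub>R ((k 4 q / 3 * \<omega> 1 q h) *\<^sub>R e 1 q - (k 4 q * \<omega> 4 q h) *\<^sub>R e 4 q)
       + ((\<epsilon> 1 * k 4 q * (k 4 q / 3) - \<theta> q * \<theta> q) * \<omega> 1 q h) *\<^sub>R n q)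
      + (k 4 q *\<^sub>R ((\<theta> q * \<omega> 4 q h) *\<^sub>R e 4 q - (\<epsilon> 1 * (k 4 q / 3) * \<omega> 1 q h) *\<^sub>R n q)
       + (- (4 * (k 4 q / 3)) * \<theta> q * \<omega> 1 q h) *\<^sub>R e 1 q))) (at q)"
    by (intro has_derivative_add has_derivative_scaleR D_n[OF q] D_e1[OF q] D_k4[OF q] D_\<theta>[OF q])
qed (rule ext, simp add: vec_eq_iff, simp add: field_simps)

text \<open>The factor - \<theta> \<omega>_1 is the one met for the axis vector, so multiplication
  by \<open>R\<close> removes it and leaves a multiple of \<open>e 4\<close>.\<close>

lemma D_V:
  assumes q: "q \<in> U"
  shows "(V has_derivative (\<lambda>h. (- \<theta> q * \<omega> 1 q h) *\<^sub>R V q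
    - (((k 4 q)\<^sup>2 + \<epsilon> 1 * (\<theta> q)\<^sup>2) * \<omega> 4 q h) *\<^sub>R e 4 q)) (at q)"
proof (rule has_derivative_eq_rhs)
  show "(V has_derivative (\<lambda>h.
      (k 4 q *\<^sub>R ((k 4 q / 3 * \<omega> 1 q h) *\<^sub>R e 1 q - (k 4 q * \<omega> 4 q h) *\<^sub>R e 4 q)
       + (- (4 * (k 4 q / 3)) * \<theta> q * \<omega> 1 q h) *\<^sub>R n q)
      - ((\<epsilon> 1 * \<theta> q) *\<^sub>R ((\<theta> q * \<omega> 4 q h) *\<^sub>R e 4 q - (\<epsilon> 1 * (k 4 q / 3) * \<omega> 1 q h) *\<^sub>R n q)
       + (\<epsilon> 1 * ((\<epsilon> 1 * k 4 q * (k 4 q / 3) - \<theta> q * \<theta> q) * \<omega> 1 q h) + 0 * \<theta> q) *\<^sub>R e 1 q))) (at q)"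
    unfolding V_def[abs_def]
    by (intro has_derivative_diff has_derivative_scaleR has_derivative_mult has_derivative_const
        D_n[OF q] D_e1[OF q] D_k4[OF q] D_\<theta>[OF q])
  have "\<epsilon> 1 * \<epsilon> 1 = 1" by (rule eps)
  then show "(\<lambda>h. (k 4 q *\<^sub>R ((k 4 q / 3 * \<omega> 1 q h) *\<^sub>R e 1 q - (k 4 q * \<omega> 4 q h) *\<^sub>R e 4 q)
       + (- (4 * (k 4 q / 3)) * \<theta> q * \<omega> 1 q h) *\<^sub>R n q)
      - ((\<epsilon> 1 * \<theta> q) *\<^sub>R ((\<theta> q * \<omega> 4 q h) *\<^sub>R e 4 q - (\<epsilon> 1 * (k 4 q / 3) * \<omega> 1 q h) *\<^sub>R n q)
       + (\<epsilon> 1 * ((\<epsilon> 1 * k 4 q * (k 4 q / 3) - \<theta> q * \<theta> q) * \<omega> 1 q h) + 0 * \<theta> q) *\<^sub>R e 1 q)) =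
    (\<lambda>h. (- \<theta> q * \<omega> 1 q h) *\<^sub>R V q - (((k 4 q)\<^sup>2 + \<epsilon> 1 * (\<theta> q)\<^sup>2) * \<omega> 4 q h) *\<^sub>R e 4 q)"
    unfolding V_def
    by (intro ext) (simp add: vec_eq_iff field_simps power2_eq_square, algebra)
qed

lemma D_g: assumes q: "q \<in> U" shows "(g has_derivative (\<lambda>h. - \<theta> q * \<omega> 1 q h * g q)) (at q)"
  unfolding g_def[abs_def]
  by (rule has_derivative_eq_rhs[OF bounded_linear.has_derivative[OF sprod.bounded_linear_right D_U[OF q]]])
     (simp add: sprod_simps)

lemma D_R: assumes q: "q \<in> U" shows "(R has_derivative (\<lambda>h. \<theta> q * \<omega> 1 q h * R q)) (at q)"
proof -
  have "g q \<noteq> 0" using g_pos[OF q] by simp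
  from Deriv.has_derivative_inverse[OF this D_g[OF q]] show ?thesis
    unfolding R_def[abs_def]
    by (rule has_derivative_eq_rhs) (use \<open>g q \<noteq> 0\<close> in \<open>simp add: fun_eq_iff\<close>)
qed

lemma A_const: "q \<in> U \<Longrightarrow> A q = A q0"
proof (rule zero_derivative_constant)
  fix q assume q: "q \<in> U"
  show "(A has_derivative (\<lambda>h. 0)) (at q)"
    unfolding A_def[abs_def]
    by (rule has_derivative_eq_rhs[OF has_derivative_scaleR[OF D_R[OF q] D_U[OF q]]])
       (rule ext, simp add: algebra_simps)
qed

definition \<kappa> :: "real^4 \<Rightarrow> real" where "\<kappa> q = (k 4 q)\<^sup>2 + \<epsilon> 1 * (\<theta> q)\<^sup>2"

text \<open>Equal to <B, B> at every point, so it fixes the causal types of both the axis and the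
  rotating vector.\<close>

definition \<tau> :: real where "\<tau> = \<epsilon> 1 * sprod (A q0) (A q0)"

lemma \<tau>_eq: assumes q: "q \<in> U" shows "\<tau> = \<kappa> q * (R q)\<^sup>2"
proof -
  have "sprod (A q) (A q) = (R q)\<^sup>2 * ((\<theta> q)\<^sup>2 + \<epsilon> 1 * (k 4 q)\<^sup>2)"
    by (simp add: A_def sprod_simps n_unit[OF q] n_e[OF q] e_n[OF q] e_orth[OF q] power2_eq_square algebra_simps)
  then show ?thesis
    unfolding \<tau>_def A_const[OF q, symmetric] \<kappa>_def using eps_cancel[of 1]
    by (simp add: algebra_simps)
qed

lemma D_B:
  assumes q: "q \<in> U"
  shows "(B has_derivative (\<lambda>h. - (\<tau> * g q * \<omega> 4 q h) *\<^sub>R e 4 q)) (at q)"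
proof -
  have "\<tau> * g q = \<kappa> q * R q * (R q * g q)" by (simp add: \<tau>_eq[OF q] power2_eq_square mult_ac)
  then have *: "\<tau> * g q = \<kappa> q * R q" by (simp add: R_g[OF q])
  show ?thesis
    unfolding B_def[abs_def] *
    by (rule has_derivative_eq_rhs[OF has_derivative_scaleR[OF D_R[OF q] D_V[OF q]]])
       (rule ext, simp add: \<kappa>_def algebra_simps)
qed

lemma V_B: "q \<in> U \<Longrightarrow> V q = g q *\<^sub>R B q"
  using R_g[of q] by (simp add: B_def mult.commute)

lemma D_e4_B:
  assumes q: "q \<in> U" shows "(e 4 has_derivative (\<lambda>h. (\<epsilon> 4 * g q * \<omega> 4 q h) *\<^sub>R B q)) (at q)"
  by (rule has_derivative_eq_rhs[OF D_e4[OF q]])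
     (rule ext, simp add: V_def[symmetric] V_B[OF q] mult_ac)

lemma sprod_e_B: assumes q: "q \<in> U" shows "sprod (e 1 q) (B q) = - (\<theta> q * R q)" "sprod (e 4 q) (B q) = 0"
    "sprod (B q) (B q) = \<tau>" "sprod (A q) (B q) = 0"
  using eps_cancel[of 1]
  by (simp_all add: B_def V_def A_def \<tau>_eq[OF q] \<kappa>_def sprod_simps e_orth[OF q] e_n[OF q] n_e[OF q] n_unit[OF q]
      power2_eq_square algebra_simps)

lemma sprod_e_A: assumes q: "q \<in> U" shows "sprod (e 1 q) (A q) = \<epsilon> 1 * k 4 q * R q" "sprod (e 4 q) (A q) = 0"
  by (simp_all add: A_def sprod_simps e_orth[OF q] e_n[OF q])

text \<open>For nonzero \<tau> this solves for \<open>e 1\<close>. For \<tau> = 0 it says that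
  \<open>A\<close> and \<open>B\<close> are linearly dependent, which is why the lightlike axis
  needs another basis.\<close>

lemma e1_A_B: assumes q: "q \<in> U" shows "\<tau> *\<^sub>R e 1 q = (k 4 q * R q) *\<^sub>R A q - (\<theta> q * R q) *\<^sub>R B q"
  unfolding \<tau>_eq[OF q] A_def B_def V_def \<kappa>_def
  by (simp add: vec_eq_iff power2_eq_square algebra_simps)

definition P :: "real^5 \<Rightarrow> real^4 \<Rightarrow> real^5" where
  "P w q = (\<epsilon> 1 * sprod w (e 1 q)) *\<^sub>R e 1 q + (\<epsilon> 4 * sprod w (e 4 q)) *\<^sub>R e 4 q + sprod w (n q) *\<^sub>R n q"

text \<open>The projection onto the span of \<open>e\<^sub>1\<close>, \<open>e\<^sub>4\<close> and the normal is constant: this splits off the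
  rulings of the cylinder.\<close>

lemma P_const: "q \<in> U \<Longrightarrow> P w q = P w q0"
proof (rule zero_derivative_constant)
  fix q assume q: "q \<in> U"
  have L: "((\<lambda>q. sprod w (F q)) has_derivative (\<lambda>h. sprod w (F' h))) (at q)" if "(F has_derivative F') (at q)" for F F'
    by (rule bounded_linear.has_derivative[OF sprod.bounded_linear_right that])
  note s = has_derivative_scaleR[OF has_derivative_mult[OF has_derivative_const L]]
  have D: "(P w has_derivative (\<lambda>h.
      ((\<epsilon> 1 * sprod w (e 1 q)) *\<^sub>R ((\<theta> q * \<omega> 4 q h) *\<^sub>R e 4 q - (\<epsilon> 1 * (k 4 q / 3) * \<omega> 1 q h) *\<^sub>R n q) +
       (\<epsilon> 1 * sprod w ((\<theta> q * \<omega> 4 q h) *\<^sub>R e 4 q - (\<epsilon> 1 * (k 4 q / 3) * \<omega> 1 q h) *\<^sub>R n q) +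
         0 * sprod w (e 1 q)) *\<^sub>R e 1 q) +
      ((\<epsilon> 4 * sprod w (e 4 q)) *\<^sub>R ((\<epsilon> 4 * \<omega> 4 q h) *\<^sub>R (k 4 q *\<^sub>R n q - (\<epsilon> 1 * \<theta> q) *\<^sub>R e 1 q)) +
       (\<epsilon> 4 * sprod w ((\<epsilon> 4 * \<omega> 4 q h) *\<^sub>R (k 4 q *\<^sub>R n q - (\<epsilon> 1 * \<theta> q) *\<^sub>R e 1 q)) +
         0 * sprod w (e 4 q)) *\<^sub>R e 4 q) +
      (sprod w (n q) *\<^sub>R ((k 4 q / 3 * \<omega> 1 q h) *\<^sub>R e 1 q - (k 4 q * \<omega> 4 q h) *\<^sub>R e 4 q) +
       sprod w ((k 4 q / 3 * \<omega> 1 q h) *\<^sub>R e 1 q - (k 4 q * \<omega> 4 q h) *\<^sub>R e 4 q) *\<^sub>R n q))) (at q)"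
    unfolding P_def[abs_def]
    by (intro has_derivative_add s D_e1[OF q] D_e4[OF q] has_derivative_scaleR[OF L] D_n[OF q])
  have "\<epsilon> 1 * \<epsilon> 1 = 1" "\<epsilon> 4 * \<epsilon> 4 = 1" by (rule eps)+
  then show "(P w has_derivative (\<lambda>h. 0)) (at q)"
    by (intro has_derivative_eq_rhs[OF D] ext)
       (simp add: vec_eq_iff sprod_simps, intro allI, algebra)
qed

section \<open>Ruling coordinates and the splitting of dy\<close>

definition T :: "4 \<Rightarrow> real^4 \<Rightarrow> real" where "T a q = \<epsilon> a * sprod (y q) (e a q0)"

lemma D_y: "q \<in> U \<Longrightarrow> (y has_derivative Fd y q) (at q)"
  by (rule smooth_on_has_derivative[OF smooth_y])

lemma D_sprod_y: "q \<in> U \<Longrightarrow> ((\<lambda>q. sprod (y q) w) has_derivative (\<lambda>h. sprod (Fd y q h) w)) (at q)"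
  by (rule bounded_linear.has_derivative[OF sprod.bounded_linear_left D_y])

lemma D_T: "q \<in> U \<Longrightarrow> (T a has_derivative (\<lambda>h. \<epsilon> a * sprod (Fd y q h) (e a q0))) (at q)"
  unfolding T_def[abs_def] by (rule has_derivative_mult_right[OF D_sprod_y])

text \<open>Only the plane of \<open>e 2\<close> and \<open>e 3\<close> is shown to be constant; the
  two vectors may turn inside it. Hence they are taken at \<open>q0\<close>, while
  \<open>e 1\<close> and \<open>e 4\<close> stay at \<open>q\<close>.\<close>

lemma Dy_split:
  assumes q: "q \<in> U"
  shows "Fd y q h = (\<epsilon> 2 * sprod (Fd y q h) (e 2 q0)) *\<^sub>R e 2 q0 + (\<epsilon> 3 * sprod (Fd y q h) (e 3 q0)) *\<^sub>R e 3 q0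
    + (\<omega> 1 q h *\<^sub>R e 1 q + \<omega> 4 q h *\<^sub>R e 4 q)"
proof -
  let ?w = "Fd y q h"
  have "P ?w q = \<omega> 1 q h *\<^sub>R e 1 q + \<omega> 4 q h *\<^sub>R e 4 q"
    using n_orth[OF q, of h] by (simp add: P_def \<omega>_def sprod_commute[of ?w "n q"])
  moreover have "?w = (\<epsilon> 2 * sprod ?w (e 2 q0)) *\<^sub>R e 2 q0 + (\<epsilon> 3 * sprod ?w (e 3 q0)) *\<^sub>R e 3 q0 + P ?w q0"
    using frame_expansion[OF q0, of ?w] by (simp add: P_def sum_4 ac_simps)
  ultimately show ?thesis using P_const[OF q, of ?w] by simp
qed

lemma smooth_g: "smooth_on g U"
  unfolding g_def[abs_def]
  by (intro smooth_sprod_const smooth_on_add smooth_on_scaleR open_U smooth_\<theta> smooth_n smooth_k smooth_e)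

lemma smooth_R: "smooth_on R U"
  unfolding R_def[abs_def] by (rule smooth_on_inverse[OF open_U smooth_g]) (use g_pos in force)

lemma smooth_sprod_y: "smooth_on (\<lambda>q. sprod (y q) w) U"
  by (rule smooth_on_sprod[OF open_U smooth_y smooth_on_const[OF open_U]])

lemma smooth_T: "smooth_on (T a) U"
  unfolding T_def[abs_def] by (rule smooth_on_mult[OF open_U smooth_on_const[OF open_U] smooth_sprod_y])

section \<open>Closed one-forms: arc length, angle and height\<close>

lemma D_\<omega>:
  assumes q: "q \<in> U"
  shows "Fd (\<lambda>q. \<omega> i q h) q h' - Fd (\<lambda>q. \<omega> i q h') q h =
    \<epsilon> i * (sprod (Fd (e i) q h') (Fd y q h) - sprod (Fd (e i) q h) (Fd y q h'))"
proof -
  have "Fd (\<lambda>q. \<omega> i q h) q h' = \<epsilon> i * Fd (\<lambda>q. sprod (e i q) (Fd y q h)) q h'" for h h'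
    unfolding \<omega>_def sprod_commute[of "Fd y _ _" "e i _"]
    using Fd_mult[OF smooth_on_const[OF open_U] smooth_on_sprod[OF open_U smooth_e smooth_Dy] q]
    by (simp add: Fd_const)
  then show ?thesis unfolding exterior_derivative[OF q smooth_e, symmetric] by (simp add: right_diff_distrib)
qed

text \<open>\<omega>_1 is closed, because de_1 contributes only a multiple of the symmetric product
  of \<omega>_4 with itself.\<close>

lemma arclength_exists: "\<exists>s. s q0 = 0 \<and> (\<forall>q\<in>U. (s has_derivative \<omega> 1 q) (at q))"
  unfolding U_ball
proof (rule poincare_1form; unfold U_ball[symmetric])
  fix q h h' assume q: "q \<in> U"
  show "linear (\<omega> 1 q)" by (rule linear_\<omega>[OF q])
  have "sprod (Fd (e 1) q h) (Fd y q h') = \<theta> q * \<epsilon> 4 * \<omega> 4 q h * \<omega> 4 q h'" for h h'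
    unfolding De1[OF q]
    by (simp add: sprod_simps n_orth[OF q] sprod_commute[of "e 4 q" "Fd y q h'"] sprod_Dy_e mult_ac)
  then show "Fd (\<lambda>q. \<omega> 1 q h) q h' = Fd (\<lambda>q. \<omega> 1 q h') q h"
    using D_\<omega>[OF q, of 1 h h'] by (simp add: mult_ac)
qed (rule smooth_\<omega>)

text \<open>d\<omega>_4 is \<theta> times the wedge product of \<omega>_1 and \<omega>_4, which dg =
  - \<theta> g \<omega>_1 cancels.\<close>

lemma angle_exists: "\<exists>v. v q0 = 0 \<and> (\<forall>q\<in>U. (v has_derivative (\<lambda>h. g q * \<omega> 4 q h)) (at q))"
  unfolding U_ball
proof (rule poincare_1form; unfold U_ball[symmetric])
  fix q h h' assume q: "q \<in> U"
  show "linear (\<lambda>h. g q * \<omega> 4 q h)"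
    using linear_\<omega>[OF q, of 4] by (simp add: linear_iff algebra_simps)
  have "sprod (Fd (e 4) q h) (Fd y q h') = - (\<epsilon> 4 * \<theta> q * \<omega> 4 q h * \<omega> 1 q h')" for h h'
    unfolding De4[OF q] V_def
    by (simp add: sprod_simps n_orth[OF q] sprod_commute[of "e 1 q" "Fd y q h'"] sprod_Dy_e mult_ac eps_cancel)
  then have *: "Fd (\<lambda>q. \<omega> 4 q h) q h' - Fd (\<lambda>q. \<omega> 4 q h') q h =
      \<theta> q * (\<omega> 4 q h * \<omega> 1 q h' - \<omega> 4 q h' * \<omega> 1 q h)"
    unfolding D_\<omega>[OF q] by (simp add: algebra_simps eps_cancel)
  have "Fd (\<lambda>q. g q * \<omega> 4 q h) q h' = g q * Fd (\<lambda>q. \<omega> 4 q h) q h' - \<theta> q * \<omega> 1 q h' * g q * \<omega> 4 q h" for h h'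
    unfolding Fd_mult[OF smooth_g smooth_\<omega> q] Fd_eqI[OF D_g[OF q]] by simp
  then have "Fd (\<lambda>q. g q * \<omega> 4 q h) q h' - Fd (\<lambda>q. g q * \<omega> 4 q h') q h =
      g q * (Fd (\<lambda>q. \<omega> 4 q h) q h' - Fd (\<lambda>q. \<omega> 4 q h') q h) -
      g q * (\<theta> q * (\<omega> 4 q h * \<omega> 1 q h' - \<omega> 4 q h' * \<omega> 1 q h))"
    by (simp add: algebra_simps)
  then show "Fd (\<lambda>q. g q * \<omega> 4 q h) q h' = Fd (\<lambda>q. g q * \<omega> 4 q h') q h"
    unfolding * by simp
qed (intro smooth_on_mult open_U smooth_g smooth_\<omega>)

definition v :: "real^4 \<Rightarrow> real" where
  "v = (SOME v. v q0 = 0 \<and> (\<forall>q\<in>U. (v has_derivative (\<lambda>h. g q * \<omega> 4 q h)) (at q)))"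

lemma v_q0: "v q0 = 0" and D_v: "q \<in> U \<Longrightarrow> (v has_derivative (\<lambda>h. g q * \<omega> 4 q h)) (at q)"
  using someI_ex[OF angle_exists] unfolding v_def[symmetric] by auto

lemma smooth_v: "smooth_on v U"
  by (rule smooth_onI[OF open_U D_v smooth_on_mult[OF open_U smooth_g smooth_\<omega>]])

definition s :: "real^4 \<Rightarrow> real" where
  "s = (SOME s. s q0 = 0 \<and> (\<forall>q\<in>U. (s has_derivative \<omega> 1 q) (at q)))"

lemma D_s: "q \<in> U \<Longrightarrow> (s has_derivative \<omega> 1 q) (at q)"
  using someI_ex[OF arclength_exists] unfolding s_def[symmetric] by auto

lemma smooth_s: "smooth_on s U"
  by (rule smooth_onI[OF open_U D_s smooth_\<omega>])

text \<open>Height along a nonnull axis: for \<tau> = 1 or -1 the factor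
  \<open>\<epsilon> 1 * \<tau>\<close> is the inverse of <A, A>.\<close>

definition a :: "real^4 \<Rightarrow> real" where "a q = \<epsilon> 1 * \<tau> * sprod (y q) (A q0)"

lemma sprod_Dy_A:
  assumes q: "q \<in> U" shows "sprod (Fd y q h) (A q0) = \<epsilon> 1 * k 4 q * R q * \<omega> 1 q h"
  unfolding A_const[OF q, symmetric] unfolding A_def
  by (simp add: sprod_simps sprod_commute[of "Fd y q h" "n q"] n_orth[OF q] sprod_Dy_e)

lemma D_a: assumes q: "q \<in> U" shows "(a has_derivative (\<lambda>h. \<tau> * k 4 q * R q * \<omega> 1 q h)) (at q)"
  unfolding a_def[abs_def]
  by (rule has_derivative_eq_rhs[OF has_derivative_mult_right[OF D_sprod_y[OF q]]])
     (rule ext, simp add: sprod_Dy_A[OF q] mult_ac eps_cancel)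

lemma smooth_a: "smooth_on a U"
  unfolding a_def[abs_def] by (rule smooth_on_mult[OF open_U smooth_on_const[OF open_U] smooth_sprod_y])

text \<open>The right-hand side integrates \<open>Dy_split\<close>: \<open>e1_A_B\<close> splits
  \<open>e 1\<close> into an axial and a radial part, and the differential of R B supplies the
  radial part together with the \<open>e 4\<close> term.\<close>

lemma position_nonnull:
  assumes \<tau>: "\<tau> * \<tau> = 1"
  shows "\<exists>C. \<forall>q\<in>U. y q = C + (T 2 q *\<^sub>R e 2 q0 + T 3 q *\<^sub>R e 3 q0 + a q *\<^sub>R A q0 - (\<tau> * R q) *\<^sub>R B q)"
proof -
  define W where "W = (\<lambda>q. y q - (T 2 q *\<^sub>R e 2 q0 + T 3 q *\<^sub>R e 3 q0 + a q *\<^sub>R A q0 - (\<tau> * R q) *\<^sub>R B q))"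
  have "(W has_derivative (\<lambda>h. 0)) (at q)" if q: "q \<in> U" for q
  proof -
    have D: "(W has_derivative (\<lambda>h. Fd y q h - ((\<epsilon> 2 * sprod (Fd y q h) (e 2 q0)) *\<^sub>R e 2 q0
        + (\<epsilon> 3 * sprod (Fd y q h) (e 3 q0)) *\<^sub>R e 3 q0 + (\<tau> * k 4 q * R q * \<omega> 1 q h) *\<^sub>R A q0
        - ((\<tau> * R q) *\<^sub>R (- (\<tau> * g q * \<omega> 4 q h) *\<^sub>R e 4 q) + (\<tau> * (\<theta> q * \<omega> 1 q h * R q)) *\<^sub>R B q)))) (at q)"
      unfolding W_def
      by (intro has_derivative_diff has_derivative_add has_derivative_scaleR_left D_y[OF q] D_T[OF q] D_a[OF q]
          has_derivative_scaleR[OF has_derivative_mult_right[OF D_R[OF q]] D_B[OF q]])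
    have e1: "(\<tau> *\<^sub>R e 1 q) $ i = ((k 4 q * R q) *\<^sub>R A q0 - (\<theta> q * R q) *\<^sub>R B q) $ i" for i
      using e1_A_B[OF q] A_const[OF q] by simp
    show ?thesis
    proof (rule has_derivative_eq_rhs[OF D], rule ext)
      fix h
      have w: "Fd y q h $ i = ((\<epsilon> 2 * sprod (Fd y q h) (e 2 q0)) *\<^sub>R e 2 q0 +
        (\<epsilon> 3 * sprod (Fd y q h) (e 3 q0)) *\<^sub>R e 3 q0 + (\<omega> 1 q h *\<^sub>R e 1 q + \<omega> 4 q h *\<^sub>R e 4 q)) $ i" for i
        by (rule arg_cong[OF Dy_split[OF q]])
      show "Fd y q h - ((\<epsilon> 2 * sprod (Fd y q h) (e 2 q0)) *\<^sub>R e 2 q0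
        + (\<epsilon> 3 * sprod (Fd y q h) (e 3 q0)) *\<^sub>R e 3 q0 + (\<tau> * k 4 q * R q * \<omega> 1 q h) *\<^sub>R A q0
        - ((\<tau> * R q) *\<^sub>R (- (\<tau> * g q * \<omega> 4 q h) *\<^sub>R e 4 q) + (\<tau> * (\<theta> q * \<omega> 1 q h * R q)) *\<^sub>R B q)) = 0"
        unfolding vec_eq_iff
      proof
        fix i
        show "(Fd y q h - ((\<epsilon> 2 * sprod (Fd y q h) (e 2 q0)) *\<^sub>R e 2 q0
          + (\<epsilon> 3 * sprod (Fd y q h) (e 3 q0)) *\<^sub>R e 3 q0 + (\<tau> * k 4 q * R q * \<omega> 1 q h) *\<^sub>R A q0
          - ((\<tau> * R q) *\<^sub>R (- (\<tau> * g q * \<omega> 4 q h) *\<^sub>R e 4 q) + (\<tau> * (\<theta> q * \<omega> 1 q h * R q)) *\<^sub>R B q))) $ i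
          = 0 $ i"
          using w[of i] e1[of i] R_g[OF q] \<tau>
          unfolding vector_minus_component vector_add_component vector_scaleR_component vector_uminus_component
            zero_index real_scaleR_def
          by algebra
      qed
    qed
  qed
  then have "W q = W q0" if "q \<in> U" for q by (rule zero_derivative_constant[OF _ that])
  then show ?thesis by (intro exI[of _ "W q0"] ballI) (simp add: W_def algebra_simps)
qed

lemma D_compose_v:
  assumes "q \<in> U" "DERIV F (v q) :> F'"
  shows "((\<lambda>q. F (v q)) has_derivative (\<lambda>h. g q * \<omega> 4 q h * F')) (at q)"
  by (rule DERIV_compose_FDERIV[OF assms(2) D_v[OF assms(1)]])

text \<open>\<open>cs\<close> and \<open>sn\<close> are cos and sin or cosh and sinh, according to
  the sign of \<open>\<tau> * \<epsilon> 4\<close>. Turning the pair formed by \<open>B\<close> and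
  \<open>e 4\<close> back by the angle \<open>v\<close> gives constants, and the quadratic identity
  inverts the turn.\<close>

lemma rotation:
  fixes cs sn :: "real \<Rightarrow> real"
  assumes D: "\<And>z. DERIV cs z :> - (\<tau> * \<epsilon> 4) * sn z" "\<And>z. DERIV sn z :> cs z"
    and 0: "cs 0 = 1" "sn 0 = 0" and unit: "\<And>z. cs z * cs z + \<tau> * \<epsilon> 4 * (sn z * sn z) = 1"
    and q: "q \<in> U"
  shows "B q = cs (v q) *\<^sub>R B q0 - (\<tau> * sn (v q)) *\<^sub>R e 4 q0"
proof -
  let ?X = "\<lambda>q. cs (v q) *\<^sub>R B q + (\<tau> * sn (v q)) *\<^sub>R e 4 q"
  let ?Y = "\<lambda>q. cs (v q) *\<^sub>R e 4 q - (\<epsilon> 4 * sn (v q)) *\<^sub>R B q"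
  have e4: "\<epsilon> 4 * \<epsilon> 4 = 1" by (rule eps)
  have "?X q = ?X q0"
  proof (rule zero_derivative_constant[OF _ q])
    fix q assume q: "q \<in> U"
    have "(?X has_derivative (\<lambda>h. cs (v q) *\<^sub>R (- (\<tau> * g q * \<omega> 4 q h) *\<^sub>R e 4 q)
        + (g q * \<omega> 4 q h * (- (\<tau> * \<epsilon> 4) * sn (v q))) *\<^sub>R B q
        + ((\<tau> * sn (v q)) *\<^sub>R ((\<epsilon> 4 * g q * \<omega> 4 q h) *\<^sub>R B q)
        + (\<tau> * (g q * \<omega> 4 q h * cs (v q))) *\<^sub>R e 4 q))) (at q)"
      by (intro has_derivative_add has_derivative_scaleR has_derivative_mult_right
          D_compose_v[OF q D(1)] D_compose_v[OF q D(2)] D_B[OF q] D_e4_B[OF q])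
    then show "(?X has_derivative (\<lambda>h. 0)) (at q)"
      by (rule has_derivative_eq_rhs) (rule ext, simp add: algebra_simps)
  qed
  then have X: "cs (v q) *\<^sub>R B q + (\<tau> * sn (v q)) *\<^sub>R e 4 q = B q0" by (simp add: v_q0 0)
  have "?Y q = ?Y q0"
  proof (rule zero_derivative_constant[OF _ q])
    fix q assume q: "q \<in> U"
    have "(?Y has_derivative (\<lambda>h. cs (v q) *\<^sub>R ((\<epsilon> 4 * g q * \<omega> 4 q h) *\<^sub>R B q)
          + (g q * \<omega> 4 q h * (- (\<tau> * \<epsilon> 4) * sn (v q))) *\<^sub>R e 4 q
          - ((\<epsilon> 4 * sn (v q)) *\<^sub>R (- (\<tau> * g q * \<omega> 4 q h) *\<^sub>R e 4 q)
          + (\<epsilon> 4 * (g q * \<omega> 4 q h * cs (v q))) *\<^sub>R B q))) (at q)"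
      by (intro has_derivative_diff has_derivative_scaleR has_derivative_mult_right
          D_compose_v[OF q D(1)] D_compose_v[OF q D(2)] D_B[OF q] D_e4_B[OF q])
    then show "(?Y has_derivative (\<lambda>h. 0)) (at q)"
      by (rule has_derivative_eq_rhs) (rule ext, simp add: algebra_simps)
  qed
  then have Y: "cs (v q) *\<^sub>R e 4 q - (\<epsilon> 4 * sn (v q)) *\<^sub>R B q = e 4 q0" by (simp add: v_q0 0)
  have "cs (v q) *\<^sub>R B q0 - (\<tau> * sn (v q)) *\<^sub>R e 4 q0 =
      (cs (v q) * cs (v q) + \<tau> * \<epsilon> 4 * (sn (v q) * sn (v q))) *\<^sub>R B q"
    unfolding X[symmetric] Y[symmetric] by (simp add: algebra_simps)
  then show ?thesis by (simp add: unit)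
qed

text \<open>If the constant vector \<open>A\<close> is lightlike, it is proportional to \<open>B\<close>; the lightlike vector \<open>d\<close>,
  dual to \<open>B\<close>, completes it to a basis of the plane orthogonal to the rulings and to \<open>e\<^sub>4\<close>.\<close>

definition d :: "real^5" where
  "d = (1 / (2 * R q0 * (k 4 q0)\<^sup>2)) *\<^sub>R (k 4 q0 *\<^sub>R n q0 - \<theta> q0 *\<^sub>R e 1 q0)"

text \<open>The component of the position along \<open>B q0\<close> without the part quadratic in
  \<open>v\<close> that the parabolic rotation creates. For \<tau> = 0 the differential of what is
  left is a multiple of dR.\<close>

definition \<Psi> :: "real^4 \<Rightarrow> real" where "\<Psi> q = sprod (y q) d - \<epsilon> 4 / 2 * (R q * (v q)\<^sup>2)"

lemma smooth_\<Psi>: "smooth_on \<Psi> U"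
  unfolding \<Psi>_def[abs_def] power2_eq_square
  by (intro smooth_on_diff smooth_on_mult smooth_on_const open_U smooth_sprod_y smooth_R smooth_v)

section \<open>Lightlike axis\<close>

context
  assumes null: "\<tau> = 0"
begin

text \<open>\<tau> = 0 means k_4^2 + \<epsilon>_1 \<theta>^2 = 0 with k_4 nonzero, which forces
  \<open>e 1\<close> to be timelike.\<close>

lemma null_facts: assumes q: "q \<in> U" shows "\<epsilon> 1 = -1" "\<theta> q \<noteq> 0" "\<theta> q * \<theta> q = k 4 q * k 4 q"
proof -
  have \<kappa>: "k 4 q * k 4 q + \<epsilon> 1 * (\<theta> q * \<theta> q) = 0"
    using \<tau>_eq[OF q] R_pos[OF q] null by (simp add: \<kappa>_def power2_eq_square)
  have k: "k 4 q * k 4 q > 0" using k4[OF q] not_square_less_zero[of "k 4 q"] by (simp add: less_le)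
  have "\<epsilon> 1 = 1 \<or> \<epsilon> 1 = -1" using eps[of 1] by (simp add: square_eq_1_iff)
  moreover have "\<theta> q * \<theta> q \<ge> 0" by simp
  ultimately show e: "\<epsilon> 1 = -1" using \<kappa> k by auto
  then show "\<theta> q * \<theta> q = k 4 q * k 4 q" "\<theta> q \<noteq> 0" using \<kappa> k by auto
qed

lemma B_const: "q \<in> U \<Longrightarrow> B q = B q0"
  by (rule zero_derivative_constant, rule has_derivative_eq_rhs[OF D_B]) (simp_all add: null fun_eq_iff)

lemma d_products: "sprod d d = 0" "sprod (B q0) d = 1" "sprod (B q0) (B q0) = 0" "sprod (e 4 q0) d = 0"
    "sprod (e 4 q0) (B q0) = 0"
proof -
  note f = null_facts[OF q0]
  have nz: "k 4 q0 \<noteq> 0" "R q0 \<noteq> 0" using k4[OF q0] R_pos[OF q0] by auto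
  show "sprod d d = 0"
    using f by (simp add: d_def sprod_simps e_orth[OF q0] n_e[OF q0] e_n[OF q0] n_unit[OF q0])
  show "sprod (B q0) d = 1"
    using f nz by (simp add: d_def B_def V_def sprod_simps e_orth[OF q0] n_e[OF q0] e_n[OF q0] n_unit[OF q0]
        power2_eq_square field_simps)
  show "sprod (B q0) (B q0) = 0" using sprod_e_B(3)[OF q0] null by simp
  show "sprod (e 4 q0) d = 0" by (simp add: d_def sprod_simps e_orth[OF q0] e_n[OF q0])
  show "sprod (e 4 q0) (B q0) = 0" by (rule sprod_e_B(2)[OF q0])
qed

text \<open>In a lightlike pair with product 1 each coefficient is the product with the other
  vector. The hypothesis on \<open>w\<close> places it in the constant span of \<open>e 1\<close>,
  \<open>e 4\<close> and \<open>n\<close>.\<close>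

lemma null_expansion:
  assumes q: "q \<in> U" and w: "P w q = w"
  shows "w = (\<epsilon> 4 * sprod w (e 4 q0)) *\<^sub>R e 4 q0 + sprod w d *\<^sub>R B q0 + sprod w (B q0) *\<^sub>R d"
proof -
  note f = null_facts[OF q0]
  have nz: "k 4 q0 \<noteq> 0" "R q0 \<noteq> 0" using k4[OF q0] R_pos[OF q0] by auto
  define m where "m = 1 / (2 * R q0 * (k 4 q0)\<^sup>2)"
  have m: "m * (2 * R q0 * (k 4 q0)\<^sup>2) = 1" using nz by (simp add: m_def)
  have "P w q0 = (\<epsilon> 4 * sprod w (e 4 q0)) *\<^sub>R e 4 q0 + sprod w d *\<^sub>R B q0 + sprod w (B q0) *\<^sub>R d"
    unfolding P_def B_def V_def d_def m_def[symmetric] sprod_simps f(1) vec_eq_iff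
      vector_minus_component vector_add_component vector_scaleR_component vector_uminus_component real_scaleR_def
    using m f(3) by (intro allI) (simp add: power2_eq_square, algebra)
  then show ?thesis using P_const[OF q, of w] w by simp
qed

lemma D_v2: assumes q: "q \<in> U"
  shows "((\<lambda>q. (v q)\<^sup>2) has_derivative (\<lambda>h. 2 * v q * (g q * \<omega> 4 q h))) (at q)"
  by (rule has_derivative_eq_rhs[OF has_derivative_power[OF D_v[OF q], of 2]]) (simp add: mult_ac)

text \<open>\<open>B\<close> is constant, so de_4 = \<epsilon>_4 B dv integrates to a linear
  function of \<open>v\<close>: a parabolic rotation.\<close>

lemma e4_null: "q \<in> U \<Longrightarrow> e 4 q = e 4 q0 + (\<epsilon> 4 * v q) *\<^sub>R B q0"
proof -
  let ?X = "\<lambda>q. e 4 q - (\<epsilon> 4 * v q) *\<^sub>R B q0"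
  assume "q \<in> U"
  have "?X q = ?X q0"
  proof (rule zero_derivative_constant[OF _ \<open>q \<in> U\<close>])
    fix q assume q: "q \<in> U"
    have "(?X has_derivative (\<lambda>h. (\<epsilon> 4 * g q * \<omega> 4 q h) *\<^sub>R B q - (\<epsilon> 4 * (g q * \<omega> 4 q h)) *\<^sub>R B q0)) (at q)"
      by (intro has_derivative_diff has_derivative_scaleR_left has_derivative_mult_right D_v[OF q] D_e4_B[OF q])
    then show "(?X has_derivative (\<lambda>h. 0)) (at q)"
      by (rule has_derivative_eq_rhs) (rule ext, simp add: B_const[OF q] mult_ac)
  qed
  then show ?thesis by (simp add: v_q0 algebra_simps)
qed

text \<open>Orthogonality to \<open>e 4\<close> determines the \<open>e 4 q0\<close> component and
  \<open>sprod_e_B\<close> the \<open>d\<close> component; <e_1, e_1> = -1 then yields the component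
  along \<open>B q0\<close>.\<close>

lemma e1_null:
  assumes q: "q \<in> U"
  shows "e 1 q = (v q * \<theta> q * R q) *\<^sub>R e 4 q0 + sprod (e 1 q) d *\<^sub>R B q0 - (\<theta> q * R q) *\<^sub>R d"
    and "2 * (\<theta> q * R q) * sprod (e 1 q) d = 1 + \<epsilon> 4 * (v q * \<theta> q * R q)\<^sup>2"
proof -
  have B: "sprod (e 1 q) (B q0) = - (\<theta> q * R q)" using sprod_e_B(1)[OF q] B_const[OF q] by simp
  have "sprod (e 1 q) (e 4 q0 + (\<epsilon> 4 * v q) *\<^sub>R B q0) = 0"
    unfolding e4_null[OF q, symmetric] by (simp add: e_orth[OF q])
  then have e4: "sprod (e 1 q) (e 4 q0) = \<epsilon> 4 * (v q * \<theta> q * R q)" by (simp add: sprod_simps B mult_ac)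
  have "P (e 1 q) q = e 1 q" by (simp add: P_def e_orth[OF q] e_n[OF q] eps)
  from null_expansion[OF q this]
  show *: "e 1 q = (v q * \<theta> q * R q) *\<^sub>R e 4 q0 + sprod (e 1 q) d *\<^sub>R B q0 - (\<theta> q * R q) *\<^sub>R d"
    by (simp add: B e4 eps_cancel)
  have "sprod (e 1 q) (e 1 q) = (v q * \<theta> q * R q) * sprod (e 1 q) (e 4 q0) +
      sprod (e 1 q) d * sprod (e 1 q) (B q0) - (\<theta> q * R q) * sprod (e 1 q) d"
    using arg_cong[OF *, of "sprod (e 1 q)"] unfolding sprod_simps real_scaleR_def .
  then show "2 * (\<theta> q * R q) * sprod (e 1 q) d = 1 + \<epsilon> 4 * (v q * \<theta> q * R q)\<^sup>2"
    by (simp add: e_orth[OF q] null_facts[OF q] B e4 power2_eq_square algebra_simps)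
qed

lemma sprod_Dy_d:
  assumes q: "q \<in> U"
  shows "sprod (Fd y q h) d = \<omega> 1 q h * sprod (e 1 q) d + \<omega> 4 q h * (\<epsilon> 4 * v q)"
proof -
  have o: "sprod (e 2 q0) d = 0" "sprod (e 3 q0) d = 0" by (simp_all add: d_def sprod_simps e_orth[OF q0] e_n[OF q0])
  have "sprod (e 4 q) d = \<epsilon> 4 * v q" unfolding e4_null[OF q] by (simp add: sprod_simps d_products)
  then show ?thesis
    using arg_cong[OF Dy_split[OF q, of h], of "\<lambda>w. sprod w d"] by (simp add: sprod_simps o)
qed

text \<open>In other words d\<Psi> = dR / (2 (\<theta> R)^2): the formula for <e_1, d> cancels all
  terms in \<open>v\<close>. Positivity of this coefficient is the origin of the sign conditions on
  1 + 2 \<psi>'.\<close>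

lemma D_\<Psi>:
  assumes q: "q \<in> U"
  shows "(\<Psi> has_derivative (\<lambda>h. 1 / (2 * (\<theta> q * R q)\<^sup>2) * (\<theta> q * \<omega> 1 q h * R q))) (at q)"
proof -
  have nz: "\<theta> q * R q \<noteq> 0" using null_facts(2)[OF q] R_pos[OF q] by simp
  define m where "m = 1 / (2 * (\<theta> q * R q)\<^sup>2)"
  have m: "m * (2 * (\<theta> q * R q)\<^sup>2) = 1" using nz by (simp add: m_def)
  have D: "(\<Psi> has_derivative (\<lambda>h. sprod (Fd y q h) d - \<epsilon> 4 / 2 *
      (R q * (2 * v q * (g q * \<omega> 4 q h)) + \<theta> q * \<omega> 1 q h * R q * (v q)\<^sup>2))) (at q)"
    unfolding \<Psi>_def[abs_def]
    by (intro has_derivative_diff has_derivative_mult_right D_sprod_y[OF q]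
        has_derivative_mult[OF D_R[OF q] D_v2[OF q]])
  show ?thesis unfolding m_def[symmetric]
  proof (rule has_derivative_eq_rhs[OF D], rule ext)
    fix h
    have "(\<theta> q * R q) * (2 * (sprod (Fd y q h) d - \<epsilon> 4 / 2 *
      (R q * (2 * v q * (g q * \<omega> 4 q h)) + \<theta> q * \<omega> 1 q h * R q * (v q)\<^sup>2))) =
      (\<theta> q * R q) * (2 * (m * (\<theta> q * \<omega> 1 q h * R q)))"
      unfolding sprod_Dy_d[OF q]
      using e1_null(2)[OF q] R_g[OF q] m by (simp add: power2_eq_square field_simps, algebra)
    then show "sprod (Fd y q h) d - \<epsilon> 4 / 2 *
      (R q * (2 * v q * (g q * \<omega> 4 q h)) + \<theta> q * \<omega> 1 q h * R q * (v q)\<^sup>2) = m * (\<theta> q * \<omega> 1 q h * R q)"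
      using nz by simp
  qed
qed

lemma position_null:
  "\<exists>C. \<forall>q\<in>U. y q = C + (T 2 q *\<^sub>R e 2 q0 + T 3 q *\<^sub>R e 3 q0 + (R q * v q) *\<^sub>R e 4 q0
    + sprod (y q) d *\<^sub>R B q0 - R q *\<^sub>R d)"
proof -
  define W where "W = (\<lambda>q. y q - (T 2 q *\<^sub>R e 2 q0 + T 3 q *\<^sub>R e 3 q0 + (R q * v q) *\<^sub>R e 4 q0
    + sprod (y q) d *\<^sub>R B q0 - R q *\<^sub>R d))"
  have "(W has_derivative (\<lambda>h. 0)) (at q)" if q: "q \<in> U" for q
  proof -
    have D: "(W has_derivative (\<lambda>h. Fd y q h - ((\<epsilon> 2 * sprod (Fd y q h) (e 2 q0)) *\<^sub>R e 2 q0
        + (\<epsilon> 3 * sprod (Fd y q h) (e 3 q0)) *\<^sub>R e 3 q0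
        + (R q * (g q * \<omega> 4 q h) + \<theta> q * \<omega> 1 q h * R q * v q) *\<^sub>R e 4 q0
        + sprod (Fd y q h) d *\<^sub>R B q0 - (\<theta> q * \<omega> 1 q h * R q) *\<^sub>R d))) (at q)"
      unfolding W_def
      by (intro has_derivative_diff has_derivative_add has_derivative_scaleR_left D_y[OF q] D_T[OF q]
          has_derivative_mult D_R[OF q] D_v[OF q] D_sprod_y[OF q])
    show ?thesis
    proof (rule has_derivative_eq_rhs[OF D], rule ext)
      fix h
      let ?w = "(\<epsilon> 2 * sprod (Fd y q h) (e 2 q0)) *\<^sub>R e 2 q0 + (\<epsilon> 3 * sprod (Fd y q h) (e 3 q0)) *\<^sub>R e 3 q0"
      have 1: "Fd y q h - ?w = \<omega> 1 q h *\<^sub>R e 1 q + \<omega> 4 q h *\<^sub>R e 4 q"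
        using Dy_split[OF q, of h] by (simp only: add_diff_cancel_left' diff_eq_eq add.commute)
      have 2: "\<omega> 1 q h *\<^sub>R e 1 q = \<omega> 1 q h *\<^sub>R ((v q * \<theta> q * R q) *\<^sub>R e 4 q0 + sprod (e 1 q) d *\<^sub>R B q0 - (\<theta> q * R q) *\<^sub>R d)"
        by (rule arg_cong[OF e1_null(1)[OF q]])
      have 3: "R q * (g q * \<omega> 4 q h) = \<omega> 4 q h" using R_g[OF q] by (simp add: mult.assoc[symmetric])
      have "Fd y q h - (?w + (R q * (g q * \<omega> 4 q h) + \<theta> q * \<omega> 1 q h * R q * v q) *\<^sub>R e 4 q0
        + sprod (Fd y q h) d *\<^sub>R B q0 - (\<theta> q * \<omega> 1 q h * R q) *\<^sub>R d) =
        (Fd y q h - ?w) - ((R q * (g q * \<omega> 4 q h) + \<theta> q * \<omega> 1 q h * R q * v q) *\<^sub>R e 4 q0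
        + sprod (Fd y q h) d *\<^sub>R B q0 - (\<theta> q * \<omega> 1 q h * R q) *\<^sub>R d)"
        by (simp add: algebra_simps)
      also have "\<dots> = 0"
        unfolding 1 2 3 sprod_Dy_d[OF q] unfolding e4_null[OF q] by (simp add: algebra_simps)
      finally show "Fd y q h - (?w + (R q * (g q * \<omega> 4 q h) + \<theta> q * \<omega> 1 q h * R q * v q) *\<^sub>R e 4 q0
        + sprod (Fd y q h) d *\<^sub>R B q0 - (\<theta> q * \<omega> 1 q h * R q) *\<^sub>R d) = 0" .
    qed
  qed
  then have "W q = W q0" if "q \<in> U" for q by (rule zero_derivative_constant[OF _ that])
  then show ?thesis by (intro exI[of _ "W q0"] ballI) (simp add: W_def algebra_simps)
qed

end

end

section \<open>The eight normal forms\<close>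

definition basis5 :: "real^5 \<Rightarrow> real^5 \<Rightarrow> real^5 \<Rightarrow> real^5 \<Rightarrow> real^5 \<Rightarrow> 5 \<Rightarrow> real^5" where
  "basis5 b1 b2 b3 b4 b5 i =
    (if i = 1 then b1 else if i = 2 then b2 else if i = 3 then b3 else if i = 4 then b4 else b5)"

lemma sum_basis5:
  "(\<Sum>i\<in>UNIV. (u::real^5) $ i *\<^sub>R basis5 b1 b2 b3 b4 b5 i) =
    u $ 1 *\<^sub>R b1 + u $ 2 *\<^sub>R b2 + u $ 3 *\<^sub>R b3 + u $ 4 *\<^sub>R b4 + u $ 5 *\<^sub>R b5"
  by (simp add: sum_5 basis5_def)

lemma orthonormal_basis5:
  assumes "sprod b1 b1 = \<eta> 1" "sprod b2 b2 = \<eta> 2" "sprod b3 b3 = \<eta> 3" "sprod b4 b4 = \<eta> 4" "sprod b5 b5 = \<eta> 5"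
    "sprod b1 b2 = 0" "sprod b1 b3 = 0" "sprod b1 b4 = 0" "sprod b1 b5 = 0" "sprod b2 b3 = 0"
    "sprod b2 b4 = 0" "sprod b2 b5 = 0" "sprod b3 b4 = 0" "sprod b3 b5 = 0" "sprod b4 b5 = 0"
    "\<And>i. \<eta> i * \<eta> i = 1"
  shows "orthonormal5 (basis5 b1 b2 b3 b4 b5) \<eta>"
  unfolding orthonormal5_def forall_5
  using assms assms(6)[unfolded sprod_commute[of b1 b2]] assms(7)[unfolded sprod_commute[of b1 b3]] assms(8)[unfolded sprod_commute[of b1 b4]]
    assms(9)[unfolded sprod_commute[of b1 b5]] assms(10)[unfolded sprod_commute[of b2 b3]] assms(11)[unfolded sprod_commute[of b2 b4]]
    assms(12)[unfolded sprod_commute[of b2 b5]] assms(13)[unfolded sprod_commute[of b3 b4]] assms(14)[unfolded sprod_commute[of b3 b5]]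
    assms(15)[unfolded sprod_commute[of b4 b5]]
  by (simp add: basis5_def)

text \<open>The last step shared by all eight cases: \<open>f1\<close> and \<open>f2\<close> become
  profile functions, and \<open>s\<close> may be the arc length or the radius.\<close>

lemma congruent_nearI:
  assumes M: "smooth_manifold M A" "(V0, \<psi>) \<in> A" and U: "open U" "q0 \<in> U" "U \<subseteq> V0"
    and s: "smooth_on s U" and t: "smooth_on t U" and u: "smooth_on u U" and v: "smooth_on v U"
    and indep: "\<And>h. Fd s q0 h = 0 \<Longrightarrow> Fd t q0 h = 0 \<Longrightarrow> Fd u q0 h = 0 \<Longrightarrow> Fd v q0 h = 0 \<Longrightarrow> h = 0"
    and f1: "smooth_on f1 U" "\<And>q h. q \<in> U \<Longrightarrow> Fd f1 q h = d1 q * Fd s q h"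
    and f2: "smooth_on f2 U" "\<And>q h. q \<in> U \<Longrightarrow> Fd f2 q h = d2 q * Fd s q h"
    and b: "orthonormal5 b standard_signs"
    and pos: "\<And>q. q \<in> U \<Longrightarrow> x (\<psi> q) = C + (\<Sum>i\<in>UNIV. F (f1 q) (f2 q) (s q) (t q) (u q) (v q) $ i *\<^sub>R b i)"
  shows "\<exists>I \<phi>1 \<phi>2. open I \<and> is_interval I \<and> smooth_on \<phi>1 I \<and> smooth_on \<phi>2 I \<and>
    congruent_near M A x (\<psi> q0) I (\<lambda>s t u v. F (\<phi>1 s) (\<phi>2 s) s t u v) \<and>
    (\<forall>x\<in>I. \<exists>q\<in>U. deriv \<phi>1 x = d1 q \<and> deriv \<phi>2 x = d2 q)"
proof -
  obtain W :: "(real^4) set" and I \<Gamma> g \<phi>1 \<phi>2 where W: "open W" "open (g ` W)" "g ` W \<subseteq> U" "q0 \<in> g ` W"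
    "homeomorphism (g ` W) W \<Gamma> g" "smooth_on \<Gamma> (g ` W)" "smooth_on g W"
    and I: "open I" "is_interval I" "smooth_on \<phi>1 I" "smooth_on \<phi>2 I"
    and coord: "\<And>w. w \<in> W \<Longrightarrow> w $ 1 \<in> I \<and> s (g w) = w $ 1 \<and> t (g w) = w $ 2 \<and> u (g w) = w $ 3 \<and> v (g w) = w $ 4 \<and>
      f1 (g w) = \<phi>1 (w $ 1) \<and> f2 (g w) = \<phi>2 (w $ 1)"
    and der: "\<And>x. x \<in> I \<Longrightarrow> \<exists>q\<in>U. deriv \<phi>1 x = d1 q \<and> deriv \<phi>2 x = d2 q"
    by (rule adapted_coordinates[OF U(1,2) s t u v indep f1 f2]) (assumption | rule that)+
  obtain \<Phi> where \<Phi>: "pe_isometry \<Phi>" "\<And>u. \<Phi> (C + (\<Sum>i\<in>UNIV. u $ i *\<^sub>R b i)) = u"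
    using isometry_to_standard_axes[OF b] by blast
  have adm: "admissible_param M A (W, \<psi> \<circ> g)"
    using W(3) U(3) by (intro admissible_reparametrization[OF M W(1,2) _ W(5,6,7)]) blast
  have "\<Phi> (x ((\<psi> \<circ> g) w)) = F (\<phi>1 (w $ 1)) (\<phi>2 (w $ 1)) (w $ 1) (w $ 2) (w $ 3) (w $ 4)" if w: "w \<in> W" for w
  proof -
    have "g w \<in> U" using W(3) w by blast
    then show ?thesis using coord[OF w] by (simp add: pos \<Phi>(2))
  qed
  moreover have "\<psi> q0 \<in> (\<psi> \<circ> g) ` W" using W(4) by (auto simp: image_iff)
  ultimately have "congruent_near M A x (\<psi> q0) I (\<lambda>s t u v. F (\<phi>1 s) (\<phi>2 s) s t u v)"
    unfolding congruent_near_def using \<Phi>(1) adm coord by blast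
  then show ?thesis using I der by blast
qed

section \<open>Normal forms for each causal type of the axis\<close>

context cylinder_ball
begin

lemma smooth_vanish:
  assumes "\<omega> 1 q0 h = 0" "\<omega> 2 q0 h = 0" "\<omega> 3 q0 h = 0" "\<omega> 4 q0 h = 0" shows "h = 0"
  using vector_expansion[OF q0, of h] by (simp add: sum_4 assms)

lemma Fd_T_q0: "Fd (T p) q0 h = \<omega> p q0 h"
  using Fd_eqI[OF D_T[OF q0]] by (simp add: \<omega>_def)

lemma Fd_v_q0: "Fd v q0 h = 0 \<Longrightarrow> \<omega> 4 q0 h = 0"
  using Fd_eqI[OF D_v[OF q0], of h] g_pos[OF q0] by simp

text \<open>The profile curve is (R, a) with parameter s, ds = \<omega>_1. From R' = \<theta> R and
  a' = \<tau> k_4 R, its speed relation is the identity \<tau> = \<kappa> R^2.\<close>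

lemma nonnull_congruent:
  fixes x :: "'m \<Rightarrow> real^5" and cs sn :: "real \<Rightarrow> real"
  assumes M: "smooth_manifold M At" "(V0, \<psi>) \<in> At" "U \<subseteq> V0" and y: "\<And>q. y q = x (\<psi> q)"
    and \<tau>: "\<tau> * \<tau> = 1" and p: "p = 2 \<and> p' = 3 \<or> p = 3 \<and> p' = (2::4)"
    and D: "\<And>z. DERIV cs z :> - (\<tau> * \<epsilon> 4) * sn z" "\<And>z. DERIV sn z :> cs z"
    and 0: "cs 0 = 1" "sn 0 = 0" and unit: "\<And>z. cs z * cs z + \<tau> * \<epsilon> 4 * (sn z * sn z) = 1"
    and b: "orthonormal5 b standard_signs"
    and F: "\<And>\<phi> \<psi> t u v. (\<Sum>i\<in>UNIV. F \<phi> \<psi> t u v $ i *\<^sub>R b i) = t *\<^sub>R e p q0 + u *\<^sub>R e p' q0 + \<psi> *\<^sub>R A q0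
      + (\<phi> * cs v) *\<^sub>R (- \<tau> *\<^sub>R B q0) + (\<phi> * sn v) *\<^sub>R e 4 q0"
  shows "\<exists>I \<phi>1 \<phi>2. open I \<and> is_interval I \<and> smooth_on \<phi>1 I \<and> smooth_on \<phi>2 I \<and>
    congruent_near M At x (\<psi> q0) I (\<lambda>s t u v. F (\<phi>1 s) (\<phi>2 s) t u v) \<and>
    (\<forall>x\<in>I. \<epsilon> 1 * (deriv \<phi>1 x)\<^sup>2 + (deriv \<phi>2 x)\<^sup>2 = \<tau>)"
proof -
  obtain C where C: "\<And>q. q \<in> U \<Longrightarrow> y q = C + (T 2 q *\<^sub>R e 2 q0 + T 3 q *\<^sub>R e 3 q0 + a q *\<^sub>R A q0 - (\<tau> * R q) *\<^sub>R B q)"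
    using position_nonnull[OF \<tau>] by blast
  have pos: "x (\<psi> q) = C + (\<Sum>i\<in>UNIV. F (R q) (a q) (T p q) (T p' q) (v q) $ i *\<^sub>R b i)" if q: "q \<in> U" for q
  proof -
    have rB: "(\<tau> * R q) *\<^sub>R B q = - ((R q * cs (v q)) *\<^sub>R (- \<tau> *\<^sub>R B q0) + (\<tau> * \<tau> * (R q * sn (v q))) *\<^sub>R e 4 q0)"
      unfolding rotation[OF D 0 unit q] by (simp add: algebra_simps)
    have "y q = C + (T 2 q *\<^sub>R e 2 q0 + T 3 q *\<^sub>R e 3 q0 + a q *\<^sub>R A q0 -
        - ((R q * cs (v q)) *\<^sub>R (- \<tau> *\<^sub>R B q0) + (1 * (R q * sn (v q))) *\<^sub>R e 4 q0))"
      using C[OF q] unfolding rB \<tau> .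
    then show ?thesis using p unfolding F y[symmetric] by (auto simp: algebra_simps)
  qed
  have Ds: "Fd s q h = \<omega> 1 q h" if "q \<in> U" for q h by (rule Fd_eqI[OF D_s[OF that]])
  have "\<exists>I \<phi>1 \<phi>2. open I \<and> is_interval I \<and> smooth_on \<phi>1 I \<and> smooth_on \<phi>2 I \<and>
    congruent_near M At x (\<psi> q0) I (\<lambda>s t u v. F (\<phi>1 s) (\<phi>2 s) t u v) \<and>
    (\<forall>x\<in>I. \<exists>q\<in>U. deriv \<phi>1 x = \<theta> q * R q \<and> deriv \<phi>2 x = \<tau> * k 4 q * R q)"
  proof (rule congruent_nearI[where F = "\<lambda>\<phi> \<psi> s t u v. F \<phi> \<psi> t u v", OF M(1,2) open_U q0 M(3) smooth_s
        smooth_T smooth_T smooth_v _ smooth_R _ smooth_a _ b pos])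
    fix h assume "Fd s q0 h = 0" "Fd (T p) q0 h = 0" "Fd (T p') q0 h = 0" "Fd v q0 h = 0"
    then show "h = 0" using p Fd_v_q0[of h] by (auto simp: Ds[OF q0] Fd_T_q0 intro!: smooth_vanish)
  next
    fix q h assume q: "q \<in> U"
    show "Fd R q h = \<theta> q * R q * Fd s q h" using Fd_eqI[OF D_R[OF q]] by (simp add: Ds[OF q] mult_ac)
    show "Fd a q h = \<tau> * k 4 q * R q * Fd s q h" using Fd_eqI[OF D_a[OF q]] by (simp add: Ds[OF q])
  qed
  moreover have "\<epsilon> 1 * (\<theta> q * R q)\<^sup>2 + (\<tau> * k 4 q * R q)\<^sup>2 = \<tau>" if q: "q \<in> U" for q
  proof -
    have "\<epsilon> 1 * (\<theta> q * R q)\<^sup>2 + (\<tau> * k 4 q * R q)\<^sup>2 = \<epsilon> 1 * (\<theta> q * R q)\<^sup>2 + \<tau> * \<tau> * (k 4 q * R q)\<^sup>2"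
      by (simp add: power2_eq_square mult_ac)
    also have "\<dots> = \<kappa> q * (R q)\<^sup>2" unfolding \<tau> \<kappa>_def by (simp add: power2_eq_square algebra_simps)
    finally show ?thesis using \<tau>_eq[OF q] by simp
  qed
  ultimately obtain I \<phi>1 \<phi>2 where I: "open I" "is_interval I" "smooth_on \<phi>1 I" "smooth_on \<phi>2 I"
      "congruent_near M At x (\<psi> q0) I (\<lambda>s t u v. F (\<phi>1 s) (\<phi>2 s) t u v)"
    and der: "\<forall>x\<in>I. \<exists>q\<in>U. deriv \<phi>1 x = \<theta> q * R q \<and> deriv \<phi>2 x = \<tau> * k 4 q * R q"
    and rel: "\<And>q. q \<in> U \<Longrightarrow> \<epsilon> 1 * (\<theta> q * R q)\<^sup>2 + (\<tau> * k 4 q * R q)\<^sup>2 = \<tau>" by blast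
  have "\<epsilon> 1 * (deriv \<phi>1 x)\<^sup>2 + (deriv \<phi>2 x)\<^sup>2 = \<tau>" if x: "x \<in> I" for x
  proof -
    obtain q where "q \<in> U" "deriv \<phi>1 x = \<theta> q * R q" "deriv \<phi>2 x = \<tau> * k 4 q * R q" using der x by blast
    then show ?thesis using rel by simp
  qed
  then show ?thesis using I by blast
qed

text \<open>The radius is the parameter s, and the single profile function \<epsilon>_4 \<Psi> - s/2
  fills both slots of \<open>congruent_nearI\<close>. The shift by s/2 matches the listed forms, in
  which s is added to only one of two components; it makes \<epsilon>_4 (1 + 2 \<psi>') equal to 1 /
  (\<theta> R)^2.\<close>

lemma null_congruent:
  fixes x :: "'m \<Rightarrow> real^5"
  assumes M: "smooth_manifold M At" "(V0, \<psi>) \<in> At" "U \<subseteq> V0" and y: "\<And>q. y q = x (\<psi> q)"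
    and \<tau>: "\<tau> = 0" and p: "p = 2 \<and> p' = 3 \<or> p = 3 \<and> p' = (2::4)"
    and b: "orthonormal5 b standard_signs"
    and F: "\<And>\<psi> s t u v. (\<Sum>i\<in>UNIV. F \<psi> s t u v $ i *\<^sub>R b i) = t *\<^sub>R e p q0 + u *\<^sub>R e p' q0 + (s * v) *\<^sub>R e 4 q0
      + (\<epsilon> 4 * (s * v\<^sup>2 / 2 + \<psi> + s / 2)) *\<^sub>R B q0 - s *\<^sub>R d"
  shows "\<exists>I \<phi>. open I \<and> is_interval I \<and> smooth_on \<phi> I \<and>
    congruent_near M At x (\<psi> q0) I (\<lambda>s t u v. F (\<phi> s) s t u v) \<and>
    (\<forall>x\<in>I. \<epsilon> 4 * (1 + 2 * deriv \<phi> x) > 0)"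
proof -
  obtain C where C: "\<And>q. q \<in> U \<Longrightarrow> y q = C + (T 2 q *\<^sub>R e 2 q0 + T 3 q *\<^sub>R e 3 q0 + (R q * v q) *\<^sub>R e 4 q0
    + sprod (y q) d *\<^sub>R B q0 - R q *\<^sub>R d)"
    using position_null[OF \<tau>] by blast
  let ?f = "\<lambda>q. \<epsilon> 4 * \<Psi> q - 1 / 2 * R q"
  let ?d = "\<lambda>q. \<epsilon> 4 * (1 / (2 * (\<theta> q * R q)\<^sup>2)) - 1 / 2"
  have f: "smooth_on ?f U"
    by (intro smooth_on_diff smooth_on_mult smooth_on_const open_U smooth_\<Psi> smooth_R)
  have pos: "x (\<psi> q) = C + (\<Sum>i\<in>UNIV. F (?f q) (R q) (T p q) (T p' q) (v q) $ i *\<^sub>R b i)" if q: "q \<in> U" for q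
  proof -
    have "sprod (y q) d = \<Psi> q + \<epsilon> 4 * (R q * (v q)\<^sup>2 / 2)" by (simp add: \<Psi>_def)
    also have "\<dots> = \<epsilon> 4 * (R q * (v q)\<^sup>2 / 2 + ?f q + R q / 2)" by (simp add: distrib_left right_diff_distrib eps_cancel)
    finally show ?thesis
      using C[OF q] p unfolding F y[symmetric] by (auto simp: ac_simps)
  qed
  have DR: "Fd R q h = \<theta> q * \<omega> 1 q h * R q" if "q \<in> U" for q h by (rule Fd_eqI[OF D_R[OF that]])
  have Df: "Fd ?f q h = ?d q * Fd R q h" if q: "q \<in> U" for q h
    using Fd_eqI[OF has_derivative_diff[OF has_derivative_mult_right[OF D_\<Psi>[OF \<tau> q], of "\<epsilon> 4"]
        has_derivative_mult_right[OF D_R[OF q], of "1/2"]]]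
    unfolding DR[OF q] by (simp add: algebra_simps)
  have "\<exists>I \<phi>1 \<phi>2. open I \<and> is_interval I \<and> smooth_on \<phi>1 I \<and> smooth_on \<phi>2 I \<and>
    congruent_near M At x (\<psi> q0) I (\<lambda>s t u v. F (\<phi>1 s) s t u v) \<and>
    (\<forall>x\<in>I. \<exists>q\<in>U. deriv \<phi>1 x = ?d q \<and> deriv \<phi>2 x = ?d q)"
  proof (rule congruent_nearI[where F = "\<lambda>\<phi> \<psi> s t u v. F \<phi> s t u v", OF M(1,2) open_U q0 M(3) smooth_R
        smooth_T smooth_T smooth_v _ f Df f Df b pos])
    fix h assume h: "Fd R q0 h = 0" "Fd (T p) q0 h = 0" "Fd (T p') q0 h = 0" "Fd v q0 h = 0"
    have "\<omega> 1 q0 h = 0" using h(1) R_pos[OF q0] null_facts(2)[OF \<tau> q0] by (simp add: DR[OF q0])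
    then show "h = 0" using h p Fd_v_q0[of h] by (auto simp: Fd_T_q0 intro!: smooth_vanish)
  qed
  moreover have "\<epsilon> 4 * (1 + 2 * ?d q) > 0" if q: "q \<in> U" for q
  proof -
    have "\<epsilon> 4 * (1 + 2 * ?d q) = 1 / (\<theta> q * R q)\<^sup>2"
      by (simp add: distrib_left right_diff_distrib eps_cancel eps)
    then show ?thesis using null_facts(2)[OF \<tau> q] R_pos[OF q] by simp
  qed
  ultimately obtain I \<phi>1 \<phi>2 where I: "open I" "is_interval I" "smooth_on \<phi>1 I"
      "congruent_near M At x (\<psi> q0) I (\<lambda>s t u v. F (\<phi>1 s) s t u v)"
    and der: "\<forall>x\<in>I. \<exists>q\<in>U. deriv \<phi>1 x = ?d q \<and> deriv \<phi>2 x = ?d q"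
    and rel: "\<And>q. q \<in> U \<Longrightarrow> \<epsilon> 4 * (1 + 2 * ?d q) > 0" by blast
  have "\<epsilon> 4 * (1 + 2 * deriv \<phi>1 x) > 0" if x: "x \<in> I" for x
  proof -
    obtain q where q: "q \<in> U" "deriv \<phi>1 x = ?d q" using der x by blast
    show ?thesis unfolding q(2) by (rule rel[OF q(1)])
  qed
  then show ?thesis using I by blast
qed

lemma products_q0:
  assumes p: "p = 2 \<or> p = 3"
  shows "sprod (e p q0) (A q0) = 0" "sprod (A q0) (e p q0) = 0" "sprod (e p q0) (B q0) = 0" "sprod (B q0) (e p q0) = 0"
    "sprod (e p q0) d = 0" "sprod d (e p q0) = 0" "sprod (e p q0) (e 4 q0) = 0" "sprod (e 4 q0) (e p q0) = 0"
    "sprod (e p q0) (e p q0) = \<epsilon> p"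
  using p by (auto simp: A_def B_def V_def d_def sprod_simps e_orth[OF q0] e_n[OF q0] n_e[OF q0])

lemma products_AB:
  "sprod (A q0) (A q0) = \<epsilon> 1 * \<tau>" "sprod (B q0) (B q0) = \<tau>" "sprod (A q0) (B q0) = 0" "sprod (B q0) (A q0) = 0"
  "sprod (e 4 q0) (A q0) = 0" "sprod (A q0) (e 4 q0) = 0" "sprod (e 4 q0) (B q0) = 0" "sprod (B q0) (e 4 q0) = 0"
  "sprod (e 4 q0) (e 4 q0) = \<epsilon> 4"
  using sprod_e_B[OF q0] sprod_e_A[OF q0] eps_cancel[of 1]
  by (simp_all add: \<tau>_def e_orth[OF q0] sprod_commute[of "A q0" "e 4 q0"]
      sprod_commute[of "B q0" "e 4 q0"] sprod_commute[of "B q0" "A q0"])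

theorem classification:
  fixes x :: "'m \<Rightarrow> real^5"
  assumes M: "smooth_manifold M At" "(V0, \<psi>0) \<in> At" "U \<subseteq> V0" and y: "\<And>q. y q = x (\<psi>0 q)"
    and \<tau>: "\<tau> \<in> {-1, 0, 1}"
  shows "\<exists>I \<phi> \<psi>. open I \<and> is_interval I \<and> smooth_on \<phi> I \<and> smooth_on \<psi> I \<and>
    ((congruent_near M At x (\<psi>0 q0) I (\<lambda>s t u v. vector [t, u, \<phi> s * cos v, \<phi> s * sin v, \<psi> s]) \<and>
        (\<forall>s\<in>I. (deriv \<phi> s)\<^sup>2 + (deriv \<psi> s)\<^sup>2 = 1)) \<or>
     (congruent_near M At x (\<psi>0 q0) I (\<lambda>s t u v. vector [\<phi> s * sinh v, t, u, \<phi> s * cosh v, \<psi> s]) \<and>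
        (\<forall>s\<in>I. (deriv \<phi> s)\<^sup>2 + (deriv \<psi> s)\<^sup>2 = 1)) \<or>
     (congruent_near M At x (\<psi>0 q0) I (\<lambda>s t u v. vector [\<psi> s, t, u, \<phi> s * cos v, \<phi> s * sin v]) \<and>
        (\<forall>s\<in>I. (deriv \<phi> s)\<^sup>2 - (deriv \<psi> s)\<^sup>2 = -1)) \<or>
     (congruent_near M At x (\<psi>0 q0) I (\<lambda>s t u v. vector [\<phi> s * cosh v, t, u, \<phi> s * sinh v, \<psi> s]) \<and>
        (\<forall>s\<in>I. (deriv \<phi> s)\<^sup>2 - (deriv \<psi> s)\<^sup>2 = 1)) \<or>
     (congruent_near M At x (\<psi>0 q0) I
          (\<lambda>s t u v. vector [v\<^sup>2 * s / 2 + \<psi> s + s, t, u, v * s, v\<^sup>2 * s / 2 + \<psi> s]) \<and>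
        (\<forall>s\<in>I. 1 + 2 * deriv \<psi> s > 0)) \<or>
     (congruent_near M At x (\<psi>0 q0) I (\<lambda>s t u v. vector [\<phi> s * cos v, \<phi> s * sin v, t, u, \<psi> s]) \<and>
        (\<forall>s\<in>I. (deriv \<phi> s)\<^sup>2 - (deriv \<psi> s)\<^sup>2 = 1)) \<or>
     (congruent_near M At x (\<psi>0 q0) I (\<lambda>s t u v. vector [\<phi> s * sinh v, \<psi> s, t, u, \<phi> s * cosh v]) \<and>
        (\<forall>s\<in>I. (deriv \<phi> s)\<^sup>2 - (deriv \<psi> s)\<^sup>2 = -1)) \<or>
     (congruent_near M At x (\<psi>0 q0) I
          (\<lambda>s t u v. vector [s * v\<^sup>2 / 2 + \<psi> s, s * v, t, u, s * v\<^sup>2 / 2 + \<psi> s + s]) \<and>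
        (\<forall>s\<in>I. 1 + 2 * deriv \<psi> s < 0)))"
proof -
  have pm: "\<epsilon> i = 1 \<or> \<epsilon> i = -1" for i using eps[of i] by (simp add: square_eq_1_iff)
  have trig: "DERIV cos z :> - (\<tau> * \<epsilon> 4) * sin z" "DERIV sin z :> cos z"
      "cos z * cos z + \<tau> * \<epsilon> 4 * (sin z * sin z) = 1" if "\<tau> * \<epsilon> 4 = 1" for z :: real
    using DERIV_cos[of z] DERIV_sin[of z] that sin_cos_squared_add3[of z] by simp_all
  have hyp: "DERIV cosh z :> - (\<tau> * \<epsilon> 4) * sinh z" "DERIV sinh z :> cosh z"
      "cosh z * cosh z + \<tau> * \<epsilon> 4 * (sinh z * sinh z) = 1" if "\<tau> * \<epsilon> 4 = -1" for z :: real
    unfolding that using cosh_square_eq[of z]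
    by (auto intro!: derivative_eq_intros simp: power2_eq_square)
  \<comment> \<open>The rulings are ordered with a timelike one first, as the negative axes precede
    the positive ones.\<close>
  obtain p p' where p: "p = 2 \<and> p' = 3 \<or> p = 3 \<and> p' = (2::4)" and le: "\<epsilon> p \<le> \<epsilon> p'"
    by (cases "\<epsilon> 2 \<le> \<epsilon> 3") force+
  have p12: "p = 2 \<or> p = 3" "p' = 2 \<or> p' = 3" "p \<noteq> p'" "p' \<noteq> p" using p by auto
  have "sprod (e p q0) (e p' q0) = 0" "sprod (e p' q0) (e p q0) = 0" using p12 by (simp_all add: e_orth[OF q0])
  note pr = this products_q0[OF p12(1)] products_q0[OF p12(2)] products_AB sprod_simps
  show ?thesis
  proof (cases "\<tau> = 0")
    case True
    note prd = pr d_products[OF True] sprod_commute[of d "B q0"] sprod_commute[of d "e 4 q0"]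
    let ?\<eta> = "\<lambda>i::5. if i = 1 then \<epsilon> p else if i = 2 then \<epsilon> p' else if i = 3 then \<epsilon> 4 else if i = 4 then 1 else -1"
    have "orthonormal5 (basis5 (e p q0) (e p' q0) (e 4 q0) (d + (1/2) *\<^sub>R B q0) (d - (1/2) *\<^sub>R B q0)) ?\<eta>"
      by (rule orthonormal_basis5) (use p12 in \<open>simp_all add: prd True eps\<close>)
    \<comment> \<open>The lightlike pair contributes one sign of each kind, so exactly one of the
      other three is negative.\<close>
    from orthonormal5_signature[OF this] have sig: "\<epsilon> p + \<epsilon> p' + \<epsilon> 4 = 1" by (simp add: sum_5)
    have "?thesis" if c: "\<epsilon> 4 = 1" "\<epsilon> p = -1" "\<epsilon> p' = 1"
    proof -
      \<comment> \<open>Since <B, d> = 1, half of \<open>B\<close> plus or minus \<open>d\<close>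
        has square 1 or -1.\<close>
      have b: "orthonormal5 (basis5 ((1/2) *\<^sub>R B q0 - d) (e p q0) (e p' q0) (e 4 q0) ((1/2) *\<^sub>R B q0 + d)) standard_signs"
        by (rule orthonormal_basis5) (use c p12 in \<open>simp_all add: prd True\<close>)
      obtain I \<phi> where I: "open I" "is_interval I" "smooth_on \<phi> I"
        and cn: "congruent_near M At x (\<psi>0 q0) I (\<lambda>s t u v. vector [v\<^sup>2 * s / 2 + \<phi> s + s, t, u, v * s, v\<^sup>2 * s / 2 + \<phi> s])"
        and rel: "\<forall>x\<in>I. \<epsilon> 4 * (1 + 2 * deriv \<phi> x) > 0"
        using null_congruent[OF M y True p b, of "\<lambda>\<psi> s t u v. vector [v\<^sup>2 * s / 2 + \<psi> + s, t, u, v * s, v\<^sup>2 * s / 2 + \<psi>]"]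
        by (auto simp: sum_basis5 vector_5 c algebra_simps vec_eq_iff field_simps)
      have "\<forall>s\<in>I. 1 + 2 * deriv \<phi> s > 0" using rel c by (auto simp: algebra_simps)
      then show ?thesis
        using I cn by (intro exI[of _ I] exI[of _ \<phi>] conjI) blast+
    qed
    moreover
    have "?thesis" if c: "\<epsilon> 4 = -1" "\<epsilon> p = 1" "\<epsilon> p' = 1"
    proof -
      have b: "orthonormal5 (basis5 (d - (1/2) *\<^sub>R B q0) (e 4 q0) (e p q0) (e p' q0) (- d - (1/2) *\<^sub>R B q0)) standard_signs"
        by (rule orthonormal_basis5) (use c p12 in \<open>simp_all add: prd True\<close>)
      obtain I \<phi> where I: "open I" "is_interval I" "smooth_on \<phi> I"
        and cn: "congruent_near M At x (\<psi>0 q0) I (\<lambda>s t u v. vector [s * v\<^sup>2 / 2 + \<phi> s, s * v, t, u, s * v\<^sup>2 / 2 + \<phi> s + s])"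
        and rel: "\<forall>x\<in>I. \<epsilon> 4 * (1 + 2 * deriv \<phi> x) > 0"
        using null_congruent[OF M y True p b, of "\<lambda>\<psi> s t u v. vector [s * v\<^sup>2 / 2 + \<psi>, s * v, t, u, s * v\<^sup>2 / 2 + \<psi> + s]"]
        by (auto simp: sum_basis5 vector_5 c algebra_simps vec_eq_iff field_simps)
      have "\<forall>s\<in>I. 1 + 2 * deriv \<phi> s < 0" using rel c by (auto simp: algebra_simps)
      then show ?thesis
        using I cn by (intro exI[of _ I] exI[of _ \<phi>] conjI) blast+
    qed
    ultimately show ?thesis using pm[of p] pm[of p'] pm[of 4] sig le by auto
  next
    case False
    then have \<tau>1: "\<tau> * \<tau> = 1" and \<tau>pm: "\<tau> = 1 \<or> \<tau> = -1" using \<tau> by auto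
    \<comment> \<open>For a spacelike \<open>e 1\<close>, \<open>\<kappa>\<close> is a sum of
      squares.\<close>
    have pos: "\<tau> = 1" if "\<epsilon> 1 = 1"
    proof -
      have "\<kappa> q0 * (R q0)\<^sup>2 \<ge> 0" by (simp add: \<kappa>_def that)
      then show ?thesis using \<tau>pm \<tau>_eq[OF q0] by auto
    qed
    let ?\<eta> = "\<lambda>i::5. if i = 1 then \<epsilon> p else if i = 2 then \<epsilon> p' else if i = 3 then \<epsilon> 4 else if i = 4 then \<tau> else \<epsilon> 1 * \<tau>"
    have "\<epsilon> 1 * \<tau> * (\<epsilon> 1 * \<tau>) = 1" using \<tau>1 eps[of 1] by algebra
    then have "orthonormal5 (basis5 (e p q0) (e p' q0) (e 4 q0) (B q0) (A q0)) ?\<eta>"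
      by (intro orthonormal_basis5) (use p12 in \<open>simp_all add: pr eps \<tau>1\<close>)
    \<comment> \<open>The signs of \<open>e p\<close>, \<open>e p'\<close> and \<open>e 4\<close>
      add up to -1 if \<open>\<epsilon> 1\<close> is 1 and to 1 otherwise; each value of
      \<open>\<epsilon> 4\<close> then determines the ordered rulings.\<close>
    from orthonormal5_signature[OF this] have sig: "\<epsilon> p + \<epsilon> p' + \<epsilon> 4 + \<tau> + \<epsilon> 1 * \<tau> = 1" by (simp add: sum_5)
    have "?thesis" if c: "\<epsilon> 1 = 1" "\<tau> = 1" "\<epsilon> 4 = 1" "\<epsilon> p = -1" "\<epsilon> p' = -1"
    proof -
      have b: "orthonormal5 (basis5 (e p q0) (e p' q0) (- \<tau> *\<^sub>R B q0) (e 4 q0) (A q0)) standard_signs"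
        by (rule orthonormal_basis5) (use c p12 in \<open>simp_all add: pr\<close>)
      have t: "\<tau> * \<epsilon> 4 = 1" using c by simp
      obtain I \<phi>1 \<phi>2 where I: "open I" "is_interval I" "smooth_on \<phi>1 I" "smooth_on \<phi>2 I"
        and cn: "congruent_near M At x (\<psi>0 q0) I (\<lambda>s t u v. vector [t, u, \<phi>1 s * cos v, \<phi>1 s * sin v, \<phi>2 s])"
        and rel: "\<forall>x\<in>I. \<epsilon> 1 * (deriv \<phi>1 x)\<^sup>2 + (deriv \<phi>2 x)\<^sup>2 = \<tau>"
        using nonnull_congruent[OF M y \<tau>1 p trig(1,2)[OF t] cos_zero sin_zero trig(3)[OF t] b,
          of "\<lambda>\<phi> \<psi> t u v. vector [t, u, \<phi> * cos v, \<phi> * sin v, \<psi>]"]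
        by (auto simp: sum_basis5 vector_5 c algebra_simps)
      have "\<forall>s\<in>I. (deriv \<phi>1 s)\<^sup>2 + (deriv \<phi>2 s)\<^sup>2 = 1" using rel c by (auto simp: algebra_simps)
      then show ?thesis
        using I cn by (intro exI[of _ I] exI[of _ \<phi>1] exI[of _ \<phi>2] conjI) blast+
    qed
    moreover
    have "?thesis" if c: "\<epsilon> 1 = 1" "\<tau> = 1" "\<epsilon> 4 = -1" "\<epsilon> p = -1" "\<epsilon> p' = 1"
    proof -
      have b: "orthonormal5 (basis5 (e 4 q0) (e p q0) (e p' q0) (- \<tau> *\<^sub>R B q0) (A q0)) standard_signs"
        by (rule orthonormal_basis5) (use c p12 in \<open>simp_all add: pr\<close>)
      have t: "\<tau> * \<epsilon> 4 = -1" using c by simp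
      obtain I \<phi>1 \<phi>2 where I: "open I" "is_interval I" "smooth_on \<phi>1 I" "smooth_on \<phi>2 I"
        and cn: "congruent_near M At x (\<psi>0 q0) I (\<lambda>s t u v. vector [\<phi>1 s * sinh v, t, u, \<phi>1 s * cosh v, \<phi>2 s])"
        and rel: "\<forall>x\<in>I. \<epsilon> 1 * (deriv \<phi>1 x)\<^sup>2 + (deriv \<phi>2 x)\<^sup>2 = \<tau>"
        using nonnull_congruent[OF M y \<tau>1 p hyp(1,2)[OF t] cosh_0 sinh_0 hyp(3)[OF t] b,
          of "\<lambda>\<phi> \<psi> t u v. vector [\<phi> * sinh v, t, u, \<phi> * cosh v, \<psi>]"]
        by (auto simp: sum_basis5 vector_5 c algebra_simps)
      have "\<forall>s\<in>I. (deriv \<phi>1 s)\<^sup>2 + (deriv \<phi>2 s)\<^sup>2 = 1" using rel c by (auto simp: algebra_simps)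
      then show ?thesis
        using I cn by (intro exI[of _ I] exI[of _ \<phi>1] exI[of _ \<phi>2] conjI) blast+
    qed
    moreover
    have "?thesis" if c: "\<epsilon> 1 = -1" "\<tau> = 1" "\<epsilon> 4 = 1" "\<epsilon> p = -1" "\<epsilon> p' = 1"
    proof -
      have b: "orthonormal5 (basis5 (A q0) (e p q0) (e p' q0) (- \<tau> *\<^sub>R B q0) (e 4 q0)) standard_signs"
        by (rule orthonormal_basis5) (use c p12 in \<open>simp_all add: pr\<close>)
      have t: "\<tau> * \<epsilon> 4 = 1" using c by simp
      obtain I \<phi>1 \<phi>2 where I: "open I" "is_interval I" "smooth_on \<phi>1 I" "smooth_on \<phi>2 I"
        and cn: "congruent_near M At x (\<psi>0 q0) I (\<lambda>s t u v. vector [\<phi>2 s, t, u, \<phi>1 s * cos v, \<phi>1 s * sin v])"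
        and rel: "\<forall>x\<in>I. \<epsilon> 1 * (deriv \<phi>1 x)\<^sup>2 + (deriv \<phi>2 x)\<^sup>2 = \<tau>"
        using nonnull_congruent[OF M y \<tau>1 p trig(1,2)[OF t] cos_zero sin_zero trig(3)[OF t] b,
          of "\<lambda>\<phi> \<psi> t u v. vector [\<psi>, t, u, \<phi> * cos v, \<phi> * sin v]"]
        by (auto simp: sum_basis5 vector_5 c algebra_simps)
      have "\<forall>s\<in>I. (deriv \<phi>1 s)\<^sup>2 - (deriv \<phi>2 s)\<^sup>2 = -1" using rel c by (auto simp: algebra_simps)
      then show ?thesis
        using I cn by (intro exI[of _ I] exI[of _ \<phi>1] exI[of _ \<phi>2] conjI) blast+
    qed
    moreover
    have "?thesis" if c: "\<epsilon> 1 = -1" "\<tau> = -1" "\<epsilon> 4 = 1" "\<epsilon> p = -1" "\<epsilon> p' = 1"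
    proof -
      have b: "orthonormal5 (basis5 (- \<tau> *\<^sub>R B q0) (e p q0) (e p' q0) (e 4 q0) (A q0)) standard_signs"
        by (rule orthonormal_basis5) (use c p12 in \<open>simp_all add: pr\<close>)
      have t: "\<tau> * \<epsilon> 4 = -1" using c by simp
      obtain I \<phi>1 \<phi>2 where I: "open I" "is_interval I" "smooth_on \<phi>1 I" "smooth_on \<phi>2 I"
        and cn: "congruent_near M At x (\<psi>0 q0) I (\<lambda>s t u v. vector [\<phi>1 s * cosh v, t, u, \<phi>1 s * sinh v, \<phi>2 s])"
        and rel: "\<forall>x\<in>I. \<epsilon> 1 * (deriv \<phi>1 x)\<^sup>2 + (deriv \<phi>2 x)\<^sup>2 = \<tau>"
        using nonnull_congruent[OF M y \<tau>1 p hyp(1,2)[OF t] cosh_0 sinh_0 hyp(3)[OF t] b,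
          of "\<lambda>\<phi> \<psi> t u v. vector [\<phi> * cosh v, t, u, \<phi> * sinh v, \<psi>]"]
        by (auto simp: sum_basis5 vector_5 c algebra_simps)
      have "\<forall>s\<in>I. (deriv \<phi>1 s)\<^sup>2 - (deriv \<phi>2 s)\<^sup>2 = 1" using rel c by (auto simp: algebra_simps)
      then show ?thesis
        using I cn by (intro exI[of _ I] exI[of _ \<phi>1] exI[of _ \<phi>2] conjI) blast+
    qed
    moreover
    have "?thesis" if c: "\<epsilon> 1 = -1" "\<tau> = -1" "\<epsilon> 4 = -1" "\<epsilon> p = 1" "\<epsilon> p' = 1"
    proof -
      have b: "orthonormal5 (basis5 (- \<tau> *\<^sub>R B q0) (e 4 q0) (e p q0) (e p' q0) (A q0)) standard_signs"
        by (rule orthonormal_basis5) (use c p12 in \<open>simp_all add: pr\<close>)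
      have t: "\<tau> * \<epsilon> 4 = 1" using c by simp
      obtain I \<phi>1 \<phi>2 where I: "open I" "is_interval I" "smooth_on \<phi>1 I" "smooth_on \<phi>2 I"
        and cn: "congruent_near M At x (\<psi>0 q0) I (\<lambda>s t u v. vector [\<phi>1 s * cos v, \<phi>1 s * sin v, t, u, \<phi>2 s])"
        and rel: "\<forall>x\<in>I. \<epsilon> 1 * (deriv \<phi>1 x)\<^sup>2 + (deriv \<phi>2 x)\<^sup>2 = \<tau>"
        using nonnull_congruent[OF M y \<tau>1 p trig(1,2)[OF t] cos_zero sin_zero trig(3)[OF t] b,
          of "\<lambda>\<phi> \<psi> t u v. vector [\<phi> * cos v, \<phi> * sin v, t, u, \<psi>]"]
        by (auto simp: sum_basis5 vector_5 c algebra_simps)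
      have "\<forall>s\<in>I. (deriv \<phi>1 s)\<^sup>2 - (deriv \<phi>2 s)\<^sup>2 = 1" using rel c by (auto simp: algebra_simps)
      then show ?thesis
        using I cn by (intro exI[of _ I] exI[of _ \<phi>1] exI[of _ \<phi>2] conjI) blast+
    qed
    moreover
    have "?thesis" if c: "\<epsilon> 1 = -1" "\<tau> = 1" "\<epsilon> 4 = -1" "\<epsilon> p = 1" "\<epsilon> p' = 1"
    proof -
      have b: "orthonormal5 (basis5 (e 4 q0) (A q0) (e p q0) (e p' q0) (- \<tau> *\<^sub>R B q0)) standard_signs"
        by (rule orthonormal_basis5) (use c p12 in \<open>simp_all add: pr\<close>)
      have t: "\<tau> * \<epsilon> 4 = -1" using c by simp
      obtain I \<phi>1 \<phi>2 where I: "open I" "is_interval I" "smooth_on \<phi>1 I" "smooth_on \<phi>2 I"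
        and cn: "congruent_near M At x (\<psi>0 q0) I (\<lambda>s t u v. vector [\<phi>1 s * sinh v, \<phi>2 s, t, u, \<phi>1 s * cosh v])"
        and rel: "\<forall>x\<in>I. \<epsilon> 1 * (deriv \<phi>1 x)\<^sup>2 + (deriv \<phi>2 x)\<^sup>2 = \<tau>"
        using nonnull_congruent[OF M y \<tau>1 p hyp(1,2)[OF t] cosh_0 sinh_0 hyp(3)[OF t] b,
          of "\<lambda>\<phi> \<psi> t u v. vector [\<phi> * sinh v, \<psi>, t, u, \<phi> * cosh v]"]
        by (auto simp: sum_basis5 vector_5 c algebra_simps)
      have "\<forall>s\<in>I. (deriv \<phi>1 s)\<^sup>2 - (deriv \<phi>2 s)\<^sup>2 = -1" using rel c by (auto simp: algebra_simps)
      then show ?thesis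
        using I cn by (intro exI[of _ I] exI[of _ \<phi>1] exI[of _ \<phi>2] conjI) blast+
    qed
    ultimately show ?thesis using pm[of 1] pm[of p] pm[of p'] pm[of 4] sig le \<tau>pm pos by auto
  qed
qed

text \<open>Division by the square of <c, w> turns the first hypothesis into <A, A> =
  \<sigma>.\<close>

lemma \<tau>_normalized:
  assumes "sprod w w = \<sigma> * (sprod c w)\<^sup>2" "w = \<theta> q0 *\<^sub>R n q0 + k 4 q0 *\<^sub>R e 1 q0" "\<sigma> \<in> {-1, 0, 1}"
  shows "\<tau> \<in> {-1, 0, 1}"
proof -
  have c: "sprod c w = g q0" by (simp add: g_def assms(2))
  have "sprod (A q0) (A q0) = (R q0)\<^sup>2 * sprod w w"
    by (simp add: A_def assms(2)[symmetric] sprod_simps power2_eq_square)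
  also have "\<dots> = \<sigma> * (R q0 * g q0)\<^sup>2" by (simp add: assms(1) c power_mult_distrib)
  finally have "\<tau> = \<epsilon> 1 * \<sigma>" by (simp add: \<tau>_def R_g[OF q0])
  moreover have "\<epsilon> 1 = 1 \<or> \<epsilon> 1 = -1" using eps[of 1] by (simp add: square_eq_1_iff)
  ultimately show ?thesis using assms(3) by auto
qed

end

text \<open>A nonnull axis vector is measured by a multiple of itself, so that the measure is its
  length. A lightlike one is orthogonal to itself and is paired with a multiple of
  \<open>e 1\<close>, where k_4 provides a nonzero product. Continuity keeps the measure positive on
  a small ball.\<close>

lemma (in bicons_chart) exists_cylinder_ball:
  assumes q0: "q0 \<in> U"
  shows "\<exists>r c. ball q0 r \<subseteq> U \<and> cylinder_ball (ball q0 r) y n e \<epsilon> k q0 r c \<and>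
    (\<exists>\<sigma>\<in>{-1, 0, 1}. sprod (\<theta> q0 *\<^sub>R n q0 + k 4 q0 *\<^sub>R e 1 q0) (\<theta> q0 *\<^sub>R n q0 + k 4 q0 *\<^sub>R e 1 q0) =
      \<sigma> * (sprod c (\<theta> q0 *\<^sub>R n q0 + k 4 q0 *\<^sub>R e 1 q0))\<^sup>2)"
proof -
  define W where "W = (\<lambda>q. \<theta> q *\<^sub>R n q + k 4 q *\<^sub>R e 1 q)"
  have W: "smooth_on W U"
    unfolding W_def by (intro smooth_on_add smooth_on_scaleR open_U smooth_\<theta> smooth_n smooth_k smooth_e)
  have "\<exists>c. sprod c (W q0) > 0 \<and> (\<exists>\<sigma>\<in>{-1, 0, 1}. sprod (W q0) (W q0) = \<sigma> * (sprod c (W q0))\<^sup>2)"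
  proof (cases "sprod (W q0) (W q0) = 0")
    case True
    have "sprod ((\<epsilon> 1 / k 4 q0) *\<^sub>R e 1 q0) (W q0) = 1"
      using k4[OF q0] by (simp add: W_def sprod_simps e_n[OF q0] e_orth[OF q0] eps)
    then show ?thesis using True by (intro exI[of _ "(\<epsilon> 1 / k 4 q0) *\<^sub>R e 1 q0"]) simp
  next
    case False
    let ?m = "sprod (W q0) (W q0)"
    have c: "sprod ((sgn ?m / sqrt \<bar>?m\<bar>) *\<^sub>R W q0) (W q0) = sqrt \<bar>?m\<bar>"
    proof -
      have "sgn ?m * ?m = sqrt \<bar>?m\<bar> * sqrt \<bar>?m\<bar>" by (simp add: sgn_if)
      then show ?thesis using False by (simp add: sprod_simps field_simps)
    qed
    have "?m = sgn ?m * (sqrt \<bar>?m\<bar>)\<^sup>2" by (simp add: sgn_if)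
    moreover have "sgn ?m \<in> {-1, 0, 1}" by (simp add: sgn_if)
    moreover have "sqrt \<bar>?m\<bar> > 0" using False by simp
    ultimately show ?thesis using c by metis
  qed
  then obtain c where c: "sprod c (W q0) > 0"
    and \<sigma>: "\<exists>\<sigma>\<in>{-1, 0, 1}. sprod (W q0) (W q0) = \<sigma> * (sprod c (W q0))\<^sup>2" by blast
  have "continuous_on U (\<lambda>q. sprod c (W q))"
    by (rule smooth_on_continuous_on[OF smooth_sprod_const[OF W]])
  then have "open (U \<inter> (\<lambda>q. sprod c (W q)) -` {0<..})"
    by (rule continuous_open_preimage[OF _ open_U open_greaterThan])
  then obtain r where r: "r > 0" "ball q0 r \<subseteq> U \<inter> (\<lambda>q. sprod c (W q)) -` {0<..}"
    using q0 c open_contains_ball by (metis IntI greaterThan_iff vimageI2)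
  have "cylinder_ball (ball q0 r) y n e \<epsilon> k q0 r c"
  proof (intro cylinder_ball.intro cylinder_ball_axioms.intro)
    show "bicons_chart (ball q0 r) y n e \<epsilon> k"
      by (rule bicons_chart_subset[OF bicons_chart_axioms open_ball]) (use r(2) in blast)
    show "sprod c (\<theta> q *\<^sub>R n q + k 4 q *\<^sub>R e 1 q) > 0" if "q \<in> ball q0 r" for q
      using r(2) that by (auto simp: W_def)
  qed (use r in auto)
  then show ?thesis using r(2) \<sigma> unfolding W_def by blast
qed

theorem theorem3p12:
  fixes M :: "'m topology"
    and A :: "'m param set"
    and x N :: "'m \<Rightarrow> real^5"
    and e :: "4 \<Rightarrow> 'm \<Rightarrow> real^5"
    and k :: "4 \<Rightarrow> 'm \<Rightarrow> real"
  assumes "hypersurface_index2 M A x"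
    and "unit_normal A x N"
    and "biconservative A x"
    and grad_H_nonzero: "\<And>V \<psi> q. (V, \<psi>) \<in> A \<Longrightarrow> q \<in> V \<Longrightarrow> grad_H (x \<circ> \<psi>) (N \<circ> \<psi>) q \<noteq> 0"
    and grad_H_not_lightlike: "\<And>V \<psi> q. (V, \<psi>) \<in> A \<Longrightarrow> q \<in> V \<Longrightarrow>
      sprod (grad_H (x \<circ> \<psi>) (N \<circ> \<psi>) q) (grad_H (x \<circ> \<psi>) (N \<circ> \<psi>) q) \<noteq> 0"
    and "principal_frame A x N e k"
    and e1: "\<And>V \<psi> q. (V, \<psi>) \<in> A \<Longrightarrow> q \<in> V \<Longrightarrow>
      e 1 (\<psi> q) = grad_H (x \<circ> \<psi>) (N \<circ> \<psi>) q /\<^sub>R pnorm (grad_H (x \<circ> \<psi>) (N \<circ> \<psi>) q)"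
    and k1: "\<And>p i. p \<in> topspace M \<Longrightarrow> i \<noteq> 1 \<Longrightarrow> k 1 p \<noteq> k i p"
    and k2: "\<And>p. p \<in> topspace M \<Longrightarrow> k 2 p = 0"
    and k3: "\<And>p. p \<in> topspace M \<Longrightarrow> k 3 p = 0"
    and k4: "\<And>p. p \<in> topspace M \<Longrightarrow> k 4 p \<noteq> 0"
  shows "\<forall>p \<in> topspace M. \<exists>I \<phi> \<psi>. open I \<and> is_interval I \<and> smooth_on \<phi> I \<and> smooth_on \<psi> I \<and>
    ((congruent_near M A x p I (\<lambda>s t u v. vector [t, u, \<phi> s * cos v, \<phi> s * sin v, \<psi> s]) \<and>
        (\<forall>s\<in>I. (deriv \<phi> s)\<^sup>2 + (deriv \<psi> s)\<^sup>2 = 1)) \<or>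
     (congruent_near M A x p I (\<lambda>s t u v. vector [\<phi> s * sinh v, t, u, \<phi> s * cosh v, \<psi> s]) \<and>
        (\<forall>s\<in>I. (deriv \<phi> s)\<^sup>2 + (deriv \<psi> s)\<^sup>2 = 1)) \<or>
     (congruent_near M A x p I (\<lambda>s t u v. vector [\<psi> s, t, u, \<phi> s * cos v, \<phi> s * sin v]) \<and>
        (\<forall>s\<in>I. (deriv \<phi> s)\<^sup>2 - (deriv \<psi> s)\<^sup>2 = -1)) \<or>
     (congruent_near M A x p I (\<lambda>s t u v. vector [\<phi> s * cosh v, t, u, \<phi> s * sinh v, \<psi> s]) \<and>
        (\<forall>s\<in>I. (deriv \<phi> s)\<^sup>2 - (deriv \<psi> s)\<^sup>2 = 1)) \<or>
     (congruent_near M A x p I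
          (\<lambda>s t u v. vector [v\<^sup>2 * s / 2 + \<psi> s + s, t, u, v * s, v\<^sup>2 * s / 2 + \<psi> s]) \<and>
        (\<forall>s\<in>I. 1 + 2 * deriv \<psi> s > 0)) \<or>
     (congruent_near M A x p I (\<lambda>s t u v. vector [\<phi> s * cos v, \<phi> s * sin v, t, u, \<psi> s]) \<and>
        (\<forall>s\<in>I. (deriv \<phi> s)\<^sup>2 - (deriv \<psi> s)\<^sup>2 = 1)) \<or>
     (congruent_near M A x p I (\<lambda>s t u v. vector [\<phi> s * sinh v, \<psi> s, t, u, \<phi> s * cosh v]) \<and>
        (\<forall>s\<in>I. (deriv \<phi> s)\<^sup>2 - (deriv \<psi> s)\<^sup>2 = -1)) \<or>
     (congruent_near M A x p I
          (\<lambda>s t u v. vector [s * v\<^sup>2 / 2 + \<psi> s, s * v, t, u, s * v\<^sup>2 / 2 + \<psi> s + s]) \<and>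
        (\<forall>s\<in>I. 1 + 2 * deriv \<psi> s < 0)))"
proof (rule ballI, goal_cases)
  case (1 p)
  note p = 1
  have M: "smooth_manifold M A" using assms(1) by (simp add: hypersurface_index2_def)
  obtain V \<psi>0 q0 where c: "(V, \<psi>0) \<in> A" and q0: "q0 \<in> V" and pq: "p = \<psi>0 q0"
    using M p unfolding smooth_manifold_def by blast
  define y n where "y = x \<circ> \<psi>0" and "n = N \<circ> \<psi>0"
  define E where "E = (\<lambda>i. e i \<circ> \<psi>0)"
  define K where "K = (\<lambda>i q. k i (\<psi>0 q))"
  have V: "open V" using M c by (auto simp: smooth_manifold_def local_param_def)
  have top: "\<psi>0 q \<in> topspace M" if "q \<in> V" for q
    using M c that unfolding smooth_manifold_def by blast
  have hyp: "smooth_field A x" "\<And>q. q \<in> V \<Longrightarrow> inj (Fd y q)"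
    using assms(1) c unfolding hypersurface_index2_def y_def by auto
  have nrm: "smooth_field A N" "\<And>q. q \<in> V \<Longrightarrow> sprod (n q) (n q) = 1"
      "\<And>q h. q \<in> V \<Longrightarrow> sprod (n q) (Fd y q h) = 0"
    using assms(2) c unfolding unit_normal_def y_def n_def tangent_space_def by auto
  have fr: "smooth_field A (e i)" "\<And>q. q \<in> V \<Longrightarrow> E i q \<in> range (Fd y q)"
      "\<And>q. q \<in> V \<Longrightarrow> \<bar>sprod (E i q) (E i q)\<bar> = 1" "\<And>q. q \<in> V \<Longrightarrow> i \<noteq> j \<Longrightarrow> sprod (E i q) (E j q) = 0" for i j
    using assms(6) c unfolding principal_frame_def orthonormal_frame_def y_def E_def tangent_space_def by auto
  have sh: "Fd n q (inv (Fd y q) (E i q)) = - (K i q *\<^sub>R E i q)" if "q \<in> V" for i q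
  proof -
    have "shape_operator y n q (E i q) = K i q *\<^sub>R E i q"
      using assms(6) c that unfolding principal_frame_def y_def n_def E_def K_def by auto
    then show ?thesis by (simp add: shape_operator_def deriv_along_def minus_equation_iff[of "Fd n q _"])
  qed
  have bic: "tangential_part y q (laplace_vec y (laplace_vec y y) q) = 0" if "q \<in> V" for q
    using assms(3) c that unfolding biconservative_def y_def Let_def by blast
  have grad: "\<exists>b. b \<noteq> 0 \<and> grad_H y n q = b *\<^sub>R E 1 q" if q: "q \<in> V" for q
  proof -
    have "pnorm (grad_H y n q) \<noteq> 0"
      using grad_H_not_lightlike[OF c q] by (simp add: pnorm_def y_def n_def)
    moreover have "E 1 q = grad_H y n q /\<^sub>R pnorm (grad_H y n q)"
      using e1[OF c q] by (simp add: y_def n_def E_def)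
    ultimately show ?thesis by (intro exI[of _ "pnorm (grad_H y n q)"]) simp
  qed
  have sm: "smooth_on y V" "smooth_on n V" "smooth_on (E i) V" for i
    using hyp(1) nrm(1) fr(1)[of i] c unfolding smooth_field_def y_def n_def E_def by auto
  obtain r0 where r0: "r0 > 0" "ball q0 r0 \<subseteq> V" using V q0 open_contains_ball by blast
  define \<epsilon> where "\<epsilon> = (\<lambda>i. sprod (E i q0) (E i q0))"
  \<comment> \<open>A continuous function with values 1 and -1 is constant on the connected
    ball.\<close>
  have \<epsilon>: "sprod (E i q) (E i q) = \<epsilon> i" if q: "q \<in> ball q0 r0" for i q
  proof -
    have "continuous_on (ball q0 r0) (\<lambda>q. sprod (E i q) (E i q))"
      by (rule continuous_on_subset[OF smooth_on_continuous_on[OF smooth_on_sprod[OF V sm(3) sm(3)]] r0(2)])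
    moreover have "(\<lambda>q. sprod (E i q) (E i q)) ` ball q0 r0 \<subseteq> {1, -1}"
      using fr(3)[of _ i] r0(2) by (force simp: abs_if split: if_splits)
    then have "finite ((\<lambda>q. sprod (E i q) (E i q)) ` ball q0 r0)" by (rule finite_subset) simp
    ultimately have "(\<lambda>q. sprod (E i q) (E i q)) constant_on ball q0 r0"
      by (rule continuous_finite_range_constant[OF connected_ball])
    then show ?thesis using q r0(1) unfolding constant_on_def \<epsilon>_def by (metis centre_in_ball)
  qed
  have \<epsilon>1: "\<epsilon> i * \<epsilon> i = 1" for i
    using fr(3)[OF q0, of i] unfolding \<epsilon>_def by (metis abs_mult_self_eq mult_1)
  have sub: "q \<in> V" if "q \<in> ball q0 r0" for q using r0(2) that by blast
  have chart: "bicons_chart (ball q0 r0) y n E \<epsilon> K"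
  proof (intro bicons_chart.intro principal_chart.intro bicons_chart_axioms.intro)
    show "sprod (E i q) (E j q) = (if i = j then \<epsilon> i else 0)" if "q \<in> ball q0 r0" for i j q
      using \<epsilon>[OF that] fr(4)[OF sub[OF that]] by simp
    show "K 1 q \<noteq> K i q" if "q \<in> ball q0 r0" "i \<noteq> 1" for i q
      unfolding K_def by (rule k1[OF top[OF sub[OF that(1)]] that(2)])
    show "K 2 q = 0" "K 3 q = 0" "K 4 q \<noteq> 0" if "q \<in> ball q0 r0" for q
      using k2 k3 k4 top[OF sub[OF that]] by (simp_all add: K_def)
    show "smooth_on (E i) (ball q0 r0)" for i by (rule smooth_on_subset[OF sm(3) r0(2)])
  qed (use sm smooth_on_subset[OF _ r0(2)] hyp(2) nrm(2,3) fr(2) \<epsilon>1 sh bic grad sub in \<open>simp_all\<close>)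
  obtain r c' where r: "ball q0 r \<subseteq> ball q0 r0" and cyl: "cylinder_ball (ball q0 r) y n E \<epsilon> K q0 r c'"
    and \<sigma>: "\<exists>\<sigma>\<in>{-1, 0, 1}. sprod (bicons_chart.\<theta> y E \<epsilon> q0 *\<^sub>R n q0 + K 4 q0 *\<^sub>R E 1 q0)
        (bicons_chart.\<theta> y E \<epsilon> q0 *\<^sub>R n q0 + K 4 q0 *\<^sub>R E 1 q0) =
      \<sigma> * (sprod c' (bicons_chart.\<theta> y E \<epsilon> q0 *\<^sub>R n q0 + K 4 q0 *\<^sub>R E 1 q0))\<^sup>2"
    using bicons_chart.exists_cylinder_ball[OF chart, of q0] r0(1) by auto
  have rV: "ball q0 r \<subseteq> V" using r r0(2) by blast
  obtain \<sigma> where \<sigma>: "\<sigma> \<in> {-1, 0, 1}" "sprod (bicons_chart.\<theta> y E \<epsilon> q0 *\<^sub>R n q0 + K 4 q0 *\<^sub>R E 1 q0)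
        (bicons_chart.\<theta> y E \<epsilon> q0 *\<^sub>R n q0 + K 4 q0 *\<^sub>R E 1 q0) =
      \<sigma> * (sprod c' (bicons_chart.\<theta> y E \<epsilon> q0 *\<^sub>R n q0 + K 4 q0 *\<^sub>R E 1 q0))\<^sup>2"
    using \<sigma> by blast
  show ?case
    unfolding pq
    by (rule cylinder_ball.classification[OF cyl M c rV _ cylinder_ball.\<tau>_normalized[OF cyl \<sigma>(2) refl \<sigma>(1)]])
       (simp add: y_def)
qed

end
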